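(* There exists a real-analytic flow on the torus $\mathbb{T}^2$, preserving a smooth probability measure and weakly mixing with respect to it, that is not reversible.
   Context: A smooth measure is a measure with a smooth strictly positive density with respect to Lebesgue measure on $\mathbb{T}^2$. A measure-preserving flow $(T_t)_{t\in\mathbb{R}}$ on $(X,\mathcal{B},\mu)$ is reversible if there is an invertible measure-preserving map $S:X\to X$ with $T_t\circ S=S\circ T_{-t}$ for each $t\in\mathbb{R}$ and $S^2=\mathrm{Id}$. *)

theory Defs
  imports "HOL-Probability.Probability"
begin

definition measure_preserving :: "'a measure \<Rightarrow> ('a \<Rightarrow> 'a) \<Rightarrow> bool" where
  "measure_preserving M S \<longleftrightarrow> S \<in> measurable M M \<and> distr M M S = M"

text \<open>As usual in ergodic theory, invertibility is understood up to null sets.\<close>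

definition invertible_measure_preserving :: "'a measure \<Rightarrow> ('a \<Rightarrow> 'a) \<Rightarrow> bool" where
  "invertible_measure_preserving M S \<longleftrightarrow> measure_preserving M S \<and>
     (\<exists>R. measure_preserving M R \<and> (AE x in M. R (S x) = x) \<and> (AE x in M. S (R x) = x))"

definition flow_on :: "'a set \<Rightarrow> (real \<Rightarrow> 'a \<Rightarrow> 'a) \<Rightarrow> bool" where
  "flow_on X T \<longleftrightarrow>
     (\<forall>t. \<forall>x\<in>X. T t x \<in> X) \<and>
     (\<forall>x\<in>X. T 0 x = x) \<and>
     (\<forall>s t. \<forall>x\<in>X. T (s + t) x = T s (T t x))"

definition measure_preserving_flow :: "'a measure \<Rightarrow> (real \<Rightarrow> 'a \<Rightarrow> 'a) \<Rightarrow> bool" where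
  "measure_preserving_flow M T \<longleftrightarrow>
     flow_on (space M) T \<and>
     (\<lambda>(t, x). T t x) \<in> measurable (borel \<Otimes>\<^sub>M M) M \<and>
     (\<forall>t. measure_preserving M (T t))"

text \<open>
  For a measure-preserving flow on a probability space the integrand below is bounded and
  Borel measurable in \<open>t\<close>, so the integral is a genuine one.
\<close>

definition weakly_mixing :: "'a measure \<Rightarrow> (real \<Rightarrow> 'a \<Rightarrow> 'a) \<Rightarrow> bool" where
  "weakly_mixing M T \<longleftrightarrow>
     (\<forall>A\<in>sets M. \<forall>B\<in>sets M.
        ((\<lambda>R. (1 / R) * (LINT t:{0..R}|lborel.
            \<bar>measure M (T t -` A \<inter> B) - measure M A * measure M B\<bar>)) \<longlongrightarrow> 0) at_top)"

text \<open>
  Equalities between measurable maps hold almost everywhere; the exceptional null set in the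
  intertwining relation may depend on \<open>t\<close>.
\<close>

definition reversible :: "'a measure \<Rightarrow> (real \<Rightarrow> 'a \<Rightarrow> 'a) \<Rightarrow> bool" where
  "reversible M T \<longleftrightarrow>
     (\<exists>S. invertible_measure_preserving M S \<and>
          (\<forall>t. AE x in M. T t (S x) = S (T (- t) x)) \<and>
          (AE x in M. S (S x) = x))"

primrec times_differentiable ::
    "nat \<Rightarrow> ('a::real_normed_vector \<Rightarrow> 'b::real_normed_vector) \<Rightarrow> bool" where
  "times_differentiable 0 f \<longleftrightarrow> continuous_on UNIV f"
| "times_differentiable (Suc k) f \<longleftrightarrow>
     (\<forall>x. f differentiable (at x)) \<and>
     (\<forall>v. times_differentiable k (\<lambda>x. frechet_derivative f (at x) v))"

definition smooth :: "('a::euclidean_space \<Rightarrow> 'b::real_normed_vector) \<Rightarrow> bool" where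
  "smooth f \<longleftrightarrow> (\<forall>k. times_differentiable k f)"

text \<open>
  Around every point \<open>f\<close> is the sum of an (unconditionally convergent) power series in the
  coordinates with respect to \<open>Basis\<close>; multi-indices are the extensional functions
  \<open>Basis \<rightarrow>\<^sub>E UNIV\<close> into the natural numbers.
\<close>

definition real_analytic :: "('a::euclidean_space \<Rightarrow> 'b::euclidean_space) \<Rightarrow> bool" where
  "real_analytic f \<longleftrightarrow>
     (\<forall>p. \<exists>r>0. \<exists>c :: ('a \<Rightarrow> nat) \<Rightarrow> 'b. \<forall>x\<in>ball p r.
        ((\<lambda>\<alpha>. (\<Prod>b\<in>Basis. ((x - p) \<bullet> b) ^ \<alpha> b) *\<^sub>R c \<alpha>) has_sum f x) (Basis \<rightarrow>\<^sub>E UNIV))"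

text \<open>
  The torus is realised as the product of two unit circles, embedded in \<open>\<complex> \<times> \<complex>\<close>; the covering
  map induces the usual identification with the quotient of the plane by the integer lattice.
\<close>

definition torus :: "(complex \<times> complex) set" where
  "torus = sphere 0 1 \<times> sphere 0 1"

definition torus_proj :: "real \<times> real \<Rightarrow> complex \<times> complex" where
  "torus_proj p = (cis (2 * pi * fst p), cis (2 * pi * snd p))"

definition torus_lebesgue :: "(complex \<times> complex) measure" where
  "torus_lebesgue =
     distr (restrict_space lborel ({0..<1} \<times> {0..<1})) (restrict_space borel torus) torus_proj"

text \<open>
  The covering map is a local diffeomorphism, so a function on the torus is smooth iff its lift
  to the plane is.
\<close>

definition smooth_torus_measure :: "(complex \<times> complex) measure \<Rightarrow> bool" where
  "smooth_torus_measure \<mu> \<longleftrightarrow>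
     (\<exists>h :: complex \<times> complex \<Rightarrow> real.
        (\<forall>z\<in>torus. 0 < h z) \<and> smooth (\<lambda>p. h (torus_proj p)) \<and>
        \<mu> = density torus_lebesgue (\<lambda>z. ennreal (h z)))"

text \<open>
  Joint analyticity of the action in time and space. The covering map is a local analytic
  isomorphism and the torus is an analytic submanifold of \<open>\<complex> \<times> \<complex>\<close>, so it can be tested on the
  lift to \<open>\<real> \<times> \<real>\<^sup>2\<close>, with values in the ambient space.
\<close>

definition real_analytic_torus_flow ::
    "(real \<Rightarrow> complex \<times> complex \<Rightarrow> complex \<times> complex) \<Rightarrow> bool" where
  "real_analytic_torus_flow T \<longleftrightarrow>
     flow_on torus T \<and>
     real_analytic (\<lambda>q :: real \<times> real \<times> real. T (fst q) (torus_proj (snd q)))"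

end

theory Submission
  imports Defs "HOL-Real_Asymp.Real_Asymp" "HOL-Complex_Analysis.Complex_Analysis"
begin

text \<open>
  The flow is a time change of the linear flow \<open>R\<^sub>s (x, y) = (x + \<alpha> s, y + s)\<close> of Liouville slope
  \<open>\<alpha> = \<Sum>k. 1 / q\<^sub>k\<close>. With \<open>p\<^sub>n\<close> the nearest integer to \<open>q\<^sub>n \<alpha>\<close>, \<open>\<delta>\<^sub>n = q\<^sub>n \<alpha> - p\<^sub>n\<close>,
  \<open>w\<^sub>n = q\<^sub>n x - p\<^sub>n y\<close> and \<open>h w = cos (2 \<pi> w) + cos (4 \<pi> w)\<close>, the time needed to follow the linear
  orbit up to parameter \<open>s\<close> is \<open>s + (\<Sum>n. M\<^sub>n (h (w\<^sub>n + \<delta>\<^sub>n s) - h w\<^sub>n))\<close>. Its derivative in \<open>s\<close> is an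
  analytic density close to 1, because \<open>\<delta>\<^sub>n\<close> is extremely small; the amplitudes \<open>M\<^sub>n\<close> take every
  natural number infinitely often.

  At the rigidity times \<open>\<tau>\<^sub>n \<approx> 1 / (4 \<delta>\<^sub>n)\<close> of the linear flow all terms except the \<open>n\<close>-th are
  negligible, so \<open>T\<close> at time \<open>j \<tau>\<^sub>n\<close> moves \<open>z\<close> along its own orbit by about
  \<open>- M\<^sub>n (h (w\<^sub>n + j / 4) - h w\<^sub>n)\<close>, and \<open>w\<^sub>n\<close> equidistributes independently of \<open>z\<close>. For large \<open>M\<^sub>n\<close>
  the time \<open>2 \<tau>\<^sub>n\<close> spreads points over long orbit segments, which gives mixing along a sequence of
  times, hence weak mixing. For \<open>M\<^sub>n = 1\<close> a reversing map would force the pair of successive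
  increments \<open>(h (w + 1/4) - h w, h (w + 1/2) - h (w + 1/4))\<close>, with \<open>w\<close> uniform, to be exchangeable,
  which a third moment refutes.
\<close>

section \<open>Haar measure on the torus\<close>

text \<open>Two harmonics in \<open>h\<close> are essential. As \<open>h\<close> is even, the pair
  \<open>(x, y)\<close> of successive quarter-turn increments has the same law as
  \<open>(- y, - x)\<close>. With a single cosine a half turn of the phase would also give
  \<open>(- x, - y)\<close>, so the pair would be exchangeable and no contradiction could arise. The
  second harmonic is unchanged by a half turn and breaks this symmetry. For the same reason it drops
  out at time \<open>2 * tau n\<close>, where the displacement is a pure cosine.

  Analyticity asks that \<open>amp n * drift n\<close> beat the exponential growth of the
  \<open>n\<close>-th phase function on a complex strip, whose rate is proportional to
  \<open>den n\<close>; this dictates the growth of the denominators.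

  The obstacle in the irreversibility part is that a reversing map is merely measurable and
  satisfies its relation at each time only up to a null set, while the times at which it has to be
  applied depend on the point. Fubini in time removes this dependence. Continuity of rotations in
  \<open>L1\<close>, together with a separation estimate for orbits that is linear in the distance,
  then turns the relation into an estimate in mean.\<close>

definition rot :: "complex \<times> complex \<Rightarrow> complex \<times> complex \<Rightarrow> complex \<times> complex" where
  "rot c z = (fst c * fst z, snd c * snd z)"

lemma torus_iff: "z \<in> torus \<longleftrightarrow> cmod (fst z) = 1 \<and> cmod (snd z) = 1"
  by (cases z) (auto simp: torus_def)

lemma torus_proj_in_torus [simp]: "torus_proj p \<in> torus"
  by (simp add: torus_iff torus_proj_def)

lemma torus_proj_surj: assumes "z \<in> torus" obtains p where "z = torus_proj p"
proof -
  obtain a b where "fst z = cis a" "snd z = cis b"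
    using assms by (metis torus_iff complex_norm_eq_1_exp cis_conv_exp)
  then have "z = torus_proj (a / (2*pi), b / (2*pi))" by (simp add: torus_proj_def prod_eq_iff)
  then show ?thesis using that by blast
qed

lemma rot_in_torus [simp]: "c \<in> torus \<Longrightarrow> z \<in> torus \<Longrightarrow> rot c z \<in> torus"
  by (simp add: torus_iff rot_def norm_mult)

lemma rot_torus_proj: "rot (torus_proj p) (torus_proj q) = torus_proj (p + q)"
  by (simp add: rot_def torus_proj_def cis_mult distrib_left)

lemma rot_proj_rot_proj: "rot (torus_proj p) (rot (torus_proj q) z) = rot (torus_proj (p + q)) z"
  by (simp add: rot_def torus_proj_def mult.assoc[symmetric] cis_mult distrib_left)

text \<open>Factors of modulus 1 preserve the metric, so a rotation displaces all points equally
  far; near-returns of the linear flow are thereby uniform in the starting point.\<close>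

lemma dist_rot: assumes "z \<in> torus" shows "dist (rot c z) z = dist c (1, 1)"
proof -
  have "dist (fst c * fst z) (fst z) = dist (fst c) 1"
    using assms by (simp add: dist_norm torus_iff left_diff_distrib[of "fst c" 1 "fst z", simplified, symmetric] norm_mult)
  moreover have "dist (snd c * snd z) (snd z) = dist (snd c) 1"
    using assms by (simp add: dist_norm torus_iff left_diff_distrib[of "snd c" 1 "snd z", simplified, symmetric] norm_mult)
  ultimately show ?thesis
    by (cases c) (simp add: dist_prod_def rot_def)
qed

lemma compact_torus: "compact torus"
  by (simp add: torus_def compact_Times)

lemma torus_borel [measurable]: "torus \<in> sets borel"
  by (simp add: borel_compact compact_torus)

lemma continuous_torus_proj: "continuous_on A torus_proj"
  unfolding torus_proj_def by (intro continuous_intros)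

lemma continuous_rot: "continuous_on A (rot c)"
  unfolding rot_def by (intro continuous_intros)

abbreviation "torus_borel_space \<equiv> restrict_space (borel :: (complex \<times> complex) measure) torus"

lemma torus_proj_measurable [measurable]: "torus_proj \<in> borel \<rightarrow>\<^sub>M torus_borel_space"
  by (intro measurable_restrict_space2 borel_measurable_continuous_onI continuous_torus_proj) auto

lemma rot_measurable: "c \<in> torus \<Longrightarrow> rot c \<in> torus_borel_space \<rightarrow>\<^sub>M torus_borel_space"
  by (intro measurable_restrict_space3 borel_measurable_continuous_onI continuous_rot) auto

lemma space_torus_lebesgue [simp]: "space torus_lebesgue = torus"
  by (simp add: torus_lebesgue_def space_restrict_space)

lemma sets_torus_lebesgue [measurable_cong, simp]: "sets torus_lebesgue = sets torus_borel_space"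
  by (simp add: torus_lebesgue_def)

lemma nn_integral_torus_lebesgue:
  assumes f [measurable]: "f \<in> borel_measurable torus_borel_space"
  shows "(\<integral>\<^sup>+z. f z \<partial>torus_lebesgue) =
    (\<integral>\<^sup>+x. (\<integral>\<^sup>+y. f (torus_proj (x, y)) * indicator {0..<1} y \<partial>lborel) * indicator {0..<1} x \<partial>lborel)"
proof -
  have [measurable]: "{0..<1} \<times> {0..<1::real} \<in> sets (borel :: (real \<times> real) measure)"
    by (metis borel_prod lborelD pair_measureI sets_lborel atLeastLessThan_borel)
  have [measurable]: "(\<lambda>p. f (torus_proj p)) \<in> borel_measurable (lborel \<Otimes>\<^sub>M lborel)"
    using measurable_compose[OF torus_proj_measurable f] by (simp add: lborel_prod)
  have "(\<integral>\<^sup>+z. f z \<partial>torus_lebesgue) =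
      (\<integral>\<^sup>+p. f (torus_proj p) \<partial>restrict_space lborel ({0..<1} \<times> {0..<1}))"
    unfolding torus_lebesgue_def
    by (subst nn_integral_distr) (auto intro!: measurable_restrict_space1)
  also have "\<dots> = (\<integral>\<^sup>+p. f (torus_proj p) * indicator ({0..<1} \<times> {0..<1}) p \<partial>lborel)"
    by (subst nn_integral_restrict_space) auto
  also have "\<dots> = (\<integral>\<^sup>+p. f (torus_proj p) * indicator ({0..<1} \<times> {0..<1}) p \<partial>(lborel \<Otimes>\<^sub>M lborel))"
    by (simp add: lborel_prod)
  also have "\<dots> = (\<integral>\<^sup>+x. (\<integral>\<^sup>+y. f (torus_proj (x, y)) * indicator ({0..<1} \<times> {0..<1}) (x, y) \<partial>lborel) \<partial>lborel)"
    by (subst lborel.nn_integral_fst[symmetric]) measurable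
  also have "\<dots> = (\<integral>\<^sup>+x. (\<integral>\<^sup>+y. (f (torus_proj (x, y)) * indicator {0..<1} y) * indicator {0..<1} x \<partial>lborel) \<partial>lborel)"
    by (intro nn_integral_cong) (auto simp: indicator_def)
  also have "\<dots> = (\<integral>\<^sup>+x. (\<integral>\<^sup>+y. f (torus_proj (x, y)) * indicator {0..<1} y \<partial>lborel) * indicator {0..<1} x \<partial>lborel)"
    by (intro nn_integral_cong nn_integral_multc) measurable
  finally show ?thesis .
qed

text \<open>Only the fractional part \<open>v\<close> of the shift matters. The window
  \<open>{v..<1+v}\<close> is cut at 1 and the overhanging piece is moved back by one
  period.\<close>

lemma nn_integral_periodic_shift:
  fixes F :: "real \<Rightarrow> ennreal"
  assumes [measurable]: "F \<in> borel_measurable borel" and per: "\<And>x. F (x + 1) = F x"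
  shows "(\<integral>\<^sup>+x. F (x + u) * indicator {0..<1} x \<partial>lborel) = (\<integral>\<^sup>+x. F x * indicator {0..<1} x \<partial>lborel)"
proof -
  have pern: "F (x + real n) = F x" for x n
    by (induction n) (simp_all add: per add.assoc[symmetric] add.commute[of 1] )
  have peri: "F (x + of_int k) = F x" for x k
    using pern[of x "nat k"] pern[of "x + of_int k" "nat (-k)"] by (cases "k \<ge> 0") auto
  define v where "v = frac u"
  have v: "0 \<le> v" "v < 1" by (auto simp: v_def frac_lt_1)
  have u: "F (x + u) = F (x + v)" for x
    using peri[of "x + v" "\<lfloor>u\<rfloor>"] by (simp add: v_def frac_def add.assoc)
  have sh: "(\<integral>\<^sup>+x. F (x + a) * indicator {b..<c} x \<partial>lborel) = (\<integral>\<^sup>+x. F x * indicator {b+a..<c+a} x \<partial>lborel)" for a b c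
    by (subst nn_integral_real_affine[where c = 1 and t = a and f = "\<lambda>x. F x * indicator {b+a..<c+a} x"])
       (auto intro!: nn_integral_cong simp: indicator_def add.commute)
  have "(\<integral>\<^sup>+x. F (x + u) * indicator {0..<1} x \<partial>lborel) = (\<integral>\<^sup>+x. F x * indicator {v..<1+v} x \<partial>lborel)"
    using sh[of v 0 1] by (simp add: u)
  also have "\<dots> = (\<integral>\<^sup>+x. F x * indicator {v..<1} x + F x * indicator {1..<1+v} x \<partial>lborel)"
    using v by (intro nn_integral_cong) (auto simp: indicator_def)
  also have "\<dots> = (\<integral>\<^sup>+x. F x * indicator {v..<1} x \<partial>lborel) + (\<integral>\<^sup>+x. F x * indicator {1..<1+v} x \<partial>lborel)"
    by (intro nn_integral_add) auto
  also have "(\<integral>\<^sup>+x. F x * indicator {1..<1+v} x \<partial>lborel) = (\<integral>\<^sup>+x. F x * indicator {0..<v} x \<partial>lborel)"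
    using sh[of 1 0 v] by (simp add: per add.commute)
  also have "(\<integral>\<^sup>+x. F x * indicator {v..<1} x \<partial>lborel) + (\<integral>\<^sup>+x. F x * indicator {0..<v} x \<partial>lborel)
     = (\<integral>\<^sup>+x. F x * indicator {v..<1} x + F x * indicator {0..<v} x \<partial>lborel)"
    by (intro nn_integral_add[symmetric]) auto
  also have "\<dots> = (\<integral>\<^sup>+x. F x * indicator {0..<1} x \<partial>lborel)"
    using v by (intro nn_integral_cong) (auto simp: indicator_def)
  finally show ?thesis .
qed

lemma torus_proj_periodic: "torus_proj (x + 1, y) = torus_proj (x, y)" "torus_proj (x, y + 1) = torus_proj (x, y)"
  by (simp_all add: torus_proj_def distrib_left cis_mult[symmetric])

lemma nn_integral_rot:
  assumes f [measurable]: "f \<in> borel_measurable torus_borel_space" and c: "c \<in> torus"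
  shows "(\<integral>\<^sup>+z. f (rot c z) \<partial>torus_lebesgue) = (\<integral>\<^sup>+z. f z \<partial>torus_lebesgue)"
proof -
  obtain u v where c_eq: "c = torus_proj (u, v)" using torus_proj_surj[OF c] by (metis surj_pair)
  note [measurable] = measurable_compose[OF torus_proj_measurable f]
  have [measurable]: "(\<lambda>(x,y). f (torus_proj (x, y))) \<in> borel_measurable (borel \<Otimes>\<^sub>M borel)"
    by (simp add: borel_prod case_prod_unfold)
  have m: "(\<lambda>z. f (rot c z)) \<in> borel_measurable torus_borel_space"
    using measurable_compose[OF rot_measurable[OF c] f] .
  have "(\<integral>\<^sup>+z. f (rot c z) \<partial>torus_lebesgue) =
     (\<integral>\<^sup>+x. (\<integral>\<^sup>+y. f (torus_proj (x + u, y + v)) * indicator {0..<1} y \<partial>lborel) * indicator {0..<1} x \<partial>lborel)"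
    unfolding nn_integral_torus_lebesgue[OF m] by (simp add: c_eq rot_torus_proj add.commute)
  also have "\<dots> = (\<integral>\<^sup>+x. (\<integral>\<^sup>+y. f (torus_proj (x + u, y)) * indicator {0..<1} y \<partial>lborel) * indicator {0..<1} x \<partial>lborel)"
    by (intro nn_integral_cong arg_cong2[where f = times] refl
        nn_integral_periodic_shift[where F = "\<lambda>y. f (torus_proj (_ + u, y))"]) (auto simp: torus_proj_periodic)
  also have "\<dots> = (\<integral>\<^sup>+x. (\<integral>\<^sup>+y. f (torus_proj (x, y)) * indicator {0..<1} y \<partial>lborel) * indicator {0..<1} x \<partial>lborel)"
    by (rule nn_integral_periodic_shift[where F = "\<lambda>x. \<integral>\<^sup>+y. f (torus_proj (x, y)) * indicator {0..<1} y \<partial>lborel"])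
       (auto simp: torus_proj_periodic)
  also have "\<dots> = (\<integral>\<^sup>+z. f z \<partial>torus_lebesgue)"
    by (simp add: nn_integral_torus_lebesgue)
  finally show ?thesis .
qed

lemma distr_rot: assumes "c \<in> torus" shows "distr torus_lebesgue torus_lebesgue (rot c) = torus_lebesgue"
proof (rule measure_eqI)
  have [measurable]: "rot c \<in> torus_lebesgue \<rightarrow>\<^sub>M torus_lebesgue"
    using rot_measurable[OF assms] by (simp cong: measurable_cong_sets)
  fix A assume "A \<in> sets (distr torus_lebesgue torus_lebesgue (rot c))"
  then have A [measurable]: "A \<in> sets torus_lebesgue" by simp
  have [measurable]: "indicator A \<in> borel_measurable torus_borel_space"
    using A by (intro borel_measurable_indicator) simp
  have "emeasure (distr torus_lebesgue torus_lebesgue (rot c)) A = (\<integral>\<^sup>+z. indicator A z \<partial>distr torus_lebesgue torus_lebesgue (rot c))"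
    using A by (subst nn_integral_indicator) simp_all
  also have "\<dots> = (\<integral>\<^sup>+z. indicator A (rot c z) \<partial>torus_lebesgue)"
    by (subst nn_integral_distr) auto
  also have "\<dots> = emeasure torus_lebesgue A"
    using A by (subst nn_integral_rot[OF _ assms]) auto
  finally show "emeasure (distr torus_lebesgue torus_lebesgue (rot c)) A = emeasure torus_lebesgue A" .
qed simp

lemma prob_space_torus_lebesgue: "prob_space torus_lebesgue"
proof
  have "emeasure torus_lebesgue (space torus_lebesgue) = (\<integral>\<^sup>+z. 1 \<partial>torus_lebesgue)" by simp
  also have "\<dots> = 1" by (subst nn_integral_torus_lebesgue) simp_all
  finally show "emeasure torus_lebesgue (space torus_lebesgue) = 1" .
qed

interpretation leb: prob_space torus_lebesgue
  by (rule prob_space_torus_lebesgue)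

lemma rot_measurable_lebesgue [measurable]: "c \<in> torus \<Longrightarrow> rot c \<in> torus_lebesgue \<rightarrow>\<^sub>M torus_lebesgue"
  using rot_measurable by (simp cong: measurable_cong_sets)

lemma integral_rot:
  fixes f :: "_ \<Rightarrow> 'b :: {banach, second_countable_topology}"
  assumes "c \<in> torus" "f \<in> borel_measurable torus_lebesgue"
  shows "(\<integral>z. f (rot c z) \<partial>torus_lebesgue) = (\<integral>z. f z \<partial>torus_lebesgue)"
  using integral_distr[of "rot c" torus_lebesgue torus_lebesgue f] assms by (simp add: distr_rot)

lemma integrable_rot:
  fixes f :: "_ \<Rightarrow> 'b :: {banach, second_countable_topology}"
  assumes "c \<in> torus" "integrable torus_lebesgue f"
  shows "integrable torus_lebesgue (\<lambda>z. f (rot c z))"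
  using integrable_distr[of "rot c" torus_lebesgue torus_lebesgue f] assms by (simp add: distr_rot)

section \<open>Continuous functions and approximation in \<open>L1\<close> on the torus\<close>

lemma borel_measurable_continuous_torus:
  fixes f :: "_ \<Rightarrow> 'b :: topological_space"
  assumes "continuous_on torus f" shows "f \<in> borel_measurable torus_lebesgue"
  using borel_measurable_continuous_on_restrict[OF assms] by (simp cong: measurable_cong_sets)

lemma continuous_torus_bounded:
  fixes f :: "_ \<Rightarrow> 'b :: real_normed_vector"
  assumes "continuous_on torus f" obtains B where "B > 0" "\<And>z. z \<in> torus \<Longrightarrow> norm (f z) \<le> B"
proof -
  have "bounded (f ` torus)"
    using compact_continuous_image[OF assms compact_torus] by (rule compact_imp_bounded)
  then show ?thesis using that unfolding bounded_pos by blast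
qed

lemma integrable_continuous_torus:
  fixes f :: "_ \<Rightarrow> 'b :: {banach, second_countable_topology}"
  assumes "continuous_on torus f" shows "integrable torus_lebesgue f"
proof -
  obtain B where "B > 0" "\<And>z. z \<in> torus \<Longrightarrow> norm (f z) \<le> B"
    using continuous_torus_bounded[OF assms] by blast
  then show ?thesis
    by (intro leb.integrable_const_bound[where B = B] borel_measurable_continuous_torus assms AE_I2) auto
qed

text \<open>By regularity \<open>A\<close> lies between a compact and an open set of nearly equal
  measure; Urysohn's lemma supplies a function between their indicators.\<close>

lemma indicator_approx_continuous:
  assumes A: "A \<in> sets torus_lebesgue" and e: "e > 0"
  obtains g :: "complex \<times> complex \<Rightarrow> real" where "continuous_on UNIV g" "\<And>z. 0 \<le> g z \<and> g z \<le> 1"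
    "(\<integral>z. \<bar>indicator A z - g z\<bar> \<partial>torus_lebesgue) < e"
proof -
  \<comment> \<open>The same measure carried by the whole ambient space, where inner and outer
    regularity of finite Borel measures apply.\<close>
  define N where "N = distr torus_lebesgue borel (\<lambda>z. z)"
  have idm [measurable]: "(\<lambda>z. z) \<in> torus_lebesgue \<rightarrow>\<^sub>M borel"
    by (rule borel_measurable_continuous_torus) (intro continuous_intros)
  interpret N: prob_space N unfolding N_def by (rule leb.prob_space_distr) simp
  have AB: "A \<in> sets borel" using A by (auto simp: sets_restrict_space)
  have At: "A \<subseteq> torus" using sets.sets_into_space[OF A] by simp
  have N: "emeasure N B = emeasure torus_lebesgue (B \<inter> torus)" if "B \<in> sets borel" for B
    using that unfolding N_def by (subst emeasure_distr) auto
  have sN: "sets N = sets borel" by (simp add: N_def)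
  have fin: "emeasure N (space N) \<noteq> \<infinity>" by simp
  have "emeasure N A < emeasure N A + ennreal (e/2)" using e 
    by (simp add: N.emeasure_eq_measure ennreal_plus[symmetric] ennreal_less_iff del: ennreal_plus) 
  then obtain U where U: "A \<subseteq> U" "open U" "emeasure N U < emeasure N A + ennreal (e/2)"
    unfolding outer_regular[OF sN fin AB] by (subst (asm) INF_less_iff) blast
  \<comment> \<open>If no compact \<open>K\<close> came within \<open>e/2\<close>, the supremum that
    expresses inner regularity would be at most \<open>measure N A - e/2\<close>.\<close>
  have "\<exists>K. K \<subseteq> A \<and> compact K \<and> emeasure N A < emeasure N K + ennreal (e/2)"
  proof (rule ccontr)
    assume "\<not> ?thesis"
    then have *: "emeasure N K + ennreal (e/2) \<le> emeasure N A" if "K \<subseteq> A" "compact K" for K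
      using that by (meson not_le)
    have m: "measure N K + e/2 \<le> measure N A" if "K \<subseteq> A" "compact K" for K
      using *[OF that] e by (simp add: N.emeasure_eq_measure ennreal_plus[symmetric] del: ennreal_plus)
    have "measure N A \<ge> e/2" using m[of "{}"] by simp
    have "emeasure N A \<le> ennreal (measure N A - e/2)"
      unfolding inner_regular[OF sN fin AB]
    proof (rule SUP_least)
      fix K assume "K \<in> {K. K \<subseteq> A \<and> compact K}"
      then have "measure N K \<le> measure N A - e/2" using m[of K] by auto
      then show "emeasure N K \<le> ennreal (measure N A - e/2)"
        by (auto simp: N.emeasure_eq_measure intro!: ennreal_leI)
    qed
    then show False using e \<open>measure N A \<ge> e/2\<close> by (simp add: N.emeasure_eq_measure)
  qed
  then obtain K where K: "K \<subseteq> A" "compact K" "emeasure N A < emeasure N K + ennreal (e/2)" by blast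
  have [measurable]: "U \<in> sets borel" "K \<in> sets borel" using U K by (auto simp: borel_compact)
  have mU: "measure N U < measure N A + e/2" and mK: "measure N A < measure N K + e/2"
    using U(3) K(3) e by (auto simp: N.emeasure_eq_measure ennreal_plus[symmetric] ennreal_less_iff simp del: ennreal_plus)
  have cl: "closed K" "closed (-U)" "K \<inter> -U = {}" using U K by (auto simp: compact_imp_closed)
  obtain g :: "complex \<times> complex \<Rightarrow> real" where g: "continuous_on UNIV g" "\<And>x. g x \<in> closed_segment 1 0"
    "\<And>x. x \<in> K \<Longrightarrow> g x = 1" "\<And>x. x \<in> -U \<Longrightarrow> g x = 0"
    using Urysohn[OF cl] by metis
  have g01: "0 \<le> g x \<and> g x \<le> 1" for x using g(2)[of x] by (auto simp: closed_segment_eq_real_ivl)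
  have gm [measurable]: "g \<in> borel_measurable borel" using g(1) by (rule borel_measurable_continuous_onI)
  have "(\<integral>z. \<bar>indicator A z - g z\<bar> \<partial>torus_lebesgue) = (\<integral>z. \<bar>indicator A z - g z\<bar> \<partial>N)"
    unfolding N_def by (subst integral_distr) (use AB in auto)
  also have "\<dots> \<le> (\<integral>z. indicator (U - K) z \<partial>N)"
  proof (rule integral_mono)
    show "integrable N (\<lambda>z. \<bar>indicator A z - g z\<bar>)"
    proof (rule N.integrable_const_bound[where B = 1])
      show "AE z in N. norm \<bar>indicator A z - g z\<bar> \<le> 1"
      proof (rule AE_I2)
        show "norm \<bar>indicator A z - g z\<bar> \<le> 1" for z
          using g01[of z] by (simp add: indicator_def)
      qed
      show "(\<lambda>z. \<bar>indicator A z - g z\<bar>) \<in> borel_measurable N"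
        unfolding measurable_cong_sets[OF sN refl] using AB by measurable
    qed
    show "\<bar>indicator A z - g z\<bar> \<le> indicator (U - K) z" for z
      using g01[of z] g(3,4)[of z] K U by (auto simp: indicator_def abs_le_iff)
    show "integrable N (indicator (U - K) :: _ \<Rightarrow> real)"
      by (rule integrable_real_indicator) (auto simp: sN N.emeasure_eq_measure)
  qed
  also have "\<dots> = measure N (U - K)" by (simp add: sN N_def) 
  also have "\<dots> = measure N U - measure N K"
    using U K by (intro N.finite_measure_Diff) (auto simp: sN)
  also have "\<dots> < e" using mU mK by simp
  finally show ?thesis using that g(1) g01 by blast
qed

text \<open>Indicators are treated through uniform continuity of an approximating function, general
  \<open>f\<close> by linearity and dominated convergence. The intended \<open>f\<close> is a
  reversing map, about which only measurability is known.\<close>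

lemma rot_L1_continuous:
  fixes f :: "complex \<times> complex \<Rightarrow> 'b :: {banach, second_countable_topology}"
  assumes f: "integrable torus_lebesgue f" and c: "\<And>n. c n \<in> torus" "c \<longlonglongrightarrow> (1, 1)"
  shows "(\<lambda>n. \<integral>z. norm (f (rot (c n) z) - f z) \<partial>torus_lebesgue) \<longlonglongrightarrow> 0"
  using f
proof (induction rule: integrable_induct)
  case (base A v)
  have "\<exists>n0. \<forall>n\<ge>n0. (\<integral>z. norm (indicator A (rot (c n) z) *\<^sub>R v - indicator A z *\<^sub>R v) \<partial>torus_lebesgue) < e"
    if e: "e > 0" for e
  proof -
    \<comment> \<open>The \<open>+ 1\<close> keeps the denominator positive when
      \<open>v = 0\<close>; the three errors below add up to less than \<open>3 * d\<close>.\<close>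
    define d where "d = e / (3 * (norm v + 1))"
    have d: "d > 0" "3 * d * norm v < e" using e
      by (auto simp: d_def field_simps add_pos_nonneg)
    obtain g :: "_ \<Rightarrow> real" where g: "continuous_on UNIV g"
        "(\<integral>z. \<bar>indicator A z - g z\<bar> \<partial>torus_lebesgue) < d" "\<And>z. 0 \<le> g z \<and> g z \<le> 1"
      using indicator_approx_continuous[OF base(1) d(1)] by metis
    have gt: "continuous_on torus g" using g(1) continuous_on_subset by blast
    have "uniformly_continuous_on torus g"
      using gt compact_torus by (rule compact_uniformly_continuous)
    then obtain r where r: "r > 0" "\<And>z w. z \<in> torus \<Longrightarrow> w \<in> torus \<Longrightarrow> dist w z < r \<Longrightarrow> dist (g w) (g z) < d"
      unfolding uniformly_continuous_on_def using d(1) by metis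
    obtain n0 where n0: "\<And>n. n \<ge> n0 \<Longrightarrow> dist (c n) (1, 1) < r"
      using c(2) r(1) unfolding lim_sequentially by blast
    have gi: "integrable torus_lebesgue g" using gt by (rule integrable_continuous_torus)
    have Ai: "integrable torus_lebesgue (indicator A :: _ \<Rightarrow> real)" using base by simp
    have "(\<integral>z. norm (indicator A (rot (c n) z) *\<^sub>R v - indicator A z *\<^sub>R v) \<partial>torus_lebesgue) < e" if "n \<ge> n0" for n
    proof -
      note ri = integrable_rot[OF c(1)[of n]]
      have i1: "integrable torus_lebesgue (\<lambda>z. \<bar>indicator A z - g z\<bar>)"
        using gi Ai by (intro integrable_abs Bochner_Integration.integrable_diff)
      have "(\<integral>z. \<bar>indicator A (rot (c n) z) - indicator A z :: real\<bar> \<partial>torus_lebesgue)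
         \<le> (\<integral>z. \<bar>indicator A (rot (c n) z) - g (rot (c n) z)\<bar> + (d + \<bar>indicator A z - g z\<bar>) \<partial>torus_lebesgue)"
      proof (rule integral_mono)
        show "integrable torus_lebesgue (\<lambda>z. \<bar>indicator A (rot (c n) z) - indicator A z :: real\<bar>)"
          using ri[OF Ai] Ai by (intro integrable_abs Bochner_Integration.integrable_diff)
        show "integrable torus_lebesgue (\<lambda>z. \<bar>indicator A (rot (c n) z) - g (rot (c n) z)\<bar> + (d + \<bar>indicator A z - g z\<bar>))"
          using ri[OF i1] i1 by (intro Bochner_Integration.integrable_add leb.integrable_const)
        show "\<bar>indicator A (rot (c n) z) - indicator A z :: real\<bar> \<le> \<bar>indicator A (rot (c n) z) - g (rot (c n) z)\<bar> + (d + \<bar>indicator A z - g z\<bar>)"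
          if "z \<in> space torus_lebesgue" for z
        proof -
          have "dist (g (rot (c n) z)) (g z) < d"
            using that c(1) n0[OF \<open>n \<ge> n0\<close>] by (intro r(2)) (simp_all add: dist_rot)
          then show ?thesis by (simp add: dist_real_def)
        qed
      qed
      also have "\<dots> = (\<integral>z. \<bar>indicator A (rot (c n) z) - g (rot (c n) z)\<bar> \<partial>torus_lebesgue) + (d + (\<integral>z. \<bar>indicator A z - g z\<bar> \<partial>torus_lebesgue))"
        using i1 ri[OF i1] by (simp add: leb.prob_space[simplified])
      also have "(\<integral>z. \<bar>indicator A (rot (c n) z) - g (rot (c n) z)\<bar> \<partial>torus_lebesgue) = (\<integral>z. \<bar>indicator A z - g z\<bar> \<partial>torus_lebesgue)"
        using integral_rot[OF c(1)[of n], of "\<lambda>z. \<bar>indicator A z - g z\<bar>"] i1 by simp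
      also have "\<dots> + (d + \<dots>) < 3 * d" using g(2) by simp
      finally have *: "(\<integral>z. \<bar>indicator A (rot (c n) z) - indicator A z :: real\<bar> \<partial>torus_lebesgue) \<le> 3 * d" by simp
      have "(\<integral>z. norm (indicator A (rot (c n) z) *\<^sub>R v - indicator A z *\<^sub>R v) \<partial>torus_lebesgue)
        = (\<integral>z. \<bar>indicator A (rot (c n) z) - indicator A z :: real\<bar> * norm v \<partial>torus_lebesgue)"
        by (simp add: scaleR_left_diff_distrib[symmetric])
      also have "\<dots> \<le> 3 * d * norm v" using * by (simp add: mult_right_mono)
      finally show ?thesis using d by simp
    qed
    then show ?thesis by blast
  qed
  then show ?case unfolding LIMSEQ_def by simp
next
  case (add f g)
  have fi: "integrable torus_lebesgue (\<lambda>z. norm (f (rot (c n) z) - f z))" for n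
    by (intro integrable_norm Bochner_Integration.integrable_diff integrable_rot c add)
  have gi: "integrable torus_lebesgue (\<lambda>z. norm (g (rot (c n) z) - g z))" for n
    by (intro integrable_norm Bochner_Integration.integrable_diff integrable_rot c add)
  have "(\<integral>z. norm (f (rot (c n) z) + g (rot (c n) z) - (f z + g z)) \<partial>torus_lebesgue) \<le>
     (\<integral>z. norm (f (rot (c n) z) - f z) + norm (g (rot (c n) z) - g z) \<partial>torus_lebesgue)" for n
    unfolding add_diff_add
    by (intro integral_mono norm_triangle_ineq integrable_norm Bochner_Integration.integrable_diff Bochner_Integration.integrable_add integrable_rot c add)
  then have le: "(\<integral>z. norm (f (rot (c n) z) + g (rot (c n) z) - (f z + g z)) \<partial>torus_lebesgue) \<le>
     (\<integral>z. norm (f (rot (c n) z) - f z) \<partial>torus_lebesgue) + (\<integral>z. norm (g (rot (c n) z) - g z) \<partial>torus_lebesgue)" for n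
    using fi gi by (simp flip: Bochner_Integration.integral_add)
  show ?case
    by (rule tendsto_sandwich[OF _ _ tendsto_const tendsto_add_zero[OF add(3,4)]]) (use le in auto)
next
  case (lim f s)
  \<comment> \<open>The approximants satisfy \<open>norm (s i z) \<le> 2 * norm (f z)\<close>,
    whence the dominating function.\<close>
  have L: "(\<lambda>i. \<integral>z. norm (s i z - f z) \<partial>torus_lebesgue) \<longlonglongrightarrow> (\<integral>z. 0 \<partial>torus_lebesgue)"
  proof (rule integral_dominated_convergence[where w = "\<lambda>z. 3 * norm (f z)"])
    show "AE z in torus_lebesgue. (\<lambda>i. norm (s i z - f z)) \<longlonglongrightarrow> 0"
      by (intro AE_I2 tendsto_norm_zero LIM_zero) (rule lim(2))
    show "AE z in torus_lebesgue. norm (norm (s i z - f z)) \<le> 3 * norm (f z)" for i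
    proof (rule AE_I2)
      fix z assume "z \<in> space torus_lebesgue"
      then show "norm (norm (s i z - f z)) \<le> 3 * norm (f z)"
        using lim(3)[of z i] norm_triangle_ineq4[of "s i z" "f z"] by simp
    qed
  qed (use lim in auto)
  show ?case unfolding LIMSEQ_def
  proof (intro allI impI)
    fix e :: real assume e: "e > 0"
    then obtain i where i: "(\<integral>z. norm (s i z - f z) \<partial>torus_lebesgue) < e / 3"
      using L unfolding LIMSEQ_def by (force dest!: spec[of _ "e/3"])
    obtain n0 where n0: "\<And>n. n \<ge> n0 \<Longrightarrow> (\<integral>z. norm (s i (rot (c n) z) - s i z) \<partial>torus_lebesgue) < e / 3"
      using lim(5)[of i] e unfolding LIMSEQ_def by (force dest!: spec[of _ "e/3"])
    have "(\<integral>z. norm (f (rot (c n) z) - f z) \<partial>torus_lebesgue) < e" if "n \<ge> n0" for n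
    proof -
      note ri = integrable_rot[OF c(1)[of n]]
      have i1: "integrable torus_lebesgue (\<lambda>z. norm (s i z - f z))" using lim by auto
      have i2: "integrable torus_lebesgue (\<lambda>z. norm (s i (rot (c n) z) - s i z))"
        using lim(1)[of i] ri[OF lim(1)[of i]] by auto
      have "(\<integral>z. norm (f (rot (c n) z) - f z) \<partial>torus_lebesgue) \<le>
        (\<integral>z. norm (s i (rot (c n) z) - f (rot (c n) z)) + (norm (s i (rot (c n) z) - s i z) + norm (s i z - f z)) \<partial>torus_lebesgue)"
      proof (rule integral_mono)
        show "norm (f (rot (c n) z) - f z) \<le> norm (s i (rot (c n) z) - f (rot (c n) z)) + (norm (s i (rot (c n) z) - s i z) + norm (s i z - f z))" for z
          by norm
      qed (use i1 ri[OF i1] i2 lim(4) ri[OF lim(4)] in auto)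
      also have "\<dots> = (\<integral>z. norm (s i (rot (c n) z) - f (rot (c n) z)) \<partial>torus_lebesgue) +
          ((\<integral>z. norm (s i (rot (c n) z) - s i z) \<partial>torus_lebesgue) + (\<integral>z. norm (s i z - f z) \<partial>torus_lebesgue))"
        using i1 ri[OF i1] i2 by simp
      also have "(\<integral>z. norm (s i (rot (c n) z) - f (rot (c n) z)) \<partial>torus_lebesgue) = (\<integral>z. norm (s i z - f z) \<partial>torus_lebesgue)"
        using integral_rot[OF c(1)[of n], of "\<lambda>z. norm (s i z - f z)"] i1 by simp
      finally show ?thesis using i n0[OF that] by simp
    qed
    then show "\<exists>n0. \<forall>n\<ge>n0. dist (\<integral>z. norm (f (rot (c n) z) - f z) \<partial>torus_lebesgue) 0 < e"
      by auto
  qed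
qed

section \<open>Averages over the unit interval and equidistribution of characters\<close>

lemma continuous_on_pair_measurable:
  fixes f :: "'a :: second_countable_topology \<times> 'b :: second_countable_topology \<Rightarrow> 'c :: topological_space"
  assumes "continuous_on (A \<times> B) f" "A \<in> sets borel" "B \<in> sets borel"
  shows "f \<in> borel_measurable (restrict_space borel A \<Otimes>\<^sub>M restrict_space borel B)"
proof -
  let ?M = "restrict_space borel A \<Otimes>\<^sub>M restrict_space borel B :: ('a \<times> 'b) measure"
  have 1: "(\<lambda>x. x) \<in> restrict_space borel A \<rightarrow>\<^sub>M (borel :: 'a measure)"
    and 2: "(\<lambda>x. x) \<in> restrict_space borel B \<rightarrow>\<^sub>M (borel :: 'b measure)"
    by (auto intro!: measurable_restrict_space1)
  have "(\<lambda>p. (fst p, snd p)) \<in> ?M \<rightarrow>\<^sub>M borel"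
    using measurable_compose[OF measurable_fst 1] measurable_compose[OF measurable_snd 2]
    by (intro borel_measurable_Pair) auto
  then have "(\<lambda>p. p) \<in> ?M \<rightarrow>\<^sub>M borel" by simp
  then have "(\<lambda>p. p) \<in> ?M \<rightarrow>\<^sub>M restrict_space borel (A \<times> B)"
    by (intro measurable_restrict_space2) (auto simp: space_pair_measure space_restrict_space)
  from measurable_compose[OF this borel_measurable_continuous_on_restrict[OF assms(1)]] show ?thesis .
qed

text \<open>Adding the bound \<open>B\<close> makes the integrand nonnegative and reduces the claim
  to nonnegative integrals; passing from \<open>{0..1}\<close> to \<open>{0..<1}\<close> discards a
  null point.\<close>

lemma set_integral_periodic_shift:
  fixes F :: "real \<Rightarrow> real"
  assumes F: "continuous_on UNIV F" "\<And>x. F (x + 1) = F x" "\<And>x. \<bar>F x\<bar> \<le> B"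
  shows "(LINT r:{0..1}|lborel. F (r + a)) = (LINT r:{0..1}|lborel. F r)"
proof -
  have [measurable]: "F \<in> borel_measurable borel" using F(1) by (rule borel_measurable_continuous_onI)
  have nonneg: "F x + B \<ge> 0" for x using F(3)[of x] by linarith
  have B: "(LINT r:{0..1}|lborel. F (r + c)) = (LINT r:{0..1}|lborel. F (r + c) + B) - B" for c
  proof -
    have "set_integrable lborel {0..1} (\<lambda>r. F (r + c))"
      by (rule borel_integrable_atLeastAtMost') (intro continuous_on_compose2[OF F(1)] continuous_intros, auto)
    then have "(LINT r:{0..1}|lborel. F (r + c) + B) = (LINT r:{0..1}|lborel. F (r + c)) + (LINT r:{0..1::real}|lborel. B)"
      by (rule set_integral_add(2)) (intro borel_integrable_atLeastAtMost' continuous_intros)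
    then show ?thesis by (simp add: set_lebesgue_integral_def)
  qed
  have E: "(LINT r:{0..1}|lborel. F (r + c) + B) = enn2real (\<integral>\<^sup>+r. ennreal (F (r + c) + B) * indicator {0..<1} r \<partial>lborel)" for c
  proof -
    have "(LINT r:{0..1}|lborel. F (r + c) + B) = (LINT r|lborel. indicator {0..1} r * (F (r + c) + B))"
      by (simp add: set_lebesgue_integral_def)
    also have "\<dots> = enn2real (\<integral>\<^sup>+r. ennreal (indicator {0..1} r * (F (r + c) + B)) \<partial>lborel)"
      using nonneg by (intro integral_eq_nn_integral) auto
    also have "(\<integral>\<^sup>+r. ennreal (indicator {0..1} r * (F (r + c) + B)) \<partial>lborel) =
        (\<integral>\<^sup>+r. ennreal (F (r + c) + B) * indicator {0..<1} r \<partial>lborel)"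
    proof (rule nn_integral_cong_AE)
      show "AE r in lborel. ennreal (indicator {0..1} r * (F (r + c) + B)) = ennreal (F (r + c) + B) * indicator {0..<1} r"
        using AE_lborel_singleton[of "1::real"] by eventually_elim (auto simp: indicator_def)
    qed
    finally show ?thesis .
  qed
  have "(\<integral>\<^sup>+r. ennreal (F (r + a) + B) * indicator {0..<1} r \<partial>lborel) =
     (\<integral>\<^sup>+r. ennreal (F r + B) * indicator {0..<1} r \<partial>lborel)"
    by (rule nn_integral_periodic_shift[where F = "\<lambda>r. ennreal (F r + B)"]) (auto simp: F)
  then show ?thesis using E[of a] E[of 0] B[of a] B[of 0] by simp
qed

abbreviation unit_interval :: "real measure" where
  "unit_interval \<equiv> restrict_space lborel {0..1}"

lemma prob_space_unit_interval: "prob_space unit_interval"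
  by (rule prob_spaceI) (simp add: space_restrict_space emeasure_restrict_space)

lemma integral_unit_interval: "(\<integral>r. f r \<partial>unit_interval) = (LINT r:{0..1}|lborel. f r :: real)"
  by (subst integral_restrict_space) (simp_all add: set_lebesgue_integral_def)

lemma integrable_unit_interval_torus:
  fixes f :: "real \<Rightarrow> complex \<times> complex \<Rightarrow> real"
  assumes "continuous_on ({0..1} \<times> torus) (\<lambda>(r, z). f r z)"
  shows "integrable (unit_interval \<Otimes>\<^sub>M torus_lebesgue) (\<lambda>(r, z). f r z)"
proof -
  interpret U: prob_space unit_interval by (rule prob_space_unit_interval)
  interpret P: pair_prob_space unit_interval torus_lebesgue ..
  have "compact ({0..1::real} \<times> torus)" by (intro compact_Times compact_torus) simp
  then have "bounded ((\<lambda>(r, z). f r z) ` ({0..1} \<times> torus))"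
    using assms by (intro compact_imp_bounded compact_continuous_image)
  then obtain B where B: "\<And>p. p \<in> {0..1} \<times> torus \<Longrightarrow> norm (case p of (r, z) \<Rightarrow> f r z) \<le> B"
    unfolding bounded_iff by blast
  have "(\<lambda>(r, z). f r z) \<in> borel_measurable (restrict_space borel {0..1} \<Otimes>\<^sub>M torus_borel_space)"
    by (rule continuous_on_pair_measurable[OF assms]) auto
  moreover have "sets (restrict_space borel {0..1} \<Otimes>\<^sub>M torus_borel_space) = sets (unit_interval \<Otimes>\<^sub>M torus_lebesgue)"
    by (intro sets_pair_measure_cong) (auto simp: sets_restrict_space)
  ultimately have "(\<lambda>(r, z). f r z) \<in> borel_measurable (unit_interval \<Otimes>\<^sub>M torus_lebesgue)"
    by (simp cong: measurable_cong_sets)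
  then show ?thesis
    by (intro P.integrable_const_bound[where B = B]) 
       (use B in \<open>auto intro!: AE_I2 simp: space_pair_measure space_restrict_space\<close>)
qed

lemma Fubini_unit_interval_torus:
  fixes f :: "real \<Rightarrow> complex \<times> complex \<Rightarrow> real"
  assumes "continuous_on ({0..1} \<times> torus) (\<lambda>(r, z). f r z)"
  shows "(LINT r:{0..1}|lborel. (\<integral>z. f r z \<partial>torus_lebesgue)) = (\<integral>z. (LINT r:{0..1}|lborel. f r z) \<partial>torus_lebesgue)"
proof -
  interpret U: prob_space unit_interval by (rule prob_space_unit_interval)
  interpret P: pair_prob_space unit_interval torus_lebesgue ..
  show ?thesis
    using P.Fubini_integral[OF integrable_unit_interval_torus[OF assms]] by (simp add: integral_unit_interval)
qed

lemma continuous_on_unit_integral: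
  fixes f :: "real \<Rightarrow> complex \<times> complex \<Rightarrow> real"
  assumes "continuous_on ({0..1} \<times> torus) (\<lambda>(r, z). f r z)"
  shows "integrable torus_lebesgue (\<lambda>z. LINT r:{0..1}|lborel. f r z)"
proof -
  interpret U: prob_space unit_interval by (rule prob_space_unit_interval)
  interpret P: pair_prob_space unit_interval torus_lebesgue ..
  show ?thesis
    using P.integrable_snd[OF integrable_unit_interval_torus[OF assms]] by (simp add: integral_unit_interval)
qed

lemma set_integral_unit_bound:
  fixes f :: "real \<Rightarrow> real"
  assumes "continuous_on {0..1} f" "\<And>r. r \<in> {0..1} \<Longrightarrow> \<bar>f r\<bar> \<le> B"
  shows "\<bar>LINT r:{0..1}|lborel. f r\<bar> \<le> B"
proof -
  have i: "set_integrable lborel {0..1} f" using assms(1) by (rule borel_integrable_atLeastAtMost')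
  have "\<bar>LINT r:{0..1}|lborel. f r\<bar> \<le> (LINT r:{0..1}|lborel. \<bar>f r\<bar>)"
    using set_integral_norm_bound[OF i] by simp
  also have "\<dots> \<le> (LINT r:{0..1::real}|lborel. B)"
    by (rule set_integral_mono[OF set_integrable_abs[OF i] borel_integrable_atLeastAtMost'[OF continuous_on_const] assms(2)])
  also have "\<dots> = B" by (simp add: set_lebesgue_integral_def)
  finally show ?thesis .
qed

lemma cmod_cis_minus_1_le: "cmod (cis x - 1) \<le> \<bar>x\<bar>"
  using dist_exp_i_1[of x] abs_sin_x_le_abs_x[of "x / 2"] by (simp add: cis_conv_exp)

text \<open>
  The function \<open>u n\<close> is a character whose first frequency \<open>q n\<close> tends to infinity: shifting the
  first coordinate by \<open>r / q n\<close> hardly moves the point but multiplies \<open>u n\<close> by \<open>cis (2 * pi * r)\<close>.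
\<close>

lemma equidistribution:
  fixes K :: "(complex \<times> complex) \<times> complex \<Rightarrow> real" and q :: "nat \<Rightarrow> nat"
  assumes K: "continuous_on (torus \<times> sphere 0 1) K"
    and u: "\<And>n. continuous_on torus (u n)" "\<And>n z. z \<in> torus \<Longrightarrow> cmod (u n z) = 1"
      "\<And>n r z. z \<in> torus \<Longrightarrow> u n (rot (torus_proj (r / real (q n), 0)) z) = cis (2 * pi * r) * u n z"
    and q: "filterlim q at_top sequentially"
  shows "(\<lambda>n. \<integral>z. K (z, u n z) \<partial>torus_lebesgue) \<longlonglongrightarrow>
    (\<integral>z. (LINT r:{0..1}|lborel. K (z, cis (2 * pi * r))) \<partial>torus_lebesgue)"
proof -
  have Kc: "continuous_on torus (\<lambda>z. K (f z, v z))"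
    if "continuous_on torus f" "f ` torus \<subseteq> torus" "continuous_on torus v" "v ` torus \<subseteq> sphere 0 1" for f v
    by (rule continuous_on_compose2[OF K]) (intro continuous_on_Pair that, use that in auto)
  have comp: "compact (torus \<times> sphere (0::complex) 1)" by (intro compact_Times compact_torus) simp
  then have "bounded (K ` (torus \<times> sphere 0 1))"
    using K by (intro compact_imp_bounded compact_continuous_image)
  then obtain B where B: "\<And>z v. z \<in> torus \<Longrightarrow> cmod v = 1 \<Longrightarrow> \<bar>K (z, v)\<bar> \<le> B"
    unfolding bounded_iff real_norm_def by (metis (no_types, lifting) SigmaI imageI mem_sphere_0)
  have uc: "uniformly_continuous_on (torus \<times> sphere 0 1) K"
    using K comp by (rule compact_uniformly_continuous)
  have Kr: "continuous_on UNIV (\<lambda>r. K (z, cis (2 * pi * r)))" if "z \<in> torus" for z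
    by (rule continuous_on_compose2[OF K]) (intro continuous_intros, use that in auto)
  \<comment> \<open>The starting value \<open>v\<close> on the circle is a shift of the argument of
    a 1-periodic integrand.\<close>
  have shift: "(LINT r:{0..1}|lborel. K (z, cis (2 * pi * r) * v)) = (LINT r:{0..1}|lborel. K (z, cis (2 * pi * r)))"
    if z: "z \<in> torus" and v: "cmod v = 1" for z v
  proof -
    define a where "a = Arg v"
    have "v = cis a" using v rcis_cmod_Arg[of v] by (simp add: rcis_def a_def)
    then have eq: "cis (2 * pi * r) * v = cis (2 * pi * (r + a / (2 * pi)))" for r
      by (simp add: cis_mult distrib_left)
    show ?thesis unfolding eq
    proof (rule set_integral_periodic_shift[OF Kr[OF z]])
      show "K (z, cis (2 * pi * (x + 1))) = K (z, cis (2 * pi * x))" for x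
        using torus_proj_periodic(1)[of x 0] by (simp add: torus_proj_def)
      show "\<bar>K (z, cis (2 * pi * x))\<bar> \<le> B" for x by (rule B[OF z]) simp
    qed
  qed
  have Kj: "continuous_on ({0..1} \<times> torus) (\<lambda>(r, z). K (rot (torus_proj (r / real m, 0)) z, cis (2 * pi * r) * v z))"
    if "continuous_on torus v" "\<And>z. z \<in> torus \<Longrightarrow> cmod (v z) = 1" for m v
  proof -
    have vc: "continuous_on ({0..1} \<times> torus) (\<lambda>p. v (snd p))"
      by (rule continuous_on_compose2[OF that(1) continuous_on_snd[OF continuous_on_id]]) auto
    have "continuous_on ({0..1} \<times> torus) (\<lambda>p. (rot (torus_proj (fst p / real m, 0)) (snd p), cis (2 * pi * fst p) * v (snd p)))"
      unfolding rot_def torus_proj_def divide_inverse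
      by (intro continuous_on_Pair continuous_on_mult vc continuous_intros)
    moreover have "(\<lambda>p. (rot (torus_proj (fst p / real m, 0)) (snd p), cis (2 * pi * fst p) * v (snd p))) ` ({0..1} \<times> torus) \<subseteq> torus \<times> sphere 0 1"
      using that(2) by (auto simp: norm_mult)
    ultimately show ?thesis unfolding case_prod_unfold by (rule continuous_on_compose2[OF K])
  qed
  have Kj0: "continuous_on ({0..1} \<times> torus) (\<lambda>(r, z). K (z, cis (2 * pi * r) * v z))"
    if "continuous_on torus v" "\<And>z. z \<in> torus \<Longrightarrow> cmod (v z) = 1" for v
    using Kj[of v 0] that by (simp add: rot_def torus_proj_def)
  \<comment> \<open>Rotation by \<open>r / q n\<close> leaves the integral unchanged for each
    \<open>r\<close>. Averaging over \<open>r\<close> makes the circle variable run once around, at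
    the price \<open>e\<close> of moving the base point.\<close>
  have main: "\<bar>(\<integral>z. K (z, u n z) \<partial>torus_lebesgue) - (\<integral>z. (LINT r:{0..1}|lborel. K (z, cis (2 * pi * r))) \<partial>torus_lebesgue)\<bar> \<le> e"
    if e: "\<And>r z v. r \<in> {0..1} \<Longrightarrow> z \<in> torus \<Longrightarrow> cmod v = 1 \<Longrightarrow>
        \<bar>K (rot (torus_proj (r / real (q n), 0)) z, v) - K (z, v)\<bar> \<le> e" for n e
  proof -
    have Kn: "continuous_on torus (\<lambda>z. K (z, u n z))"
      by (rule Kc[OF continuous_on_id]) (use u in auto)
    have "(\<integral>z. K (z, u n z) \<partial>torus_lebesgue) = (\<integral>z. K (rot (torus_proj (r / real (q n), 0)) z, cis (2 * pi * r) * u n z) \<partial>torus_lebesgue)" for r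
      using integral_rot[OF torus_proj_in_torus[of "(r / real (q n), 0)"] borel_measurable_continuous_torus[OF Kn]]
      by (subst (asm) Bochner_Integration.integral_cong[OF refl, where g = "\<lambda>z. K (rot (torus_proj (r / real (q n), 0)) z, cis (2 * pi * r) * u n z)"])
         (auto simp: u)
    then have "(\<integral>z. K (z, u n z) \<partial>torus_lebesgue) = (LINT r:{0..1}|lborel. \<integral>z. K (rot (torus_proj (r / real (q n), 0)) z, cis (2 * pi * r) * u n z) \<partial>torus_lebesgue)"
      by (subst set_lebesgue_integral_cong[where g = "\<lambda>_. \<integral>z. K (z, u n z) \<partial>torus_lebesgue"])
         (auto simp: set_lebesgue_integral_def)
    also have "\<dots> = (\<integral>z. (LINT r:{0..1}|lborel. K (rot (torus_proj (r / real (q n), 0)) z, cis (2 * pi * r) * u n z)) \<partial>torus_lebesgue)"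
      using u by (intro Fubini_unit_interval_torus Kj)
    finally have 1: "(\<integral>z. K (z, u n z) \<partial>torus_lebesgue) = \<dots>" .
    have 2: "(\<integral>z. (LINT r:{0..1}|lborel. K (z, cis (2 * pi * r))) \<partial>torus_lebesgue) =
        (\<integral>z. (LINT r:{0..1}|lborel. K (z, cis (2 * pi * r) * u n z)) \<partial>torus_lebesgue)"
      by (intro Bochner_Integration.integral_cong refl shift[symmetric]) (auto simp: u)
    have i1: "integrable torus_lebesgue (\<lambda>z. LINT r:{0..1}|lborel. K (rot (torus_proj (r / real (q n), 0)) z, cis (2 * pi * r) * u n z))"
      using u by (intro continuous_on_unit_integral Kj)
    have i2: "integrable torus_lebesgue (\<lambda>z. LINT r:{0..1}|lborel. K (z, cis (2 * pi * r) * u n z))"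
      using u by (intro continuous_on_unit_integral Kj0)
    have pw: "\<bar>(LINT r:{0..1}|lborel. K (rot (torus_proj (r / real (q n), 0)) z, cis (2 * pi * r) * u n z)) -
        (LINT r:{0..1}|lborel. K (z, cis (2 * pi * r) * u n z))\<bar> \<le> e" if z: "z \<in> torus" for z
    proof -
      have c1: "continuous_on {0..1} (\<lambda>r. K (rot (torus_proj (r / real (q n), 0)) z, cis (2 * pi * r) * u n z))"
        using continuous_on_compose2[OF Kj[of "u n" "q n"] continuous_on_Pair[OF continuous_on_id continuous_on_const[of _ z]], of "{0..1}"] u z by auto
      have c2: "continuous_on {0..1} (\<lambda>r. K (z, cis (2 * pi * r) * u n z))"
        using continuous_on_compose2[OF Kj0[of "u n"] continuous_on_Pair[OF continuous_on_id continuous_on_const[of _ z]], of "{0..1}"] u z by auto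
      show ?thesis
        unfolding set_integral_diff(2)[OF borel_integrable_atLeastAtMost'[OF c1] borel_integrable_atLeastAtMost'[OF c2], symmetric]
        by (rule set_integral_unit_bound[OF continuous_on_diff[OF c1 c2] e]) (use u z in \<open>auto simp: norm_mult\<close>)
    qed
    show ?thesis unfolding 1 2
      unfolding Bochner_Integration.integral_diff[OF i1 i2, symmetric]
      by (rule order_trans[OF integral_abs_bound leb.integral_le_const])
         (use i1 i2 pw in auto)
  qed
  show ?thesis unfolding LIMSEQ_def dist_real_def
  proof (intro allI impI)
    fix e :: real assume e: "e > 0"
    obtain d where d: "d > 0" "\<And>p p'. p \<in> torus \<times> sphere 0 1 \<Longrightarrow> p' \<in> torus \<times> sphere 0 1 \<Longrightarrow> dist p' p < d \<Longrightarrow> dist (K p') (K p) < e/2"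
      using uc e unfolding uniformly_continuous_on_def by (metis half_gt_zero)
    \<comment> \<open>For \<open>q n \<ge> N\<close> the rotations involved move points by at most
      \<open>2 * pi / q n < d\<close>.\<close>
    define N where "N = nat \<lceil>2 * pi / d\<rceil> + 1"
    obtain n0 where n0: "\<And>n. n \<ge> n0 \<Longrightarrow> q n \<ge> N"
      using q unfolding filterlim_at_top eventually_sequentially by blast
    have "\<bar>(\<integral>z. K (z, u n z) \<partial>torus_lebesgue) - (\<integral>z. (LINT r:{0..1}|lborel. K (z, cis (2 * pi * r))) \<partial>torus_lebesgue)\<bar> < e"
      if n: "n \<ge> n0" for n
    proof -
      have qn: "real (q n) > 2 * pi / d" using n0[OF n] unfolding N_def by linarith
      then have qn0: "real (q n) > 0" using d(1) by (smt (verit) divide_pos_pos pi_gt_zero)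
      have "\<bar>K (rot (torus_proj (r / real (q n), 0)) z, v) - K (z, v)\<bar> \<le> e/2"
        if "r \<in> {0..1}" "z \<in> torus" "cmod v = 1" for r z v
      proof -
        have "dist (rot (torus_proj (r / real (q n), 0)) z, v) (z, v) = dist (torus_proj (r / real (q n), 0)) (1, 1)"
          using that by (simp add: dist_Pair_Pair dist_rot)
        also have "\<dots> = cmod (cis (2 * pi * (r / real (q n))) - 1)"
          by (simp add: torus_proj_def dist_Pair_Pair dist_norm)
        also have "\<dots> \<le> 2 * pi * (r / real (q n))"
          using cmod_cis_minus_1_le[of "2 * pi * (r / real (q n))"] that qn0 by simp
        also have "\<dots> \<le> 2 * pi / real (q n)"
          using that qn0 by (simp add: divide_right_mono mult_le_cancel_left1)
        also have "\<dots> < d" using qn qn0 d(1) by (simp add: field_simps)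
        finally have "dist (K (rot (torus_proj (r / real (q n), 0)) z, v)) (K (z, v)) < e/2"
          using that by (intro d(2)) auto
        then show ?thesis by (simp add: dist_real_def)
      qed
      from main[OF this] show ?thesis using e by simp
    qed
    then show "\<exists>n0. \<forall>n\<ge>n0. \<bar>(\<integral>z. K (z, u n z) \<partial>torus_lebesgue) - (\<integral>z. (LINT r:{0..1}|lborel. K (z, cis (2 * pi * r))) \<partial>torus_lebesgue)\<bar> < e"
      by blast
  qed
qed

section \<open>A Liouville slope\<close>

text \<open>Since \<open>den (Suc n) = 4 * den n * tau n\<close>, the factor 4 makes
  \<open>tau n\<close> a quarter turn of the \<open>n\<close>-th phase. The exponent is linear in
  \<open>den n\<close> because cosines of that frequency grow exponentially in \<open>den n\<close>
  on a complex strip; 200 exceeds the rate met in \<open>amp_drift_exp\<close>.\<close>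

fun den :: "nat \<Rightarrow> nat" where
  "den 0 = 1"
| "den (Suc n) = 4 * den n ^ 2 * 2 ^ (200 * den n)"

definition slope :: real where "slope = (\<Sum>k. 1 / real (den k))"

text \<open>Each \<open>den k\<close> divides \<open>den n\<close>, so the divisions are exact and
  \<open>num n / den n\<close> is a partial sum of \<open>slope\<close>.\<close>

definition num :: "nat \<Rightarrow> nat" where "num n = (\<Sum>k\<le>n. den n div den k)"

definition drift :: "nat \<Rightarrow> real" where "drift n = den n * slope - num n"

text \<open>The first coordinate of the Cantor pairing: every value recurs at infinitely many
  indices, while the growth stays at most linear.\<close>

definition amp :: "nat \<Rightarrow> real" where "amp n = real (fst (prod_decode n))"

text \<open>Being an integer, this time returns the second coordinate of the linear flow exactly;
  being a multiple of \<open>den n\<close>, it nearly returns the first.\<close>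

definition tau :: "nat \<Rightarrow> nat" where "tau n = den n * 2 ^ (200 * den n)"

section \<open>Growth of the denominators and quality of approximation of the slope\<close>

lemma den_pos [simp]: "den n > 0" by (induction n) auto

lemma tau_pos [simp]: "tau n > 0" by (simp add: tau_def)

lemma den_tau_nonzero [simp]: "den n \<noteq> 0" "tau n \<noteq> 0" using den_pos[of n] tau_pos[of n] by auto

lemma den_Suc: "den (Suc n) = 4 * den n * tau n"
  by (simp add: tau_def power2_eq_square)

declare den.simps(2) [simp del]

lemma tau_ge: "tau n \<ge> den n" by (simp add: tau_def)

lemma den_Suc_ge: "den (Suc n) \<ge> 4 * den n"
  using tau_pos[of n] by (simp add: den_Suc Suc_le_eq del: den_tau_nonzero)

lemma den_mono: "m \<le> n \<Longrightarrow> den m \<le> den n"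
  using lift_Suc_mono_le[of den, OF order_trans[OF _ den_Suc_ge]] by simp

lemma den_gt: "n < den n"
proof (induction n)
  case (Suc n)
  then show ?case using den_Suc_ge[of n] den_pos[of n] by linarith
qed simp

lemma den_dvd: "m \<le> n \<Longrightarrow> den m dvd den n"
proof (induction n)
  case (Suc n)
  have "den n dvd den (Suc n)" by (simp add: den_Suc)
  then show ?case using Suc by (metis dvd_refl dvd_trans le_Suc_eq)
qed simp

lemma den_geometric: "2 ^ k * den m \<le> den (k + m)"
proof (induction k)
  case (Suc k)
  then show ?case using den_Suc_ge[of "k + m"] by simp
qed simp

lemma inverse_den_le: "1 / real (den (k + m)) \<le> (1/2) ^ k * (1 / real (den m))"
proof -
  have "real (2 ^ k * den m) \<le> real (den (k + m))" using den_geometric of_nat_mono by blast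
  then show ?thesis by (simp add: field_simps power_divide)
qed

lemma summable_den: "summable (\<lambda>k. 1 / real (den (k + m)))"
  by (rule summable_comparison_test'[where g = "\<lambda>k. (1/2) ^ k * (1 / real (den m))" and N = 0])
     (use inverse_den_le in \<open>auto intro!: summable_mult2 summable_geometric\<close>)

definition den_tail :: "nat \<Rightarrow> real" where "den_tail n = (\<Sum>k. 1 / real (den (k + n)))"

lemma den_tail_le: "den_tail n \<le> 2 / den n"
proof -
  have "den_tail n \<le> (\<Sum>k. (1/2) ^ k * (1 / real (den n)))"
    unfolding den_tail_def
    by (intro suminf_le summable_den inverse_den_le summable_mult2 summable_geometric) auto
  also have "\<dots> = 2 / den n"
    by (subst suminf_mult2[symmetric]) (auto simp: suminf_geometric intro: summable_geometric)
  finally show ?thesis .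
qed

lemma den_tail_Suc: "den_tail n = 1 / den n + den_tail (Suc n)"
  using suminf_split_head[OF summable_den[of n]] by (simp add: den_tail_def)

lemma den_tail_pos: "den_tail n > 0"
  unfolding den_tail_def by (rule suminf_pos[OF summable_den]) simp

lemma slope_eq: "slope = (\<Sum>k\<le>n. 1 / real (den k)) + den_tail (Suc n)"
  using suminf_split_initial_segment[OF summable_den[of 0], of "Suc n"]
  by (simp add: slope_def den_tail_def lessThan_Suc_atMost)

lemma real_num: "real (num n) = den n * (\<Sum>k\<le>n. 1 / real (den k))"
  unfolding num_def of_nat_sum sum_distrib_left
  by (intro sum.cong) (use den_dvd in \<open>auto simp: real_of_nat_div\<close>)

lemma drift_eq: "drift n = den n * den_tail (Suc n)"
  by (simp add: drift_def real_num slope_eq[of n] distrib_left)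

lemma drift_pos [simp]: "drift n > 0"
  by (simp add: drift_eq den_tail_pos)

lemma drift_le: "drift n \<le> 1 / (2 * tau n)"
proof -
  have "drift n \<le> den n * (2 / den (Suc n))"
    unfolding drift_eq by (intro mult_left_mono den_tail_le) auto
  also have "\<dots> = 1 / (2 * tau n)" by (simp add: den_Suc)
  finally show ?thesis .
qed

lemma two_power_ge: "real n \<le> 2 ^ n"
  by (metis less_exp less_imp_le of_nat_le_iff of_nat_numeral of_nat_power)

lemma tau_ge_power: assumes "k \<le> 200 * den n" shows "2 ^ k * real (den n) \<le> real (tau n)"
  using assms by (simp add: tau_def)

text \<open>The leading term \<open>1 / den (Suc n)\<close> of the tail contributes exactly
  \<open>1/4\<close>; the error is the tail from \<open>den (Suc (Suc n))\<close> on.\<close>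

lemma tau_drift: "0 \<le> tau n * drift n - 1/4" "tau n * drift n - 1/4 \<le> (1/2) ^ n"
proof -
  have eq: "tau n * drift n - 1/4 = tau n * den n * den_tail (Suc (Suc n))"
    by (simp add: drift_eq den_tail_Suc[of "Suc n"] den_Suc distrib_left)
  show "0 \<le> tau n * drift n - 1/4" unfolding eq using den_tail_pos[of "Suc (Suc n)"] by simp
  have "tau n * den n * den_tail (Suc (Suc n)) \<le> tau n * den n * (2 / den (Suc (Suc n)))"
    by (intro mult_left_mono den_tail_le) auto
  also have "\<dots> = 1 / (8 * tau (Suc n))"
    by (simp add: den_Suc[of "Suc n"]) (simp add: den_Suc)
  also have "\<dots> \<le> 1 / 2 ^ n"
  proof -
    have "2 ^ n * 1 \<le> (2::real) ^ n * den (Suc n)" by (intro mult_left_mono) (auto simp: Suc_le_eq)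
    also have "\<dots> \<le> tau (Suc n)" by (rule tau_ge_power) (use den_gt[of "Suc n"] in linarith)
    finally have "2 ^ n \<le> 8 * real (tau (Suc n))" using tau_pos[of "Suc n"] by linarith
    then show ?thesis by (intro divide_left_mono) auto
  qed
  finally show "tau n * drift n - 1/4 \<le> (1/2) ^ n" unfolding eq by (simp add: power_divide)
qed

lemma tau_drift_le: "tau n * drift n \<le> 1/2"
  using mult_left_mono[OF drift_le[of n], of "tau n"] by simp

lemma slope_tau: "slope * tau n = real (2 ^ (200 * den n) * num n) + tau n * drift n / den n"
  by (simp add: drift_def tau_def field_simps)

lemma amp_nonneg [simp]: "amp n \<ge> 0" by (simp add: amp_def)

lemma amp_le: "amp n \<le> n"
  using le_prod_encode_1[of "fst (prod_decode n)" "snd (prod_decode n)"] by (simp add: amp_def)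

lemma amp_frequently: "\<exists>n\<ge>n0. amp n = real M"
proof -
  have "n0 \<le> prod_encode (M, n0)" by (rule le_prod_encode_2)
  then show ?thesis by (intro exI[of _ "prod_encode (M, n0)"]) (simp add: amp_def)
qed

text \<open>The factor \<open>den m\<close> in \<open>tau m\<close> absorbs the amplitude, as
  \<open>amp m \<le> m < den m\<close>. Convergence, analyticity and smoothness of the time change
  all rest on this bound.\<close>

lemma amp_drift_le: "amp m * drift m \<le> (1/2) ^ (200 * den m)"
proof -
  have "amp m * drift m \<le> den m * (1 / (2 * tau m))"
    using amp_le[of m] den_gt[of m] drift_le[of m] drift_pos[of m]
    by (intro mult_mono) (auto intro: less_imp_le)
  also have "\<dots> \<le> (1/2) ^ (200 * den m)" by (simp add: tau_def power_divide divide_simps)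
  finally show ?thesis .
qed

text \<open>For \<open>m < n\<close>, \<open>tau n\<close> is a near-period of the linear flow,
  hence of the character of index \<open>m\<close>, with an error proportional to
  \<open>1 / den n\<close>. For \<open>m > n\<close>, the drift of index \<open>m\<close> is so slow
  that its phase hardly moves up to time \<open>tau n\<close>, and \<open>k = 0\<close>
  serves.\<close>

lemma phase_bound:
  assumes "m \<noteq> n"
  obtains k :: int where "amp m * \<bar>drift m * tau n - k\<bar> \<le> (1/2) ^ m * (1/2) ^ n"
proof (cases "m < n")
  case True
  \<comment> \<open>With \<open>l\<close> the predecessor of \<open>n\<close>,
    \<open>den n = 4 * den l * tau l\<close>, and the exponential in \<open>tau l\<close> beats both
    factors \<open>den l\<close> and \<open>2 ^ (m + n)\<close>.\<close>
  then obtain l where l: "n = Suc l" "m \<le> l" by (metis less_eq_Suc_le Suc_le_D Suc_le_mono)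
  define k :: int where "k = int (den m * (2 ^ (200 * den n) * num n)) - int (num m * tau n)"
  have "drift m * tau n = den m * (slope * tau n) - num m * tau n"
    by (simp add: drift_def algebra_simps)
  then have eq: "drift m * tau n - k = den m * (tau n * drift n) / den n"
    unfolding slope_tau k_def by (simp add: algebra_simps)
  have "amp m * \<bar>drift m * tau n - k\<bar> = amp m * den m * (tau n * drift n) / den n"
    unfolding eq by (simp add: less_imp_le)
  also have "\<dots> \<le> (real (den l) * real (den l) * 1) / den n"
  proof (intro divide_right_mono mult_mono)
    show "amp m \<le> den l" using amp_le[of m] den_gt[of m] den_mono[OF l(2)] by linarith
    show "real (den m) \<le> den l" using den_mono[OF l(2)] by simp
    show "tau n * drift n \<le> 1" using tau_drift_le[of n] by linarith
  qed (simp_all add: less_imp_le)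
  also have "\<dots> \<le> (1/2) ^ (m + n)"
  proof -
    have "m + n \<le> 200 * den l" using den_gt[of l] l by linarith
    then have "2 ^ (m + n) * real (den l) \<le> real (tau l)" by (rule tau_ge_power)
    then have "2 ^ (m + n) * real (den l) * den l \<le> real (tau l) * den l" by (rule mult_right_mono) auto
    also have "\<dots> \<le> real (den n)" by (simp add: den_Suc l)
    finally have "real (den l) * real (den l) * 2 ^ (m + n) \<le> den n" by (simp add: mult_ac)
    then show ?thesis by (simp add: power_divide field_simps)
  qed
  finally show ?thesis using that[of k] by (simp add: power_add)
next
  case False
  then have mn: "n < m" using assms by simp
  have "tau n \<le> den (Suc n)" by (simp add: den_Suc Suc_le_eq)
  also have "\<dots> \<le> den m" using mn by (intro den_mono) simp
  finally have t: "tau n \<le> den m" .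
  have "amp m * \<bar>drift m * tau n - (0::int)\<bar> = amp m * (drift m * tau n)"
    by (simp add: less_imp_le)
  also have "\<dots> \<le> 2 ^ m * (1 / (2 * tau m) * den m)"
    using t drift_le[of m] order_trans[OF amp_le[of m] two_power_ge[of m]]
    by (intro mult_mono) (auto intro: less_imp_le)
  also have "\<dots> \<le> (1/2) ^ (m + n)"
  proof -
    have "m + m + n \<le> 200 * den m" using den_gt[of m] mn by linarith
    then have "2 ^ (m + m + n) * real (den m) \<le> real (tau m)" by (rule tau_ge_power)
    also have "\<dots> \<le> 2 * tau m" by simp
    finally show ?thesis by (simp add: power_divide field_simps power_add)
  qed
  finally show ?thesis using that[of 0] by (simp add: power_add)
qed

lemma drift_tendsto_0: "drift \<longlonglongrightarrow> 0"
proof (rule tendsto_sandwich[OF _ _ tendsto_const])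
  show "\<forall>\<^sub>F n in sequentially. 0 \<le> drift n" by (simp add: less_imp_le)
  show "\<forall>\<^sub>F n in sequentially. drift n \<le> 1 / real n"
  proof (intro eventually_sequentiallyI[of 1])
    fix n :: nat assume n: "n \<ge> 1"
    have "drift n \<le> 1 / (2 * tau n)" by (rule drift_le)
    also have "\<dots> \<le> 1 / real n" using tau_ge[of n] den_gt[of n] n by (intro divide_left_mono) auto
    finally show "drift n \<le> 1 / real n" .
  qed
  show "(\<lambda>n. 1 / real n) \<longlonglongrightarrow> 0" by real_asymp
qed

text \<open>Under the hypothesis \<open>k * drift n\<close> would be an integer for every
  \<open>n\<close>, yet it tends to 0 without vanishing when \<open>k \<noteq> 0\<close>. The
  combination \<open>k * slope + l\<close> is the frequency of a character along the linear
  flow.\<close>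

lemma slope_irrational:
  fixes k l :: int
  assumes "k * slope + l = 0" shows "k = 0" "l = 0"
proof -
  show "k = 0"
  proof (rule ccontr)
    assume "k \<noteq> 0"
    have "(\<lambda>n. \<bar>real_of_int k\<bar> * drift n) \<longlonglongrightarrow> \<bar>real_of_int k\<bar> * 0"
      by (intro tendsto_mult tendsto_const drift_tendsto_0)
    then have "\<forall>\<^sub>F n in sequentially. \<bar>real_of_int k\<bar> * drift n < 1"
      by (intro order_tendstoD(2)) auto
    then obtain n where n: "\<bar>real_of_int k\<bar> * drift n < 1" by (auto simp: eventually_sequentially)
    have "k * drift n = den n * (k * slope) - k * num n" by (simp add: drift_def algebra_simps)
    also have "k * slope = - l" using assms by simp
    finally have eq: "k * drift n = of_int (- int (den n) * l - k * int (num n))" by simp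
    have "\<bar>k * drift n\<bar> < 1" "k * drift n \<noteq> 0" using n \<open>k \<noteq> 0\<close> drift_pos[of n]
      by (auto simp: abs_mult simp del: drift_pos)
    moreover have "False" if "\<bar>real_of_int x\<bar> < 1" "real_of_int x \<noteq> 0" for x
      using that by (cases x "0::int" rule: linorder_cases) auto
    ultimately show False unfolding eq by blast
  qed
  then show "l = 0" using assms by simp
qed

text \<open>Modulo integers only the error term of \<open>slope_tau\<close> survives in the first
  coordinate, and nothing in the second.\<close>

lemma torus_proj_tau:
  fixes j :: real
  assumes "j \<in> \<int>"
  shows "torus_proj (slope * (j * tau n), j * tau n) = torus_proj (j * (tau n * drift n / den n), 0)"
proof -
  obtain i where j: "j = of_int i" using assms unfolding Ints_def by blast
  have per: "cis (2 * pi * (real_of_int k + x)) = cis (2 * pi * x)" for k x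
    using cis_multiple_2pi[of "of_int k"] by (simp add: distrib_left cis_mult[symmetric] mult_ac)
  have "slope * (j * tau n) = real_of_int (i * int (2 ^ (200 * den n) * num n)) + j * (tau n * drift n / den n)"
    using arg_cong[OF slope_tau[of n], of "\<lambda>x. j * x"] by (simp add: j algebra_simps)
  moreover have "j * tau n = real_of_int (i * int (tau n)) + 0" by (simp add: j)
  ultimately show ?thesis unfolding torus_proj_def fst_conv snd_conv by (simp only: per)
qed

lemma torus_proj_tau_tendsto:
  fixes j :: real
  assumes "j \<in> \<int>" shows "(\<lambda>n. torus_proj (slope * (j * tau n), j * tau n)) \<longlonglongrightarrow> (1, 1)"
proof -
  have "(\<lambda>n. tau n * drift n / den n) \<longlonglongrightarrow> 0"
  proof (rule tendsto_sandwich[OF _ _ tendsto_const])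
    show "\<forall>\<^sub>F n in sequentially. 0 \<le> tau n * drift n / den n" by (simp add: less_imp_le)
    show "\<forall>\<^sub>F n in sequentially. tau n * drift n / den n \<le> 1 / real n"
    proof (intro eventually_sequentiallyI[of 1] frac_le)
      show "tau n * drift n \<le> 1" for n using tau_drift_le[of n] by simp
      show "real n \<le> real (den n)" for n using den_gt[of n] by simp
    qed auto
    show "(\<lambda>n. 1 / real n) \<longlonglongrightarrow> 0" by real_asymp
  qed
  note lim = tendsto_mult[OF tendsto_const this, of j]
  have "(\<lambda>n. torus_proj (j * (tau n * drift n / den n), 0)) \<longlonglongrightarrow> torus_proj (j * 0, 0)"
    unfolding torus_proj_def fst_conv snd_conv by (intro tendsto_Pair tendsto_cis tendsto_mult tendsto_const lim)
  then show ?thesis unfolding torus_proj_tau[OF assms] by (simp add: torus_proj_def)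
qed

lemma filterlim_den: "filterlim den at_top sequentially"
  by (rule filterlim_at_top_mono[OF filterlim_ident]) (simp add: den_gt less_imp_le)

text \<open>Every partial sum of \<open>slope\<close> is at most 2. This controls the second
  frequency of \<open>chi\<close> when phases become complex.\<close>

lemma num_le: "num n \<le> 2 * den n"
proof -
  have "den_tail 0 = (\<Sum>k\<le>n. 1 / real (den k)) + den_tail (Suc n)"
    using slope_eq[of n] by (simp add: slope_def den_tail_def)
  then have "(\<Sum>k\<le>n. 1 / real (den k)) \<le> 2" using den_tail_le[of 0] den_tail_pos[of "Suc n"] by simp
  then have "real (num n) \<le> real (den n) * 2" unfolding real_num by (rule mult_left_mono) auto
  then show ?thesis by linarith
qed

section \<open>The time change of the linear flow\<close>

definition hfun :: "real \<Rightarrow> real" where "hfun w = cos (2 * pi * w) + cos (4 * pi * w)"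

definition hder :: "real \<Rightarrow> real" where
  "hder w = - 2 * pi * (sin (2 * pi * w) + 2 * sin (4 * pi * w))"

text \<open>\<open>hcirc\<close> and \<open>dcirc\<close> are \<open>hfun\<close> and
  \<open>hder\<close> as functions of \<open>u = cis (2 * pi * w)\<close>: on the torus only this
  character is well defined, not the phase \<open>w\<close>.\<close>

definition hcirc :: "complex \<Rightarrow> real" where "hcirc u = Re u + Re (u ^ 2)"

definition dcirc :: "complex \<Rightarrow> real" where "dcirc u = - 2 * pi * (Im u + 2 * Im (u ^ 2))"

text \<open>On the unit circle \<open>cnj\<close> is inversion, so this is the character with
  frequencies \<open>(den m, - num m)\<close>; the linear flow turns it at the slow rate
  \<open>drift m\<close>.\<close>

definition chi :: "nat \<Rightarrow> complex \<times> complex \<Rightarrow> complex" where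
  "chi m z = fst z ^ den m * cnj (snd z) ^ num m"

definition lin :: "real \<Rightarrow> complex \<times> complex \<Rightarrow> complex \<times> complex" where
  "lin s z = rot (torus_proj (slope * s, s)) z"

definition Phi :: "real \<Rightarrow> complex \<times> complex \<Rightarrow> real" where
  "Phi s z = s + (\<Sum>m. amp m * (hcirc (chi m z * cis (2 * pi * (drift m * s))) - hcirc (chi m z)))"

definition phi :: "complex \<times> complex \<Rightarrow> real" where
  "phi z = 1 + (\<Sum>m. amp m * drift m * dcirc (chi m z))"

lemma cis_squared: "cis (2 * pi * w) ^ 2 = cis (4 * pi * w)"
  by (simp add: power2_eq_square cis_mult mult.assoc)

lemma hcirc_cis: "hcirc (cis (2 * pi * w)) = hfun w"
  unfolding hcirc_def hfun_def cis_squared by simp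

lemma dcirc_cis: "dcirc (cis (2 * pi * w)) = hder w"
  unfolding dcirc_def hder_def cis_squared by simp

lemma hfun_has_derivative: "(hfun has_real_derivative hder w) (at w)"
  unfolding hfun_def[abs_def] hder_def by (auto intro!: derivative_eq_intros simp: algebra_simps)

lemma abs_hder_le: "\<bar>hder w\<bar> \<le> 6 * pi"
proof -
  have "\<bar>sin (2 * pi * w) + 2 * sin (4 * pi * w)\<bar> \<le> 3"
    using abs_sin_le_one[of "2 * pi * w"] abs_sin_le_one[of "4 * pi * w"] by linarith
  then have "2 * pi * \<bar>sin (2 * pi * w) + 2 * sin (4 * pi * w)\<bar> \<le> 2 * pi * 3"
    by (intro mult_left_mono) auto
  then show ?thesis by (simp add: hder_def abs_mult)
qed

lemma hfun_lipschitz: "\<bar>hfun a - hfun b\<bar> \<le> 6 * pi * \<bar>a - b\<bar>"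
  using field_differentiable_bound[of UNIV hfun hder "6 * pi" a b]
    hfun_has_derivative abs_hder_le by (auto intro: has_field_derivative_at_within)

lemma unit_complex_cis: assumes "cmod u = 1" obtains a where "u = cis (2 * pi * a)"
proof -
  have "u = cis (2 * pi * (Arg u / (2 * pi)))" using assms rcis_cmod_Arg[of u] by (simp add: rcis_def)
  then show ?thesis using that by blast
qed

lemma hcirc_cis_lipschitz:
  assumes "cmod u = 1"
  shows "\<bar>hcirc (u * cis (2 * pi * a)) - hcirc (u * cis (2 * pi * b))\<bar> \<le> 6 * pi * \<bar>a - b\<bar>"
proof -
  obtain c where u: "u = cis (2 * pi * c)" using assms by (rule unit_complex_cis)
  show ?thesis using hfun_lipschitz[of "c + a" "c + b"]
    by (simp add: u cis_mult distrib_left[symmetric] hcirc_cis)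
qed

lemma abs_dcirc_le: "cmod u = 1 \<Longrightarrow> \<bar>dcirc u\<bar> \<le> 6 * pi"
  by (erule unit_complex_cis) (simp add: dcirc_cis abs_hder_le)

lemma chi_torus_proj:
  fixes x y :: real
  shows "chi m (torus_proj (x, y)) = cis (2 * pi * (den m * x - num m * y))"
  unfolding chi_def torus_proj_def fst_conv snd_conv cis_cnj Complex.DeMoivre cis_mult
  by (simp add: algebra_simps)

lemma chi_rot: "chi m (rot c z) = chi m c * chi m z"
  by (simp add: chi_def rot_def power_mult_distrib)

lemma cmod_chi: "z \<in> torus \<Longrightarrow> cmod (chi m z) = 1"
  by (simp add: chi_def torus_iff norm_mult norm_power)

lemma continuous_chi: "continuous_on A (chi m)"
  unfolding chi_def by (intro continuous_intros)

lemma chi_lin: "chi m (lin s z) = chi m z * cis (2 * pi * (drift m * s))"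
  by (simp add: lin_def chi_rot chi_torus_proj drift_def algebra_simps)

lemma lin_in_torus [simp]: "z \<in> torus \<Longrightarrow> lin s z \<in> torus"
  by (simp add: lin_def)

lemma lin_lin: "lin s (lin t z) = lin (s + t) z"
  by (simp add: lin_def rot_proj_rot_proj distrib_left)

lemma lin_0 [simp]: "lin 0 z = z"
  by (simp add: lin_def torus_proj_def rot_def)

text \<open>\<open>6 * pi\<close> is the Lipschitz constant of \<open>hfun\<close>, and the weights
  on the right sum to \<open>1/2\<close>, which keeps the density between \<open>1/2\<close> and
  \<open>3/2\<close>. The 7 in the proof comes from \<open>4 * 24 < 2 ^ 7\<close>.\<close>

lemma amp_drift_weight: "6 * pi * (amp m * drift m) \<le> 1/4 * (1/2) ^ m"
proof -
  have "amp m * drift m \<le> (1/2) ^ (200 * den m)" by (rule amp_drift_le)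
  also have "\<dots> \<le> (1/2) ^ (m + 7)" using den_gt[of m] by (intro power_decreasing) auto
  finally have "6 * pi * (amp m * drift m) \<le> 6 * pi * (1/2) ^ (m + 7)" by simp
  also have "\<dots> \<le> 24 * (1/2) ^ (m + 7)" using pi_less_4 by (intro mult_right_mono) auto
  also have "\<dots> \<le> 1/4 * (1/2) ^ m" by (simp add: power_add power_divide field_simps)
  finally show ?thesis .
qed

lemma summable_weight: "summable (\<lambda>m. 1/4 * (1/2::real) ^ m)"
  by (intro summable_mult summable_geometric) auto

lemma suminf_weight: "(\<Sum>m. 1/4 * (1/2::real) ^ m) = 1/2"
  by (subst suminf_mult) (auto simp: suminf_geometric intro: summable_geometric)

definition Phi_term :: "nat \<Rightarrow> real \<Rightarrow> complex \<times> complex \<Rightarrow> real" where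
  "Phi_term m s z = amp m * (hcirc (chi m z * cis (2 * pi * (drift m * s))) - hcirc (chi m z))"

lemma Phi_eq: "Phi s z = s + (\<Sum>m. Phi_term m s z)"
  by (simp add: Phi_def Phi_term_def)

lemma Phi_term_lipschitz:
  assumes "z \<in> torus"
  shows "\<bar>Phi_term m s z - Phi_term m t z\<bar> \<le> \<bar>s - t\<bar> * (1/4 * (1/2) ^ m)"
proof -
  have "\<bar>Phi_term m s z - Phi_term m t z\<bar> \<le> amp m * (6 * pi * \<bar>drift m * s - drift m * t\<bar>)"
    using mult_left_mono[OF hcirc_cis_lipschitz[OF cmod_chi[OF assms, of m], of "drift m * s" "drift m * t"] amp_nonneg[of m]]
    by (simp add: Phi_term_def right_diff_distrib[symmetric] abs_mult)
  also have "\<dots> = \<bar>s - t\<bar> * (6 * pi * (amp m * drift m))"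
    using drift_pos[of m] by (simp add: right_diff_distrib[symmetric] abs_mult del: drift_pos)
  also have "\<dots> \<le> \<bar>s - t\<bar> * (1/4 * (1/2) ^ m)"
    by (intro mult_left_mono amp_drift_weight) auto
  finally show ?thesis .
qed

lemma Phi_term_0 [simp]: "Phi_term m 0 z = 0" by (simp add: Phi_term_def)

lemma Phi_term_bound: "z \<in> torus \<Longrightarrow> \<bar>Phi_term m s z\<bar> \<le> \<bar>s\<bar> * (1/4 * (1/2) ^ m)"
  using Phi_term_lipschitz[of z m s 0] by simp

lemma summable_Phi_term: "z \<in> torus \<Longrightarrow> summable (\<lambda>m. Phi_term m s z)"
  by (rule summable_comparison_test'[OF summable_mult[OF summable_weight, of "\<bar>s\<bar>"], where N = 0])
     (use Phi_term_bound in auto)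

text \<open>The total weight \<open>1/2\<close> makes \<open>Phi\<close> a perturbation of the
  identity in time with Lipschitz constant \<open>1/2\<close>; monotonicity, surjectivity and the
  two-sided Lipschitz bounds in time follow from this estimate.\<close>

lemma Phi_lipschitz_id:
  assumes "z \<in> torus" shows "\<bar>(Phi s z - Phi t z) - (s - t)\<bar> \<le> \<bar>s - t\<bar> / 2"
proof -
  have "(Phi s z - Phi t z) - (s - t) = (\<Sum>m. Phi_term m s z - Phi_term m t z)"
    using assms by (simp add: Phi_eq suminf_diff[OF summable_Phi_term summable_Phi_term])
  also have "\<bar>\<dots>\<bar> \<le> (\<Sum>m. \<bar>s - t\<bar> * (1/4 * (1/2) ^ m))"
    using norm_suminf_le[of "\<lambda>m. Phi_term m s z - Phi_term m t z", OF _ summable_mult[OF summable_weight]]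
      Phi_term_lipschitz[OF assms] by simp
  also have "\<dots> = \<bar>s - t\<bar> / 2"
    using suminf_mult[OF summable_weight, of "\<bar>s - t\<bar>"] unfolding suminf_weight by simp
  finally show ?thesis .
qed

lemma Phi_lipschitz: "z \<in> torus \<Longrightarrow> \<bar>Phi s z - Phi t z\<bar> \<le> 3/2 * \<bar>s - t\<bar>"
  by (drule Phi_lipschitz_id[of z s t]) (auto simp: abs_if field_simps split: if_splits)

lemma Phi_expand: "z \<in> torus \<Longrightarrow> \<bar>s - t\<bar> \<le> 2 * \<bar>Phi s z - Phi t z\<bar>"
  by (drule Phi_lipschitz_id[of z s t]) (auto simp: abs_if field_simps split: if_splits)

lemma Phi_mono: "z \<in> torus \<Longrightarrow> s \<le> t \<Longrightarrow> Phi s z \<le> Phi t z"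
  by (drule Phi_lipschitz_id[of z s t]) (auto simp: abs_if field_simps split: if_splits)

lemma Phi_0 [simp]: "Phi 0 z = 0" by (simp add: Phi_eq)

text \<open>Each term is a coboundary, the difference of \<open>amp m * hcirc (chi m _)\<close> at
  \<open>lin s z\<close> and at \<open>z\<close>, so the cocycle identity holds term by
  term.\<close>

lemma Phi_add: assumes "z \<in> torus" shows "Phi (s + t) z = Phi t z + Phi s (lin t z)"
proof -
  have "Phi_term m (s + t) z = Phi_term m t z + Phi_term m s (lin t z)" for m
    by (simp add: Phi_term_def chi_lin mult.assoc cis_mult distrib_left algebra_simps)
  then show ?thesis using assms
    by (simp add: Phi_eq suminf_add[OF summable_Phi_term summable_Phi_term, symmetric])
qed

lemma phi_term_bound: "z \<in> torus \<Longrightarrow> \<bar>amp m * drift m * dcirc (chi m z)\<bar> \<le> 1/4 * (1/2) ^ m"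
proof -
  assume z: "z \<in> torus"
  have "\<bar>amp m * drift m * dcirc (chi m z)\<bar> \<le> amp m * drift m * (6 * pi)"
    using abs_dcirc_le[OF cmod_chi[OF z, of m]] drift_pos[of m]
    by (simp add: abs_mult less_imp_le mult_left_mono)
  also have "\<dots> \<le> 1/4 * (1/2) ^ m" using amp_drift_weight[of m] by (simp add: mult_ac)
  finally show ?thesis .
qed

lemma phi_bounds: assumes "z \<in> torus" shows "1/2 \<le> phi z" "phi z \<le> 3/2"
proof -
  have "\<bar>\<Sum>m. amp m * drift m * dcirc (chi m z)\<bar> \<le> (\<Sum>m. 1/4 * (1/2) ^ m)"
    using norm_suminf_le[of "\<lambda>m. amp m * drift m * dcirc (chi m z)", OF _ summable_weight]
      phi_term_bound[OF assms] by simp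
  then have "\<bar>phi z - 1\<bar> \<le> 1/2" unfolding suminf_weight by (simp add: phi_def)
  then show "1/2 \<le> phi z" "phi z \<le> 3/2" by linarith+
qed

lemma continuous_dcirc: "continuous_on A dcirc" and continuous_hcirc: "continuous_on A hcirc"
  unfolding dcirc_def hcirc_def by (intro continuous_intros)+

lemma continuous_phi: "continuous_on torus phi"
proof -
  have "continuous_on torus (\<lambda>z. \<Sum>m. amp m * drift m * dcirc (chi m z))"
  proof (rule uniform_limit_theorem)
    show "uniform_limit torus (\<lambda>n z. \<Sum>m<n. amp m * drift m * dcirc (chi m z)) (\<lambda>z. \<Sum>m. amp m * drift m * dcirc (chi m z)) sequentially"
      by (rule Weierstrass_m_test[OF _ summable_weight]) (use phi_term_bound in auto)
    show "\<forall>\<^sub>F n in sequentially. continuous_on torus (\<lambda>z. \<Sum>m<n. amp m * drift m * dcirc (chi m z))"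
      by (intro always_eventually allI continuous_on_sum continuous_on_mult continuous_on_const
          continuous_on_compose2[OF continuous_dcirc[of UNIV]] continuous_chi) auto
  qed simp
  then show ?thesis unfolding phi_def[abs_def] by (intro continuous_on_add continuous_on_const)
qed

lemma Phi_has_derivative:
  assumes z: "z \<in> torus" shows "((\<lambda>s. Phi s z) has_real_derivative phi (lin s z)) (at s)"
proof -
  have d: "((\<lambda>s. Phi_term m s z) has_real_derivative amp m * drift m * dcirc (chi m (lin s z))) (at s)" for m s
  proof -
    obtain a where a: "chi m z = cis (2 * pi * a)" using cmod_chi[OF z] by (rule unit_complex_cis)
    have "Phi_term m s z = amp m * (hfun (a + drift m * s) - hfun a)" for s
      by (simp add: Phi_term_def a cis_mult distrib_left[symmetric] hcirc_cis)
    moreover have "dcirc (chi m (lin s z)) = hder (a + drift m * s)"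
      by (simp add: chi_lin a cis_mult distrib_left[symmetric] dcirc_cis)
    ultimately show ?thesis
      by (auto intro!: derivative_eq_intros DERIV_chain2[OF hfun_has_derivative])
  qed
  have "((\<lambda>s. \<Sum>m. Phi_term m s z) has_real_derivative (\<Sum>m. amp m * drift m * dcirc (chi m (lin s z)))) (at s)"
  proof (rule has_field_derivative_series'(2))
    show "((\<lambda>s. Phi_term m s z) has_real_derivative amp m * drift m * dcirc (chi m (lin s z))) (at s within UNIV)" for m s
      using d by simp
    show "uniformly_convergent_on UNIV (\<lambda>n s. \<Sum>m<n. amp m * drift m * dcirc (chi m (lin s z)))"
      by (rule Weierstrass_m_test'[OF _ summable_weight]) (use phi_term_bound z in auto)
    show "summable (\<lambda>m. Phi_term m 0 z)" using z by (rule summable_Phi_term)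
  qed auto
  then show ?thesis
    unfolding Phi_eq[abs_def] phi_def by (auto intro!: derivative_eq_intros)
qed

text \<open>Continuity in the point at each fixed time becomes joint because the Lipschitz constant
  in time does not depend on the point.\<close>

lemma continuous_on_lipschitz_fst:
  fixes f :: "real \<Rightarrow> 'a :: topological_space \<Rightarrow> 'b :: metric_space"
  assumes lip: "\<And>s t z. z \<in> B \<Longrightarrow> dist (f s z) (f t z) \<le> L * \<bar>s - t\<bar>"
    and cont: "\<And>s. continuous_on B (f s)"
  shows "continuous_on (UNIV \<times> B) (\<lambda>(s, z). f s z)"
  unfolding continuous_on_def
proof
  fix p :: "real \<times> 'a" assume p: "p \<in> UNIV \<times> B"
  obtain s z where sz: "p = (s, z)" "z \<in> B" using p by auto
  have fst: "(fst \<longlongrightarrow> s) (at p within UNIV \<times> B)" and snd: "(snd \<longlongrightarrow> z) (at p within UNIV \<times> B)"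
    unfolding sz by (auto intro!: tendsto_eq_intros)
  have "((\<lambda>p. f s (snd p)) \<longlongrightarrow> f s z) (at p within UNIV \<times> B)"
    using continuous_on_compose2[OF cont[of s] continuous_on_snd[OF continuous_on_id], of "UNIV \<times> B"] p
    unfolding continuous_on_def sz by auto
  then have 1: "((\<lambda>p. dist (f s (snd p)) (f s z)) \<longlongrightarrow> 0) (at p within UNIV \<times> B)"
    by (rule iffD1[OF tendsto_dist_iff])
  have 2: "((\<lambda>p. L * \<bar>fst p - s\<bar>) \<longlongrightarrow> L * \<bar>s - s\<bar>) (at p within UNIV \<times> B)"
    by (intro tendsto_intros fst)
  have "((\<lambda>p. dist (f (fst p) (snd p)) (f s z)) \<longlongrightarrow> 0) (at p within UNIV \<times> B)"
  proof (rule tendsto_sandwich[OF _ _ tendsto_const])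
    show "((\<lambda>p. L * \<bar>fst p - s\<bar> + dist (f s (snd p)) (f s z)) \<longlongrightarrow> 0) (at p within UNIV \<times> B)"
      using tendsto_add[OF 2 1] by simp
    show "\<forall>\<^sub>F p in at p within UNIV \<times> B. dist (f (fst p) (snd p)) (f s z) \<le> L * \<bar>fst p - s\<bar> + dist (f s (snd p)) (f s z)"
      unfolding eventually_at_filter
      by (intro always_eventually allI impI order_trans[OF dist_triangle add_right_mono] lip) auto
  qed auto
  then show "((\<lambda>(s, z). f s z) \<longlongrightarrow> (case p of (s, z) \<Rightarrow> f s z)) (at p within UNIV \<times> B)"
    unfolding sz by (subst tendsto_dist_iff) (simp add: case_prod_unfold)
qed

lemma continuous_Phi_snd: "continuous_on torus (Phi s)"
proof -
  have "continuous_on torus (\<lambda>z. \<Sum>m. Phi_term m s z)"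
  proof (rule uniform_limit_theorem)
    show "uniform_limit torus (\<lambda>n z. \<Sum>m<n. Phi_term m s z) (\<lambda>z. \<Sum>m. Phi_term m s z) sequentially"
      by (rule Weierstrass_m_test[OF _ summable_mult[OF summable_weight, of "\<bar>s\<bar>"]]) (use Phi_term_bound in auto)
    show "\<forall>\<^sub>F n in sequentially. continuous_on torus (\<lambda>z. \<Sum>m<n. Phi_term m s z)"
      unfolding Phi_term_def
      by (intro always_eventually allI continuous_on_sum continuous_on_mult continuous_on_diff continuous_on_const
          continuous_on_compose2[OF continuous_hcirc[of UNIV]] continuous_chi) auto
  qed simp
  then show ?thesis unfolding Phi_eq[abs_def] by (intro continuous_on_add continuous_on_const)
qed

lemma continuous_Phi: "continuous_on (UNIV \<times> torus) (\<lambda>(s, z). Phi s z)"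
  by (rule continuous_on_lipschitz_fst[OF _ continuous_Phi_snd, of _ "3/2"])
     (use Phi_lipschitz in \<open>auto simp: dist_real_def\<close>)

section \<open>The inverse time change and the flow\<close>

definition clock :: "real \<Rightarrow> complex \<times> complex \<Rightarrow> real" where
  "clock t z = (THE s. Phi s z = t)"

definition flow :: "real \<Rightarrow> complex \<times> complex \<Rightarrow> complex \<times> complex" where
  "flow t z = lin (clock t z) z"

lemma Phi_eqD: "z \<in> torus \<Longrightarrow> Phi s z = Phi t z \<Longrightarrow> s = t"
  using Phi_expand[of z s t] by simp

lemma clock_Phi [simp]: "z \<in> torus \<Longrightarrow> clock (Phi s z) z = s"
  unfolding clock_def by (rule the_equality) (auto dest: Phi_eqD)

text \<open>\<open>Phi s z\<close> differs from \<open>s\<close> by at most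
  \<open>\<bar>s\<bar> / 2\<close>, so the values at \<open>- 2 * \<bar>t\<bar>\<close> and
  \<open>2 * \<bar>t\<bar>\<close> enclose \<open>t\<close> and the intermediate value theorem gives
  a solution. With uniqueness from \<open>Phi_expand\<close> this justifies the description in
  \<open>clock\<close>.\<close>

lemma Phi_clock [simp]: assumes z: "z \<in> torus" shows "Phi (clock t z) z = t"
proof -
  have c: "continuous_on {- 2 * \<bar>t\<bar>..2 * \<bar>t\<bar>} (\<lambda>s. Phi s z)"
    using Phi_has_derivative[OF z] by (intro DERIV_atLeastAtMost_imp_continuous_on) blast
  have "\<exists>s\<ge>- 2 * \<bar>t\<bar>. s \<le> 2 * \<bar>t\<bar> \<and> Phi s z = t"
    using Phi_lipschitz_id[OF z, of "2 * \<bar>t\<bar>" 0] Phi_lipschitz_id[OF z, of "- 2 * \<bar>t\<bar>" 0]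
    by (intro IVT'[OF _ _ _ c]) auto
  then obtain s where "Phi s z = t" by blast
  then show ?thesis using clock_Phi[OF z, of s] by simp
qed

lemma clock_lipschitz: "z \<in> torus \<Longrightarrow> \<bar>clock s z - clock t z\<bar> \<le> 2 * \<bar>s - t\<bar>"
  using Phi_expand[of z "clock s z" "clock t z"] by simp

lemma clock_0 [simp]: "z \<in> torus \<Longrightarrow> clock 0 z = 0"
  using clock_Phi[of z 0] by simp

lemma continuous_clock: "continuous_on (UNIV \<times> torus) (\<lambda>(t, z). clock t z)"
proof (rule continuous_on_lipschitz_fst)
  show "dist (clock s z) (clock t z) \<le> 2 * \<bar>s - t\<bar>" if "z \<in> torus" for s t z
    using clock_lipschitz[OF that] by (simp add: dist_real_def)
  show "continuous_on torus (clock t)" for t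
    unfolding continuous_on_def
  proof
    fix z0 assume z0: "z0 \<in> torus"
    have "(Phi (clock t z0) \<longlongrightarrow> Phi (clock t z0) z0) (at z0 within torus)"
      using continuous_Phi_snd z0 unfolding continuous_on_def by blast
    then have "((\<lambda>z. 2 * \<bar>Phi (clock t z0) z - t\<bar>) \<longlongrightarrow> 2 * \<bar>Phi (clock t z0) z0 - t\<bar>) (at z0 within torus)"
      by (intro tendsto_intros)
    then have L: "((\<lambda>z. 2 * \<bar>Phi (clock t z0) z - t\<bar>) \<longlongrightarrow> 0) (at z0 within torus)" using z0 by simp
    \<comment> \<open>Expansion of \<open>Phi\<close> bounds the change of the clock by the error
      that the old clock value makes at the new point.\<close>
    have "((\<lambda>z. clock t z - clock t z0) \<longlongrightarrow> 0) (at z0 within torus)"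
    proof (rule Lim_null_comparison[OF _ L])
      show "\<forall>\<^sub>F z in at z0 within torus. norm (clock t z - clock t z0) \<le> 2 * \<bar>Phi (clock t z0) z - t\<bar>"
        unfolding eventually_at_filter
      proof (intro always_eventually allI impI)
        fix z assume "z \<in> torus"
        then show "norm (clock t z - clock t z0) \<le> 2 * \<bar>Phi (clock t z0) z - t\<bar>"
          using Phi_expand[of z "clock t z" "clock t z0"] by (simp add: abs_minus_commute)
      qed
    qed
    then show "(clock t \<longlongrightarrow> clock t z0) (at z0 within torus)" by (simp add: LIM_zero_iff)
  qed
qed

lemma flow_in_torus [simp]: "z \<in> torus \<Longrightarrow> flow t z \<in> torus"
  by (simp add: flow_def)

lemma flow_0 [simp]: "z \<in> torus \<Longrightarrow> flow 0 z = z"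
  by (simp add: flow_def)

lemma flow_Phi: "z \<in> torus \<Longrightarrow> flow (Phi s z) z = lin s z"
  by (simp add: flow_def)

text \<open>The cocycle identity of \<open>Phi\<close> becomes additivity of the inverse
  \<open>clock\<close> along the orbit.\<close>

lemma flow_add: assumes z: "z \<in> torus" shows "flow (s + t) z = flow s (flow t z)"
proof -
  have "Phi (clock s (flow t z) + clock t z) z = s + t"
    unfolding Phi_add[OF z] using z by (simp add: flow_def)
  then have "clock (s + t) z = clock s (flow t z) + clock t z"
    using clock_Phi[OF z] by metis
  then show ?thesis by (simp add: flow_def[of "s + t"] flow_def[of s] flow_def[of t] lin_lin)
qed

lemma flow_on_torus: "flow_on torus flow"
  unfolding flow_on_def by (auto simp: flow_add)

lemma flow_cancel [simp]: "z \<in> torus \<Longrightarrow> flow (- t) (flow t z) = z" "z \<in> torus \<Longrightarrow> flow t (flow (- t) z) = z"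
  by (simp_all flip: flow_add)

lemma continuous_lin: "continuous_on A (\<lambda>p. lin (fst p) (snd p))"
  unfolding lin_def rot_def torus_proj_def by (intro continuous_intros)

lemma continuous_flow: "continuous_on (UNIV \<times> torus) (\<lambda>(t, z). flow t z)"
proof -
  have "continuous_on (UNIV \<times> torus) (\<lambda>p. (clock (fst p) (snd p), snd p))"
    using continuous_clock by (intro continuous_on_Pair continuous_on_snd continuous_on_id) (simp add: case_prod_unfold)
  from continuous_on_compose2[OF continuous_lin[of UNIV] this] show ?thesis
    by (simp add: flow_def case_prod_unfold)
qed

section \<open>The invariant measure\<close>

lemma measurable_continuous_pair_torus:
  fixes F :: "real \<Rightarrow> complex \<times> complex \<Rightarrow> 'b :: topological_space"
  assumes F: "continuous_on (UNIV \<times> torus) (\<lambda>(t, z). F t z)"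
    and f: "f \<in> borel_measurable M" and g: "g \<in> M \<rightarrow>\<^sub>M torus_lebesgue"
  shows "(\<lambda>x. F (f x) (g x)) \<in> borel_measurable M"
proof -
  have "(\<lambda>(t, z). F t z) \<in> borel_measurable (restrict_space borel UNIV \<Otimes>\<^sub>M torus_borel_space)"
    by (rule continuous_on_pair_measurable[OF F]) auto
  moreover have "(\<lambda>x. (f x, g x)) \<in> M \<rightarrow>\<^sub>M restrict_space borel UNIV \<Otimes>\<^sub>M torus_borel_space"
    using f g by (intro measurable_Pair) (simp_all cong: measurable_cong_sets)
  ultimately show ?thesis by (auto dest: measurable_compose)
qed

lemma measurable_continuous_pair_torus_torus:
  fixes F :: "real \<Rightarrow> complex \<times> complex \<Rightarrow> complex \<times> complex"
  assumes F: "continuous_on (UNIV \<times> torus) (\<lambda>(t, z). F t z)" "\<And>t z. z \<in> torus \<Longrightarrow> F t z \<in> torus"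
    and f: "f \<in> borel_measurable M" and g: "g \<in> M \<rightarrow>\<^sub>M torus_lebesgue"
  shows "(\<lambda>x. F (f x) (g x)) \<in> M \<rightarrow>\<^sub>M torus_lebesgue"
proof -
  have "(\<lambda>x. F (f x) (g x)) \<in> M \<rightarrow>\<^sub>M torus_borel_space"
    using measurable_space[OF g] F(2)
    by (intro measurable_restrict_space2 measurable_continuous_pair_torus[OF F(1) f g]) auto
  then show ?thesis by (simp cong: measurable_cong_sets)
qed

lemma continuous_lin_torus: "continuous_on (UNIV \<times> torus) (\<lambda>(t, z). lin t z)"
  using continuous_lin by (simp add: case_prod_unfold)

lemmas measurable_flow [measurable (raw)] = measurable_continuous_pair_torus_torus[OF continuous_flow flow_in_torus]
lemmas measurable_lin [measurable (raw)] = measurable_continuous_pair_torus_torus[OF continuous_lin_torus lin_in_torus]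
lemmas measurable_Phi [measurable (raw)] = measurable_continuous_pair_torus[OF continuous_Phi]

lemma measurable_phi [measurable]: "phi \<in> borel_measurable torus_lebesgue"
  by (rule borel_measurable_continuous_torus[OF continuous_phi])

definition mu :: "(complex \<times> complex) measure" where
  "mu = density torus_lebesgue (\<lambda>z. ennreal (phi z))"

lemma space_mu [simp]: "space mu = torus" by (simp add: mu_def)

lemma sets_mu [simp, measurable_cong]: "sets mu = sets torus_lebesgue" by (simp add: mu_def)

lemma phi_nonneg: "z \<in> torus \<Longrightarrow> 0 \<le> phi z" using phi_bounds[of z] by simp

text \<open>Shifting the first coordinate by \<open>r / den m\<close> multiplies
  \<open>chi m\<close> by \<open>cis (2 * pi * r)\<close>. A half turn negates the first harmonic, a
  quarter turn the second.\<close>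

lemma integral_dcirc_chi: "(\<integral>z. dcirc (chi m z) \<partial>torus_lebesgue) = 0"
proof -
  have inv: "(\<integral>z. f (chi m z) \<partial>torus_lebesgue) = (\<integral>z. f (cis (2 * pi * r) * chi m z) \<partial>torus_lebesgue)"
    if "continuous_on UNIV f" for f :: "complex \<Rightarrow> real" and r
  proof -
    have "chi m (torus_proj (r / real (den m), 0)) = cis (2 * pi * r)" by (simp add: chi_torus_proj)
    moreover have "(\<lambda>z. f (chi m z)) \<in> borel_measurable torus_lebesgue"
      by (intro borel_measurable_continuous_torus continuous_on_compose2[OF that continuous_chi]) auto
    ultimately show ?thesis
      using integral_rot[of "torus_proj (r / real (den m), 0)" "\<lambda>z. f (chi m z)"] by (simp add: chi_rot)
  qed
  have "cis (2 * pi * (1/2)) = -1" "cis (2 * pi * (1/4)) = \<i>"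
    by (simp_all add: complex_eq_iff)
  then have "(\<integral>z. Im (chi m z) \<partial>torus_lebesgue) = 0" "(\<integral>z. Im ((chi m z)\<^sup>2) \<partial>torus_lebesgue) = 0"
    using inv[of Im "1/2"] inv[of "\<lambda>u. Im (u\<^sup>2)" "1/4"]
    by (simp_all add: power_mult_distrib continuous_intros)
  moreover have "integrable torus_lebesgue (\<lambda>z. Im (chi m z))" "integrable torus_lebesgue (\<lambda>z. Im ((chi m z)\<^sup>2))"
    by (intro integrable_continuous_torus continuous_on_Im continuous_on_power continuous_chi)+
  ultimately show ?thesis unfolding dcirc_def by simp
qed

lemma integral_phi: "(\<integral>z. phi z \<partial>torus_lebesgue) = 1"
proof -
  let ?f = "\<lambda>m z. amp m * drift m * dcirc (chi m z)"
  have i: "integrable torus_lebesgue (?f m)" for m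
    by (intro integrable_continuous_torus continuous_on_mult continuous_on_const
          continuous_on_compose2[OF continuous_dcirc[of UNIV]] continuous_chi) auto
  have le: "(\<integral>z. norm (?f m z) \<partial>torus_lebesgue) \<le> 1/4 * (1/2) ^ m" for m
    by (rule leb.integral_le_const) (use i phi_term_bound in auto)
  have s: "summable (\<lambda>m. \<integral>z. norm (?f m z) \<partial>torus_lebesgue)"
    by (rule summable_comparison_test'[OF summable_weight, where N = 0]) (use le in auto)
  have s2: "AE z in torus_lebesgue. summable (\<lambda>m. norm (?f m z))"
  proof (rule AE_I2)
    fix z assume "z \<in> space torus_lebesgue"
    then show "summable (\<lambda>m. norm (?f m z))"
      by (intro summable_comparison_test'[OF summable_weight, where N = 0]) (use phi_term_bound in auto)
  qed
  have "integrable torus_lebesgue (\<lambda>z. \<Sum>m. ?f m z)"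
    by (rule integrable_suminf[OF i s2 s])
  moreover have "(\<integral>z. (\<Sum>m. ?f m z) \<partial>torus_lebesgue) = 0"
    by (subst integral_suminf[OF i s2 s]) (simp add: integral_dcirc_chi)
  ultimately show ?thesis unfolding phi_def by (simp add: leb.prob_space[simplified])
qed

lemma integrable_phi: "integrable torus_lebesgue phi"
  by (rule integrable_continuous_torus[OF continuous_phi])

lemma prob_space_mu: "prob_space mu"
proof
  have "emeasure mu (space mu) = (\<integral>\<^sup>+z. ennreal (phi z) \<partial>torus_lebesgue)"
    using sets.top[of torus_lebesgue] unfolding mu_def
    by (subst emeasure_density) (auto intro!: nn_integral_cong simp: indicator_def)
  also have "\<dots> = 1"
    by (subst nn_integral_eq_integral) (auto simp: integrable_phi integral_phi phi_nonneg)
  finally show "emeasure mu (space mu) = 1" .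
qed

interpretation mu: prob_space mu by (rule prob_space_mu)

lemma integral_mu:
  fixes f :: "_ \<Rightarrow> real"
  assumes "f \<in> borel_measurable torus_lebesgue"
  shows "(\<integral>z. f z \<partial>mu) = (\<integral>z. phi z * f z \<partial>torus_lebesgue)"
  unfolding mu_def using assms by (subst integral_real_density) (auto simp: phi_nonneg)

lemma integral_mu_le:
  fixes f :: "_ \<Rightarrow> real"
  assumes f: "integrable torus_lebesgue f" "\<And>z. z \<in> torus \<Longrightarrow> 0 \<le> f z"
  shows "(\<integral>z. f z \<partial>mu) \<le> 3/2 * (\<integral>z. f z \<partial>torus_lebesgue)"
proof -
  have "(\<integral>z. f z \<partial>mu) = (\<integral>z. phi z * f z \<partial>torus_lebesgue)" using f by (intro integral_mu) simp
  also have "\<dots> \<le> (\<integral>z. 3/2 * f z \<partial>torus_lebesgue)"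
    using phi_bounds f
    by (intro integral_mono' mult_right_mono) (auto simp: phi_nonneg)
  finally show ?thesis by simp
qed

text \<open>\<open>phi\<close> is bounded below on the torus, so both measures have the same null
  sets and almost-everywhere arguments may use Haar measure.\<close>

lemma AE_mu_iff: "(AE z in mu. P z) \<longleftrightarrow> (AE z in torus_lebesgue. P z)"
proof -
  have "(AE z in mu. P z) \<longleftrightarrow> (AE z in torus_lebesgue. 0 < ennreal (phi z) \<longrightarrow> P z)"
    unfolding mu_def by (rule AE_density) simp
  also have "\<dots> \<longleftrightarrow> (AE z in torus_lebesgue. P z)"
    using phi_bounds by (intro AE_cong) (force simp: ennreal_less_zero_iff)
  finally show ?thesis .
qed

lemma integrable_phi_mult:
  fixes f :: "_ \<Rightarrow> real"
  assumes [measurable]: "f \<in> borel_measurable torus_lebesgue" and f: "\<And>z. z \<in> torus \<Longrightarrow> \<bar>f z\<bar> \<le> 1"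
  shows "integrable torus_lebesgue (\<lambda>z. phi z * f z)"
proof (rule Bochner_Integration.integrable_bound[OF integrable_phi])
  show "AE z in torus_lebesgue. norm (phi z * f z) \<le> norm (phi z)"
  proof (rule AE_I2)
    fix z assume "z \<in> space torus_lebesgue"
    then show "norm (phi z * f z) \<le> norm (phi z)"
      using mult_left_mono[OF f[of z], of "\<bar>phi z\<bar>"] by (simp add: abs_mult)
  qed
qed simp

text \<open>The two windows differ only inside two intervals of length \<open>\<bar>t\<bar>\<close>,
  one at each end.\<close>

lemma window_shift_bound:
  fixes F :: "real \<Rightarrow> real"
  assumes [measurable]: "F \<in> borel_measurable borel" and F: "\<And>v. \<bar>F v\<bar> \<le> 1" and P: "P \<ge> 0"
  shows "\<bar>(LBINT v. F v * indicator {t..t + P} v) - (LBINT v. F v * indicator {0..P} v)\<bar> \<le> 2 * \<bar>t\<bar>"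
proof -
  have Fi: "set_integrable lborel {a..b} F" for a b
    unfolding set_integrable_def using F
    by (intro integrableI_bounded_set_indicator[where B = 1]) (auto simp: emeasure_lborel_Icc_eq)
  have "(LBINT v. F v * indicator {t..t + P} v) - (LBINT v. F v * indicator {0..P} v) =
      (LBINT v. F v * indicator {t..t + P} v - F v * indicator {0..P} v)"
    using Fi[of t "t + P"] Fi[of 0 P] by (subst Bochner_Integration.integral_diff) (simp_all add: set_integrable_def mult.commute)
  moreover have "\<bar>LBINT v. F v * indicator {t..t + P} v - F v * indicator {0..P} v\<bar> \<le>
      (LBINT v. indicator {min 0 t..max 0 t} v + indicator {P + min 0 t..P + max 0 t} v)"
  proof (rule order_trans[OF integral_abs_bound integral_mono'])
    show "integrable lborel (\<lambda>v. indicator {min 0 t..max 0 t} v + indicator {P + min 0 t..P + max 0 t} v :: real)"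
      by simp
    show "\<bar>F v * indicator {t..t + P} v - F v * indicator {0..P} v\<bar> \<le> indicator {min 0 t..max 0 t} v + indicator {P + min 0 t..P + max 0 t} v" for v
    proof -
      have "\<bar>F v * indicator {t..t + P} v - F v * indicator {0..P} v\<bar> = \<bar>F v\<bar> * \<bar>indicator {t..t + P} v - indicator {0..P} v\<bar>"
        by (simp add: abs_mult[symmetric] right_diff_distrib)
      also have "\<dots> \<le> 1 * \<bar>indicator {t..t + P} v - indicator {0..P} v\<bar>"
        by (intro mult_right_mono F) auto
      also have "\<dots> \<le> indicator {min 0 t..max 0 t} v + indicator {P + min 0 t..P + max 0 t} v"
      proof (cases "t \<ge> 0")
        case True
        then have "min 0 t = 0" "max 0 t = t" by auto
        then show ?thesis using P True by (auto simp: indicator_def)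
      next
        case False
        then have "min 0 t = t" "max 0 t = 0" by auto
        then show ?thesis using P False by (auto simp: indicator_def)
      qed
      finally show ?thesis .
    qed
  qed simp
  moreover have "\<dots> = 2 * \<bar>t\<bar>"
  proof -
    have "integrable lborel (indicator {a..b} :: real \<Rightarrow> real)" for a b :: real
      by (rule integrable_real_indicator) (auto simp: emeasure_lborel_Icc_eq)
    from Bochner_Integration.integral_add[OF this this]
    have "(LBINT v. indicator {min 0 t..max 0 t} v + indicator {P + min 0 t..P + max 0 t} v) =
        measure lborel {min 0 t..max 0 t} + measure lborel {P + min 0 t..P + max 0 t}" by simp
    then show ?thesis by (simp add: min_def max_def)
  qed
  ultimately show ?thesis by simp
qed

text \<open>
  Along a single orbit, the time change turns \<open>\<integral>\<^sub>0\<^sup>S f (T\<^sub>t R\<^sub>s z) phi (R\<^sub>s z) ds\<close> into an integral of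
  \<open>v \<mapsto> f (T\<^sub>v z)\<close> over an interval that is shifted by \<open>t\<close>, hence changes by at most \<open>2\<bar>t\<bar>\<close>.
\<close>

lemma orbit_integral_shift:
  fixes f :: "complex \<times> complex \<Rightarrow> real"
  assumes f [measurable]: "f \<in> borel_measurable torus_lebesgue" and bound: "\<And>z. z \<in> torus \<Longrightarrow> \<bar>f z\<bar> \<le> 1"
    and z: "z \<in> torus" and S: "S > 0"
  shows "\<bar>LINT r:{0..1}|lborel. (f (flow t (lin (S * r) z)) - f (lin (S * r) z)) * phi (lin (S * r) z)\<bar> \<le> 2 * \<bar>t\<bar> / S"
proof -
  have zm: "(\<lambda>_. z) \<in> lborel \<rightarrow>\<^sub>M torus_lebesgue" "(\<lambda>_. z) \<in> borel \<rightarrow>\<^sub>M torus_lebesgue" using z by auto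
  note [measurable] = zm
  define F where "F v = f (flow v z)" for v
  have Fm [measurable]: "F \<in> borel_measurable lborel" unfolding F_def by measurable
  have Fb: "\<bar>F v\<bar> \<le> 1" for v unfolding F_def using z by (intro bound) auto
  have Fi: "set_integrable lborel {a..b} F" for a b
    unfolding set_integrable_def using Fb
    by (intro integrableI_bounded_set_indicator[where B = 1]) (auto simp: emeasure_lborel_Icc_eq)
  define P where "P = Phi S z"
  have P0: "P \<ge> 0" unfolding P_def using Phi_mono[OF z, of 0 S] S by simp
  \<comment> \<open>Substitution \<open>v = t + Phi (S * r) z\<close>, whose derivative supplies the
    weight \<open>phi\<close>.\<close>
  have sub: "(LBINT v. F v * indicator {t..t + P} v) = (LBINT r. F (t + Phi (S * r) z) * (S * phi (lin (S * r) z)) * indicator {0..1} r)" for t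
  proof -
    have "((\<lambda>r. t + Phi (S * r) z) has_real_derivative S * phi (lin (S * r) z)) (at r)" for r
      by (auto intro!: derivative_eq_intros DERIV_chain2[OF Phi_has_derivative[OF z]])
    moreover have "continuous_on {0..1} (\<lambda>r. S * phi (lin (S * r) z))"
      unfolding lin_def
      by (intro continuous_on_mult continuous_on_const continuous_on_compose2[OF continuous_phi])
         (use z in \<open>auto simp: rot_def torus_proj_def torus_iff norm_mult intro!: continuous_intros\<close>)
    ultimately show ?thesis
      using integral_substitution(2)[where f = F and g = "\<lambda>r. t + Phi (S * r) z" and a = 0 and b = 1
          and g' = "\<lambda>r. S * phi (lin (S * r) z)"] Fi S z
      by (simp add: P_def phi_nonneg)
  qed
  have m1 [measurable]: "(\<lambda>r. lin (S * r) z) \<in> lborel \<rightarrow>\<^sub>M torus_lebesgue" by measurable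
  have FPhi: "F (t + Phi (S * r) z) = f (flow t (lin (S * r) z))" for t r
    unfolding F_def using z by (simp add: flow_add flow_Phi)
  let ?J = "LINT r:{0..1}|lborel. (f (flow t (lin (S * r) z)) - f (lin (S * r) z)) * phi (lin (S * r) z)"
  have pi2: "integrable lborel (\<lambda>r. F (t + Phi (S * r) z) * (S * phi (lin (S * r) z)) * indicator {0..1} r)" for t
  proof -
    have "\<bar>F (t + Phi (S * r) z) * (S * phi (lin (S * r) z))\<bar> \<le> 1 * (S * (3/2))" for r
      unfolding abs_mult using Fb phi_bounds[of "lin (S * r) z"] z S
      by (intro mult_mono) auto
    then have "integrable lborel (\<lambda>r. indicator {0..1} r *\<^sub>R (F (t + Phi (S * r) z) * (S * phi (lin (S * r) z))))"
      by (intro integrableI_bounded_set_indicator[where B = "S * (3/2)"]) auto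
    then show ?thesis by (simp add: mult.commute)
  qed
  have "S * ?J = (LBINT r. S * (indicator {0..1} r * ((f (flow t (lin (S * r) z)) - f (lin (S * r) z)) * phi (lin (S * r) z))))"
    by (simp add: set_lebesgue_integral_def)
  also have "\<dots> = (LBINT r. F (t + Phi (S * r) z) * (S * phi (lin (S * r) z)) * indicator {0..1} r -
     F (0 + Phi (S * r) z) * (S * phi (lin (S * r) z)) * indicator {0..1} r)"
    unfolding FPhi using z by (intro Bochner_Integration.integral_cong refl) (simp add: algebra_simps)
  also have "\<dots> = (LBINT v. F v * indicator {t..t + P} v) - (LBINT v. F v * indicator {0..0 + P} v)"
    unfolding sub by (rule Bochner_Integration.integral_diff[OF pi2 pi2])
  finally have eq: "S * ?J = (LBINT v. F v * indicator {t..t + P} v) - (LBINT v. F v * indicator {0..0 + P} v)" .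
  have "S * \<bar>?J\<bar> = \<bar>S * ?J\<bar>" using S by (simp add: abs_mult)
  also have "\<dots> \<le> 2 * \<bar>t\<bar>"
    unfolding eq using window_shift_bound[of F P t] Fm Fb P0 by simp
  finally have "S * \<bar>?J\<bar> \<le> 2 * \<bar>t\<bar>" .
  then show ?thesis using S by (simp add: field_simps)
qed

text \<open>Invariance of Haar measure under the linear flow allows averaging over linear orbits of
  any length \<open>S\<close>; the orbitwise estimate then bounds the defect by
  \<open>2 * \<bar>t\<bar> / S\<close> for all \<open>S\<close>, so it vanishes.\<close>

lemma integral_flow_bounded:
  fixes f :: "complex \<times> complex \<Rightarrow> real"
  assumes f [measurable]: "f \<in> borel_measurable torus_lebesgue" and bound: "\<And>z. z \<in> torus \<Longrightarrow> \<bar>f z\<bar> \<le> 1"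
  shows "(\<integral>z. f (flow t z) \<partial>mu) = (\<integral>z. f z \<partial>mu)"
proof -
  interpret U: prob_space unit_interval by (rule prob_space_unit_interval)
  interpret P: pair_prob_space unit_interval torus_lebesgue ..
  define G where "G z = (f (flow t z) - f z) * phi z" for z
  have Gm [measurable]: "G \<in> borel_measurable torus_lebesgue" unfolding G_def by measurable
  have Gb: "\<bar>G z\<bar> \<le> 2 * (3/2)" if "z \<in> torus" for z
    unfolding G_def abs_mult using bound[OF that] bound[of "flow t z"] phi_bounds[OF that] that
    by (intro mult_mono) auto
  have Gi: "integrable torus_lebesgue G"
    by (rule leb.integrable_const_bound[where B = 3]) (use Gb in auto)
  have D: "\<bar>\<integral>z. G z \<partial>torus_lebesgue\<bar> \<le> 2 * \<bar>t\<bar> / S" if S: "S > 0" for S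
  proof -
    have "(\<lambda>p. G (lin (S * fst p) (snd p))) \<in> borel_measurable (unit_interval \<Otimes>\<^sub>M torus_lebesgue)"
      by (intro measurable_compose[OF measurable_lin Gm] borel_measurable_times borel_measurable_const
          measurable_compose[OF measurable_fst measurable_restrict_space1] measurable_snd) auto
    then have I: "integrable (unit_interval \<Otimes>\<^sub>M torus_lebesgue) (\<lambda>(r, z). G (lin (S * r) z))"
      unfolding case_prod_unfold
      by (intro P.integrable_const_bound[where B = 3] AE_I2) (simp_all add: Gb[simplified] space_pair_measure mem_Times_iff)
    have "(\<integral>z. G z \<partial>torus_lebesgue) = (\<integral>r. (\<integral>z. G (lin (S * r) z) \<partial>torus_lebesgue) \<partial>unit_interval)"
      using U.prob_space by (simp add: lin_def integral_rot space_restrict_space)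
    also have "\<dots> = (\<integral>z. (\<integral>r. G (lin (S * r) z) \<partial>unit_interval) \<partial>torus_lebesgue)"
      using P.Fubini_integral[OF I] by simp
    also have "\<bar>\<dots>\<bar> \<le> 2 * \<bar>t\<bar> / S"
    proof (rule order_trans[OF integral_abs_bound leb.integral_le_const])
      show "integrable torus_lebesgue (\<lambda>z. \<bar>\<integral>r. G (lin (S * r) z) \<partial>unit_interval\<bar>)"
        using P.integrable_snd[OF I] by simp
      show "AE z in torus_lebesgue. \<bar>\<integral>r. G (lin (S * r) z) \<partial>unit_interval\<bar> \<le> 2 * \<bar>t\<bar> / S"
        using orbit_integral_shift[OF f bound _ S, of _ t] by (intro AE_I2) (simp add: integral_unit_interval G_def)
    qed
    finally show ?thesis .
  qed
  have "(\<integral>z. G z \<partial>torus_lebesgue) = 0"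
  proof (rule ccontr)
    assume "\<not> ?thesis"
    then have pos: "\<bar>\<integral>z. G z \<partial>torus_lebesgue\<bar> > 0" by simp
    \<comment> \<open>For this \<open>S\<close> the bound \<open>2 * \<bar>t\<bar> / S\<close> is
      strictly smaller than the integral it should dominate.\<close>
    define S where "S = (2 * \<bar>t\<bar> + 1) / \<bar>\<integral>z. G z \<partial>torus_lebesgue\<bar>"
    have "S > 0" using pos by (simp add: S_def)
    from D[OF this] show False using pos \<open>S > 0\<close> by (simp add: S_def field_simps)
  qed
  moreover have "integrable torus_lebesgue (\<lambda>z. phi z * f z)" "integrable torus_lebesgue (\<lambda>z. phi z * f (flow t z))"
    by (auto intro!: integrable_phi_mult bound)
  ultimately show ?thesis
    by (simp add: integral_mu G_def algebra_simps)
qed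

lemma measure_preserving_flow_mu: "measure_preserving mu (flow t)"
  unfolding measure_preserving_def
proof
  show m [measurable]: "flow t \<in> mu \<rightarrow>\<^sub>M mu" by measurable
  show "distr mu mu (flow t) = mu"
  proof (rule measure_eqI)
    fix A assume "A \<in> sets (distr mu mu (flow t))"
    then have A: "A \<in> sets mu" by simp
    have [measurable]: "A \<in> sets torus_lebesgue" using A by simp
    have "measure mu (flow t -` A \<inter> torus) = (\<integral>z. indicator (flow t -` A \<inter> torus) z \<partial>mu)" by simp
    also have "\<dots> = (\<integral>z. indicator A (flow t z) \<partial>mu)"
      by (intro Bochner_Integration.integral_cong) (auto simp: indicator_def)
    also have "\<dots> = (\<integral>z. indicator A z \<partial>mu)"
      by (rule integral_flow_bounded) (auto simp: indicator_def)
    also have "\<dots> = measure mu A" using sets.sets_into_space[OF A] by (simp add: Int_absorb2)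
    finally show "emeasure (distr mu mu (flow t)) A = emeasure mu A"
      using A by (simp add: emeasure_distr mu.emeasure_eq_measure)
  qed simp
qed

lemma measure_preserving_flow_flow: "measure_preserving_flow mu flow"
  unfolding measure_preserving_flow_def
proof (intro conjI allI measure_preserving_flow_mu)
  show "flow_on (space mu) flow" using flow_on_torus by simp
  show "(\<lambda>(t, x). flow t x) \<in> borel \<Otimes>\<^sub>M mu \<rightarrow>\<^sub>M mu" by measurable
qed

section \<open>Rigidity times and orbit averages\<close>

lemma leb_integral_abs_le:
  fixes f :: "_ \<Rightarrow> real"
  assumes f: "integrable torus_lebesgue f" and le: "\<And>z. z \<in> torus \<Longrightarrow> \<bar>f z\<bar> \<le> c"
  shows "\<bar>\<integral>z. f z \<partial>torus_lebesgue\<bar> \<le> c"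
  by (rule order_trans[OF integral_abs_bound leb.integral_le_const])
     (use f in \<open>simp, intro AE_I2 le, simp\<close>)

lemma mu_integral_abs_le:
  fixes f :: "_ \<Rightarrow> real"
  assumes f: "integrable mu f" and le: "\<And>z. z \<in> torus \<Longrightarrow> \<bar>f z\<bar> \<le> c"
  shows "\<bar>\<integral>z. f z \<partial>mu\<bar> \<le> c"
  by (rule order_trans[OF integral_abs_bound mu.integral_le_const])
     (use f in \<open>simp, intro AE_I2 le, simp\<close>)

text \<open>The increment of \<open>hcirc\<close> over \<open>j\<close> quarter turns; times
  \<open>amp n\<close> it is the limiting excess of \<open>Phi\<close> at time
  \<open>j * tau n\<close>.\<close>

definition gap :: "real \<Rightarrow> complex \<Rightarrow> real" where
  "gap j u = hcirc (u * cis (2 * pi * (j / 4))) - hcirc u"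

lemma continuous_gap: "continuous_on A (gap j)"
  unfolding gap_def[abs_def] hcirc_def by (intro continuous_intros)

lemma gap_bound: "cmod u = 1 \<Longrightarrow> \<bar>gap j u\<bar> \<le> 6 * pi * \<bar>j\<bar>"
proof -
  assume "cmod u = 1"
  then have "\<bar>gap j u\<bar> \<le> 6 * pi * \<bar>j / 4 - 0\<bar>"
    using hcirc_cis_lipschitz[of u "j / 4" 0] by (simp add: gap_def)
  also have "\<dots> \<le> 6 * pi * \<bar>j\<bar>" by (intro mult_left_mono) auto
  finally show ?thesis .
qed

text \<open>The series is compared with its \<open>n\<close>-th term alone. That term has phase
  advance close to \<open>j / 4\<close> by \<open>tau_drift\<close>; all others advance by nearly an
  integer by \<open>phase_bound\<close>.\<close>

lemma Phi_tau:
  fixes j :: real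
  assumes j: "j \<in> \<int>" and z: "z \<in> torus"
  shows "\<bar>Phi (j * tau n) z - j * tau n - amp n * gap j (chi n z)\<bar> \<le> 6 * pi * \<bar>j\<bar> * (1/2) ^ n * (2 + amp n)"
proof -
  let ?s = "j * tau n"
  define C where "C = 6 * pi * \<bar>j\<bar> * (1/2) ^ n"
  have C0: "C \<ge> 0" by (simp add: C_def)
  define w where "w m = (if m = n then amp n * gap j (chi n z) else 0)" for m
  have w: "w sums (amp n * gap j (chi n z))"
    unfolding w_def[abs_def] by (rule sums_single[of n "\<lambda>_. amp n * gap j (chi n z)"])
  have B: "(\<lambda>m. C * ((1/2) ^ m + (if m = n then amp n else 0))) sums (C * (2 + amp n))"
    using sums_add[OF geometric_sums[of "1/2::real"] sums_single[of n "\<lambda>_. amp n"]]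
    by (intro sums_mult) simp
  have le: "\<bar>Phi_term m ?s z - w m\<bar> \<le> C * ((1/2) ^ m + (if m = n then amp n else 0))" for m
  proof (cases "m = n")
    case True
    have "Phi_term n ?s z - w n = amp n * (hcirc (chi n z * cis (2 * pi * (drift n * ?s))) - hcirc (chi n z * cis (2 * pi * (j / 4))))"
      by (simp add: Phi_term_def w_def gap_def right_diff_distrib)
    also have "\<bar>\<dots>\<bar> \<le> amp n * (6 * pi * \<bar>drift n * ?s - j / 4\<bar>)"
      unfolding abs_mult abs_of_nonneg[OF amp_nonneg]
      by (intro mult_left_mono hcirc_cis_lipschitz cmod_chi z amp_nonneg)
    also have "drift n * ?s - j / 4 = j * (tau n * drift n - 1/4)" by (simp add: algebra_simps)
    also have "amp n * (6 * pi * \<bar>\<dots>\<bar>) \<le> amp n * (6 * pi * (\<bar>j\<bar> * (1/2) ^ n))"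
      unfolding abs_mult using tau_drift[of n] by (intro mult_left_mono) auto
    also have "\<dots> \<le> C * ((1/2) ^ n + amp n)"
      using C0 by (simp add: C_def algebra_simps)
    finally show ?thesis using True by simp
  next
    case False
    obtain i :: int where i: "j = of_int i" using j unfolding Ints_def by blast
    obtain k :: int where k: "amp m * \<bar>drift m * tau n - k\<bar> \<le> (1/2) ^ m * (1/2) ^ n"
      using phase_bound[OF False] by blast
    \<comment> \<open>Since \<open>j\<close> is an integer, so is \<open>j * k\<close>, and it may
      be removed from the phase.\<close>
    have "cis (2 * pi * (drift m * ?s)) = cis (2 * pi * (j * (drift m * tau n - k)))"
    proof -
      have "2 * pi * (drift m * ?s) = 2 * pi * (j * (drift m * tau n - k)) + 2 * pi * of_int (i * k)"
        by (simp add: i algebra_simps)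
      then show ?thesis by (simp only: cis_mult[symmetric] cis_multiple_2pi Ints_of_int mult_1_right)
    qed
    then have "\<bar>Phi_term m ?s z\<bar> = amp m * \<bar>hcirc (chi m z * cis (2 * pi * (j * (drift m * tau n - k)))) - hcirc (chi m z * cis (2 * pi * 0))\<bar>"
      by (simp add: Phi_term_def abs_mult)
    also have "\<dots> \<le> amp m * (6 * pi * \<bar>j * (drift m * tau n - k) - 0\<bar>)"
      by (intro mult_left_mono hcirc_cis_lipschitz cmod_chi z) auto
    also have "\<dots> = 6 * pi * \<bar>j\<bar> * (amp m * \<bar>drift m * tau n - k\<bar>)" by (simp add: abs_mult)
    also have "\<dots> \<le> 6 * pi * \<bar>j\<bar> * ((1/2) ^ m * (1/2) ^ n)" using k by (intro mult_left_mono) auto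
    finally show ?thesis using False by (simp add: w_def C_def mult_ac)
  qed
  have "Phi ?s z - ?s - amp n * gap j (chi n z) = (\<Sum>m. Phi_term m ?s z - w m)"
    using suminf_diff[OF summable_Phi_term[OF z] sums_summable[OF w]] sums_unique[OF w] by (simp add: Phi_eq)
  also have "\<bar>\<dots>\<bar> \<le> (\<Sum>m. C * ((1/2) ^ m + (if m = n then amp n else 0)))"
    using norm_suminf_le[OF _ sums_summable[OF B], of "\<lambda>m. Phi_term m ?s z - w m"] le by simp
  also have "\<dots> = C * (2 + amp n)" using sums_unique[OF B] by simp
  finally show ?thesis by (simp add: C_def)
qed

text \<open>This splits the flow at a large time into a linear motion, nearly the identity at
  rigidity times, and a flow for the time \<open>t - Phi t z\<close>, which is bounded there when
  the amplitudes are.\<close>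

lemma flow_via_lin:
  assumes "z \<in> torus" shows "flow t z = flow (t - Phi t z) (lin t z)"
  using flow_add[OF assms, of "t - Phi t z" "Phi t z"] assms by (simp add: flow_Phi)

lemma dist_lin: "z \<in> torus \<Longrightarrow> dist (lin s z) z = dist (torus_proj (slope * s, s)) (1, 1)"
  by (simp add: lin_def dist_rot)

lemma dist_lin_tau_tendsto:
  fixes j :: real
  assumes "j \<in> \<int>" shows "(\<lambda>n. dist (torus_proj (slope * (j * tau n), j * tau n)) (1, 1)) \<longlonglongrightarrow> 0"
  using torus_proj_tau_tendsto[OF assms] by (rule iffD1[OF tendsto_dist_iff])

lemma amp_subsequence: obtains s :: "nat \<Rightarrow> nat" where "\<And>k. amp (s k) = real M" "filterlim s at_top sequentially"
proof -
  obtain s where s: "\<And>k. s k \<ge> k \<and> amp (s k) = real M"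
    using amp_frequently[of _ M] by metis
  moreover have "filterlim s at_top sequentially"
    by (rule filterlim_at_top_mono[OF filterlim_ident]) (use s in auto)
  ultimately show ?thesis using that by blast
qed

text \<open>The density is continuous and independent of the circle variable, so it is absorbed into
  the test function.\<close>

lemma equidistribution_chi:
  fixes K :: "(complex \<times> complex) \<times> complex \<Rightarrow> real"
  assumes K: "continuous_on (torus \<times> sphere 0 1) K" and s: "filterlim s at_top sequentially"
  shows "(\<lambda>k. \<integral>z. K (z, chi (s k) z) \<partial>mu) \<longlonglongrightarrow> (\<integral>z. (LINT r:{0..1}|lborel. K (z, cis (2 * pi * r))) \<partial>mu)"
proof -
  define K' where "K' p = phi (fst p) * K p" for p
  have c: "continuous_on (torus \<times> sphere 0 1) K'"
    unfolding K'_def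
    by (rule continuous_on_mult[OF continuous_on_compose2[OF continuous_phi continuous_on_fst[OF continuous_on_id]] K]) auto
  have "filterlim (\<lambda>k. den (s k)) at_top sequentially"
    using filterlim_compose[OF filterlim_den s] .
  then have L: "(\<lambda>k. \<integral>z. K' (z, chi (s k) z) \<partial>torus_lebesgue) \<longlonglongrightarrow> (\<integral>z. (LINT r:{0..1}|lborel. K' (z, cis (2 * pi * r))) \<partial>torus_lebesgue)"
    by (intro equidistribution[OF c]) (auto simp: chi_rot chi_torus_proj cmod_chi intro!: continuous_chi)
  have m1: "(\<lambda>z. K (z, chi n z)) \<in> borel_measurable torus_lebesgue" for n
    by (intro borel_measurable_continuous_torus continuous_on_compose2[OF K] continuous_on_Pair continuous_on_id continuous_chi)
       (auto simp: cmod_chi)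
  have "continuous_on ({0..1} \<times> torus) (\<lambda>p. (snd p, cis (2 * pi * fst p)))" by (intro continuous_intros)
  then have "continuous_on ({0..1} \<times> torus) (\<lambda>(r, z). K (z, cis (2 * pi * r)))"
    unfolding case_prod_unfold by (rule continuous_on_compose2[OF K]) auto
  from continuous_on_unit_integral[OF this]
  have m2: "(\<lambda>z. LINT r:{0..1}|lborel. K (z, cis (2 * pi * r))) \<in> borel_measurable torus_lebesgue" by simp
  show ?thesis
    unfolding integral_mu[OF m1] integral_mu[OF m2] using L by (simp add: K'_def)
qed

section \<open>Trigonometric polynomials and uniform averages along linear orbits\<close>

inductive trig :: "(complex \<times> complex \<Rightarrow> complex) \<Rightarrow> bool" where
  char: "trig (\<lambda>z. c * (fst z powi k * snd z powi l))"
| add: "trig f \<Longrightarrow> trig g \<Longrightarrow> trig (\<lambda>z. f z + g z)"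

text \<open>Exponents add only for nonzero coordinates, so the closure properties of
  \<open>trig\<close> are stated on the torus instead of as equalities of functions.\<close>

lemma trig_mult_char:
  "trig f \<Longrightarrow> \<exists>h. trig h \<and> (\<forall>z\<in>torus. h z = c * (fst z powi k * snd z powi l) * f z)"
proof (induction rule: trig.induct)
  case (char d m n)
  have "c * (fst z powi k * snd z powi l) * (d * (fst z powi m * snd z powi n)) = (c * d) * (fst z powi (k + m) * snd z powi (l + n))"
    if "z \<in> torus" for z
  proof -
    have "fst z \<noteq> 0" "snd z \<noteq> 0" using that by (auto simp: torus_iff)
    then show ?thesis by (simp add: power_int_add)
  qed
  then show ?case by (intro exI[of _ "\<lambda>z. (c * d) * (fst z powi (k + m) * snd z powi (l + n))"] conjI trig.char ballI) (rule sym)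
next
  case (add f g)
  then obtain h h' where "trig h" "trig h'" "\<forall>z\<in>torus. h z = c * (fst z powi k * snd z powi l) * f z" "\<forall>z\<in>torus. h' z = c * (fst z powi k * snd z powi l) * g z"
    by blast
  then show ?case by (intro exI[of _ "\<lambda>z. h z + h' z"]) (auto intro: trig.add simp: distrib_left)
qed

lemma trig_mult: "trig f \<Longrightarrow> trig g \<Longrightarrow> \<exists>h. trig h \<and> (\<forall>z\<in>torus. h z = f z * g z)"
proof (induction rule: trig.induct)
  case (char c k l)
  then show ?case by (rule trig_mult_char)
next
  case (add f f')
  then obtain h h' where "trig h" "trig h'" "\<forall>z\<in>torus. h z = f z * g z" "\<forall>z\<in>torus. h' z = f' z * g z"
    by blast
  then show ?case by (intro exI[of _ "\<lambda>z. h z + h' z"]) (auto intro: trig.add simp: distrib_right)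
qed

lemma trig_cnj: "trig f \<Longrightarrow> \<exists>h. trig h \<and> (\<forall>z\<in>torus. h z = cnj (f z))"
proof (induction rule: trig.induct)
  case (char c k l)
  have "cnj x = inverse x" if "cmod x = 1" for x
  proof -
    have "x * cnj x = 1" using that by (simp add: complex_norm_square[symmetric])
    then show ?thesis using inverse_unique by metis
  qed
  then have "cnj (c * (fst z powi k * snd z powi l)) = cnj c * (fst z powi (-k) * snd z powi (-l))" if "z \<in> torus" for z
    using that by (simp add: torus_iff power_int_minus power_int_inverse)
  then show ?case by (intro exI[of _ "\<lambda>z. cnj c * (fst z powi (-k) * snd z powi (-l))"] conjI trig.char ballI) (rule sym)
next
  case (add f g)
  then obtain h h' where "trig h" "trig h'" "\<forall>z\<in>torus. h z = cnj (f z)" "\<forall>z\<in>torus. h' z = cnj (g z)"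
    by blast
  then show ?case by (intro exI[of _ "\<lambda>z. h z + h' z"]) (auto intro: trig.add)
qed

lemma continuous_trig: "trig f \<Longrightarrow> continuous_on torus f"
  by (induction rule: trig.induct)
     (auto simp: torus_iff intro!: continuous_intros)

text \<open>
  Since \<open>slope\<close> is irrational, the nontrivial characters have bounded integrals along the orbits
  of the linear flow, uniformly in the starting point.
\<close>

definition uniquely_integrated :: "(complex \<times> complex \<Rightarrow> real) \<Rightarrow> bool" where
  "uniquely_integrated f \<longleftrightarrow> (\<exists>C. \<forall>z\<in>torus. \<exists>Q. Q 0 = 0 \<and>
     (\<forall>s. (Q has_real_derivative f (lin s z)) (at s)) \<and>
     (\<forall>s. \<bar>Q s - (\<integral>z. f z \<partial>torus_lebesgue) * s\<bar> \<le> C))"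

lemma uniquely_integrated_trig: "trig f \<Longrightarrow> uniquely_integrated (\<lambda>z. Re (f z))"
proof (induction rule: trig.induct)
  case (char c k l)
  let ?x = "\<lambda>z. c * (fst z powi k * snd z powi l)"
  have xc: "continuous_on torus ?x" using continuous_trig[OF trig.char] .
  have powi_cis: "cis a powi n = cis (n * a)" for a :: real and n :: int
    by (simp add: cis_power_int)
  show ?case
  proof (cases "k = 0 \<and> l = 0")
    case True
    have "(\<integral>z. Re (?x z) \<partial>torus_lebesgue) = Re c" using True leb.prob_space by simp
    then show ?thesis unfolding uniquely_integrated_def using True
      by (intro exI[of _ 0] ballI exI[of _ "\<lambda>s. Re c * s"]) (auto intro!: derivative_eq_intros)
  next
    case False
    \<comment> \<open>A rotation turning the nontrivial character by half a turn; invariance of the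
      measure forces the mean to vanish.\<close>
    obtain p where p: "?x (rot (torus_proj p) z) = - ?x z" for z
    proof (cases "k = 0")
      case False
      then have "of_int k * (2 * pi * (1 / (2 * of_int k))) = pi" by simp
      then have "cis (2 * pi * (1 / (2 * of_int k))) powi k = -1" unfolding powi_cis by (simp only: cis_pi)
      then show ?thesis using that[of "(1 / (2 * of_int k), 0)"]
        by (simp add: rot_def torus_proj_def power_int_mult_distrib)
    next
      case True
      then have "of_int l * (2 * pi * (1 / (2 * of_int l))) = pi" using \<open>\<not> (k = 0 \<and> l = 0)\<close> by simp
      then have "cis (2 * pi * (1 / (2 * of_int l))) powi l = -1" unfolding powi_cis by (simp only: cis_pi)
      then show ?thesis using that[of "(0, 1 / (2 * of_int l))"]
        by (simp add: rot_def torus_proj_def power_int_mult_distrib)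
    qed
    have "(\<integral>z. Re (?x (rot (torus_proj p) z)) \<partial>torus_lebesgue) = (\<integral>z. Re (?x z) \<partial>torus_lebesgue)"
      by (rule integral_rot[of _ "\<lambda>z. Re (?x z)"])
         (intro torus_proj_in_torus borel_measurable_continuous_torus continuous_on_Re xc)+
    then have int0: "(\<integral>z. Re (?x z) \<partial>torus_lebesgue) = 0"
      unfolding p uminus_complex.sel integral_minus by linarith
    \<comment> \<open>The frequency along linear orbits, nonzero by irrationality; dividing by it
      gives an explicit bounded primitive.\<close>
    define om where "om = 2 * pi * (k * slope + l)"
    have om: "om \<noteq> 0" using slope_irrational[of k l] False by (auto simp: om_def)
    have "\<exists>Q. Q 0 = 0 \<and> (\<forall>s. (Q has_real_derivative Re (?x (lin s z))) (at s)) \<and> (\<forall>s. \<bar>Q s - 0 * s\<bar> \<le> 2 * cmod c / \<bar>om\<bar>)"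
      if z: "z \<in> torus" for z
    proof -
      define th where "th = Arg (?x z)"
      have "cmod (?x z) = cmod c" using z by (simp add: norm_mult norm_power_int torus_iff)
      then have th: "?x z = of_real (cmod c) * cis th"
        using rcis_cmod_Arg[of "?x z"] by (simp add: th_def rcis_def)
      have "?x (lin s z) = ?x z * cis (om * s)" for s
        by (simp add: lin_def rot_def torus_proj_def power_int_mult_distrib powi_cis cis_mult om_def algebra_simps)
      then have re: "Re (?x (lin s z)) = cmod c * cos (th + om * s)" for s
        by (simp add: th cis_mult mult.assoc)
      define Q where "Q s = cmod c * (sin (th + om * s) - sin th) / om" for s
      have "(Q has_real_derivative Re (?x (lin s z))) (at s)" for s
        unfolding Q_def re using om by (auto intro!: derivative_eq_intros)
      moreover have "\<bar>Q s\<bar> \<le> 2 * cmod c / \<bar>om\<bar>" for s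
      proof -
        have "\<bar>sin (th + om * s) - sin th\<bar> \<le> 2"
          using abs_sin_le_one[of "th + om * s"] abs_sin_le_one[of th] by linarith
        then have "cmod c * \<bar>sin (th + om * s) - sin th\<bar> \<le> cmod c * 2" by (intro mult_left_mono) auto
        then show ?thesis by (simp add: Q_def abs_mult divide_right_mono mult.commute)
      qed
      ultimately show ?thesis by (intro exI[of _ Q]) (auto simp: Q_def)
    qed
    then show ?thesis unfolding uniquely_integrated_def int0 by blast
  qed
next
  case (add f g)
  have "integrable torus_lebesgue (\<lambda>z. Re (f z))" "integrable torus_lebesgue (\<lambda>z. Re (g z))"
    using add by (auto intro!: integrable_continuous_torus continuous_on_Re continuous_trig)
  then have I: "(\<integral>z. Re (f z + g z) \<partial>torus_lebesgue) = (\<integral>z. Re (f z) \<partial>torus_lebesgue) + (\<integral>z. Re (g z) \<partial>torus_lebesgue)" by simp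
  obtain C C' where C: "\<And>z. z \<in> torus \<Longrightarrow> \<exists>Q. Q 0 = 0 \<and> (\<forall>s. (Q has_real_derivative Re (f (lin s z))) (at s)) \<and> (\<forall>s. \<bar>Q s - (\<integral>z. Re (f z) \<partial>torus_lebesgue) * s\<bar> \<le> C)"
     and C': "\<And>z. z \<in> torus \<Longrightarrow> \<exists>Q. Q 0 = 0 \<and> (\<forall>s. (Q has_real_derivative Re (g (lin s z))) (at s)) \<and> (\<forall>s. \<bar>Q s - (\<integral>z. Re (g z) \<partial>torus_lebesgue) * s\<bar> \<le> C')"
    using add unfolding uniquely_integrated_def by metis
  show ?case unfolding uniquely_integrated_def I
  proof (intro exI[of _ "C + C'"] ballI)
    fix z assume z: "z \<in> torus"
    obtain Q Q' where Q: "Q 0 = 0" "\<And>s. (Q has_real_derivative Re (f (lin s z))) (at s)" "\<And>s. \<bar>Q s - (\<integral>z. Re (f z) \<partial>torus_lebesgue) * s\<bar> \<le> C"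
      and Q': "Q' 0 = 0" "\<And>s. (Q' has_real_derivative Re (g (lin s z))) (at s)" "\<And>s. \<bar>Q' s - (\<integral>z. Re (g z) \<partial>torus_lebesgue) * s\<bar> \<le> C'"
      using C[OF z] C'[OF z] by metis
    show "\<exists>Q. Q 0 = 0 \<and> (\<forall>s. (Q has_real_derivative Re (f (lin s z) + g (lin s z))) (at s)) \<and>
         (\<forall>s. \<bar>Q s - ((\<integral>z. Re (f z) \<partial>torus_lebesgue) + (\<integral>z. Re (g z) \<partial>torus_lebesgue)) * s\<bar> \<le> C + C')"
    proof (intro exI[of _ "\<lambda>s. Q s + Q' s"] conjI allI)
      fix s
      show "((\<lambda>s. Q s + Q' s) has_real_derivative Re (f (lin s z) + g (lin s z))) (at s)"
        using DERIV_add[OF Q(2) Q'(2)] by simp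
      show "\<bar>Q s + Q' s - ((\<integral>z. Re (f z) \<partial>torus_lebesgue) + (\<integral>z. Re (g z) \<partial>torus_lebesgue)) * s\<bar> \<le> C + C'"
        using Q(3)[of s] Q'(3)[of s] by (simp add: distrib_right)
    qed (use Q Q' in auto)
  qed
qed

text \<open>Stone-Weierstrass for real parts of \<open>trig\<close> functions. They are closed under
  products because \<open>Re f * Re g\<close> is the real part of
  \<open>(g + cnj g) * f / 2\<close>; real and imaginary parts of the coordinates separate
  points.\<close>

lemma trig_approximation:
  fixes b :: "complex \<times> complex \<Rightarrow> real"
  assumes b: "continuous_on torus b" and e: "e > 0"
  obtains g where "trig g" "\<And>z. z \<in> torus \<Longrightarrow> \<bar>b z - Re (g z)\<bar> < e"
proof -
  define P where "P f \<longleftrightarrow> (\<exists>g. trig g \<and> (\<forall>z\<in>torus. f z = Re (g z)))" for f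
  have re: "P (\<lambda>z. Re (c * (fst z powi k * snd z powi l)))" for c k l
    unfolding P_def using trig.char by blast
  have "\<exists>p. P p \<and> (\<forall>z\<in>torus. \<bar>b z - p z\<bar> < e)"
  proof (rule Stone_Weierstrass_HOL[OF compact_torus])
    show "P (\<lambda>z. c)" for c using re[of "of_real c" 0 0] by simp
    show "continuous_on torus f" if "P f" for f
    proof -
      from that obtain g where "trig g" "\<forall>z\<in>torus. f z = Re (g z)" unfolding P_def by blast
      then show ?thesis by (subst continuous_on_cong[OF refl, of _ _ "\<lambda>z. Re (g z)"]) (auto intro!: continuous_on_Re continuous_trig)
    qed
    show "P (\<lambda>z. f z + g z)" if fg: "P f \<and> P g" for f g
    proof -
      obtain f' g' where "trig f'" "\<forall>z\<in>torus. f z = Re (f' z)" "trig g'" "\<forall>z\<in>torus. g z = Re (g' z)"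
        using fg unfolding P_def by blast
      then show ?thesis unfolding P_def by (intro exI[of _ "\<lambda>z. f' z + g' z"]) (auto intro: trig.add)
    qed
    show "P (\<lambda>z. f z * g z)" if fg: "P f \<and> P g" for f g
    proof -
      obtain f' g' where f': "trig f'" "\<forall>z\<in>torus. f z = Re (f' z)" and g': "trig g'" "\<forall>z\<in>torus. g z = Re (g' z)"
        using fg unfolding P_def by blast
      obtain h where h: "trig h" "\<forall>z\<in>torus. h z = cnj (g' z)" using trig_cnj[OF g'(1)] by blast
      obtain v where v: "trig v" "\<forall>z\<in>torus. v z = (g' z + h z) * f' z"
        using trig_mult[OF trig.add[OF g'(1) h(1)] f'(1)] by blast
      obtain w where w: "trig w" "\<forall>z\<in>torus. w z = (1/2) * (fst z powi 0 * snd z powi 0) * v z"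
        using trig_mult_char[OF v(1)] by blast
      have "f z * g z = Re (w z)" if "z \<in> torus" for z
        using that f'(2) g'(2) h(2) v(2) w(2) by (simp add: complex_add_cnj)
      then show ?thesis unfolding P_def using w(1) by blast
    qed
    show "\<exists>f. P f \<and> f x \<noteq> f y" if xy: "x \<in> torus \<and> y \<in> torus \<and> x \<noteq> y" for x y
    proof (rule ccontr)
      assume "\<not> ?thesis"
      then have eq: "Re (c * (fst x powi k * snd x powi l)) = Re (c * (fst y powi k * snd y powi l))" for c k l
        using re by blast
      have "x = y" using eq[of 1 1 0] eq[of \<i> 1 0] eq[of 1 0 1] eq[of \<i> 0 1]
        by (auto simp: prod_eq_iff complex_eq_iff)
      then show False using xy by simp
    qed
  qed (use b e in auto)
  then show ?thesis using that unfolding P_def by (metis (mono_tags, lifting))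
qed

text \<open>Uniform approximation by a trigonometric polynomial costs
  \<open>e * \<bar>s\<bar>\<close>, and the polynomial contributes a bounded error. That
  \<open>C\<close> does not depend on \<open>z\<close> is unique ergodicity in quantitative
  form.\<close>

lemma linear_orbit_average:
  fixes b :: "complex \<times> complex \<Rightarrow> real"
  assumes b: "continuous_on torus b" and e: "e > 0"
  obtains C where "\<And>z B s. z \<in> torus \<Longrightarrow> B 0 = 0 \<Longrightarrow> (\<And>s. (B has_real_derivative b (lin s z)) (at s)) \<Longrightarrow>
     \<bar>B s - (\<integral>z. b z \<partial>torus_lebesgue) * s\<bar> \<le> e * \<bar>s\<bar> + C"
proof -
  obtain g where g: "trig g" "\<And>z. z \<in> torus \<Longrightarrow> \<bar>b z - Re (g z)\<bar> < e/2"
    using trig_approximation[OF b, of "e/2"] e by auto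
  let ?p = "\<lambda>z. Re (g z)"
  obtain C where C: "\<And>z. z \<in> torus \<Longrightarrow> \<exists>Q. Q 0 = 0 \<and> (\<forall>s. (Q has_real_derivative ?p (lin s z)) (at s)) \<and> (\<forall>s. \<bar>Q s - (\<integral>z. ?p z \<partial>torus_lebesgue) * s\<bar> \<le> C)"
    using uniquely_integrated_trig[OF g(1)] unfolding uniquely_integrated_def by blast
  have bi: "integrable torus_lebesgue b" by (rule integrable_continuous_torus[OF b])
  have pi: "integrable torus_lebesgue ?p" by (intro integrable_continuous_torus continuous_on_Re continuous_trig g)
  have "\<bar>\<integral>z. b z - ?p z \<partial>torus_lebesgue\<bar> \<le> e/2"
    by (rule leb_integral_abs_le[OF Bochner_Integration.integrable_diff[OF bi pi] less_imp_le[OF g(2)]])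
  then have I: "\<bar>(\<integral>z. b z \<partial>torus_lebesgue) - (\<integral>z. ?p z \<partial>torus_lebesgue)\<bar> \<le> e/2"
    using bi pi by simp
  show ?thesis
  proof (rule that[of C])
    fix z B s assume z: "z \<in> torus" and B: "B 0 = 0" "\<And>s. (B has_real_derivative b (lin s z)) (at s)"
    obtain Q where Q: "Q 0 = 0" "\<And>s. (Q has_real_derivative ?p (lin s z)) (at s)" "\<And>s. \<bar>Q s - (\<integral>z. ?p z \<partial>torus_lebesgue) * s\<bar> \<le> C"
      using C[OF z] by blast
    have "\<bar>(B s - Q s) - (B 0 - Q 0)\<bar> \<le> e/2 * \<bar>s - 0\<bar>"
    proof (rule field_differentiable_bound[where S = UNIV and f = "\<lambda>s. B s - Q s", simplified real_norm_def])
      show "((\<lambda>s. B s - Q s) has_field_derivative b (lin s z) - ?p (lin s z)) (at s within UNIV)" for s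
        using DERIV_diff[OF B(2) Q(2)] by simp
      show "\<bar>b (lin s z) - ?p (lin s z)\<bar> \<le> e/2" for s using g(2)[of "lin s z"] z by simp
    qed auto
    then have 1: "\<bar>B s - Q s\<bar> \<le> e/2 * \<bar>s\<bar>" using B Q by simp
    have 2: "\<bar>((\<integral>z. ?p z \<partial>torus_lebesgue) - (\<integral>z. b z \<partial>torus_lebesgue)) * s\<bar> \<le> e/2 * \<bar>s\<bar>"
      unfolding abs_mult using I by (intro mult_right_mono) (auto simp: abs_minus_commute)
    have "B s - (\<integral>z. b z \<partial>torus_lebesgue) * s = (B s - Q s) + (Q s - (\<integral>z. ?p z \<partial>torus_lebesgue) * s) + ((\<integral>z. ?p z \<partial>torus_lebesgue) - (\<integral>z. b z \<partial>torus_lebesgue)) * s"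
      by (simp add: algebra_simps)
    then show "\<bar>B s - (\<integral>z. b z \<partial>torus_lebesgue) * s\<bar> \<le> e * \<bar>s\<bar> + C"
      using 1 2 Q(3)[of s] by linarith
  qed
qed

section \<open>Averages along orbits of the time-changed flow\<close>

lemma integrable_mu_continuous:
  fixes f :: "_ \<Rightarrow> real"
  assumes "continuous_on torus f" shows "integrable mu f"
proof -
  obtain B where "B > 0" "\<And>z. z \<in> torus \<Longrightarrow> norm (f z) \<le> B" using continuous_torus_bounded[OF assms] by blast
  then show ?thesis
    using borel_measurable_continuous_torus[OF assms]
    by (intro mu.integrable_const_bound[where B = B] AE_I2) (simp_all cong: measurable_cong_sets)
qed

text \<open>Substituting \<open>u = Phi s z\<close> turns \<open>E\<close> into a primitive along
  the linear orbit of \<open>phi z * (a z - m)\<close>, with \<open>m\<close> the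
  \<open>mu\<close>-mean of \<open>a\<close>; this has Haar mean zero. The factor 2 in the bound for
  \<open>clock\<close> explains the use of \<open>e/2\<close>.\<close>

lemma flow_orbit_average:
  fixes a :: "complex \<times> complex \<Rightarrow> real"
  assumes a: "continuous_on torus a" and e: "e > 0"
  obtains C where "\<And>z E u. z \<in> torus \<Longrightarrow> E 0 = 0 \<Longrightarrow>
     (\<And>u. (E has_real_derivative a (flow u z) - (\<integral>z. a z \<partial>mu)) (at u)) \<Longrightarrow> \<bar>E u\<bar> \<le> e * \<bar>u\<bar> + C"
proof -
  let ?m = "\<integral>z. a z \<partial>mu"
  define b where "b z = phi z * (a z - ?m)" for z
  have bc: "continuous_on torus b"
    unfolding b_def by (intro continuous_on_mult continuous_on_diff continuous_on_const continuous_phi a)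
  have "(\<integral>z. b z \<partial>torus_lebesgue) = (\<integral>z. a z - ?m \<partial>mu)"
    unfolding b_def
    by (rule integral_mu[symmetric])
       (intro borel_measurable_continuous_torus continuous_on_diff continuous_on_const a)
  also have "\<dots> = 0"
    using integrable_mu_continuous[OF a] mu.prob_space by (subst Bochner_Integration.integral_diff) auto
  finally have b0: "(\<integral>z. b z \<partial>torus_lebesgue) = 0" .
  obtain C where C: "\<And>z B s. z \<in> torus \<Longrightarrow> B 0 = 0 \<Longrightarrow> (\<And>s. (B has_real_derivative b (lin s z)) (at s)) \<Longrightarrow>
     \<bar>B s - (\<integral>z. b z \<partial>torus_lebesgue) * s\<bar> \<le> e/2 * \<bar>s\<bar> + C"
    using linear_orbit_average[OF bc, of "e/2"] e by auto
  show ?thesis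
  proof (rule that[of C])
    fix z E u assume z: "z \<in> torus" and E: "E 0 = 0" "\<And>u. (E has_real_derivative a (flow u z) - ?m) (at u)"
    have "((\<lambda>s. E (Phi s z)) has_real_derivative b (lin s z)) (at s)" for s
    proof -
      have "((\<lambda>s. E (Phi s z)) has_real_derivative (a (flow (Phi s z) z) - ?m) * phi (lin s z)) (at s)"
        by (rule DERIV_chain2[OF E(2) Phi_has_derivative[OF z]])
      then show ?thesis using z by (simp add: b_def flow_Phi mult.commute)
    qed
    from C[OF z _ this, of "clock u z"] have "\<bar>E u\<bar> \<le> e/2 * \<bar>clock u z\<bar> + C"
      using z E(1) by (simp add: b0)
    also have "\<bar>clock u z\<bar> \<le> 2 * \<bar>u\<bar>" using clock_lipschitz[OF z, of u 0] z by simp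
    finally show "\<bar>E u\<bar> \<le> e * \<bar>u\<bar> + C" using e by (simp add: mult_left_mono)
  qed
qed

text \<open>The weight is at most 1 and tends to 0 with \<open>eta\<close> away from the zeros of
  the sine, so dominated convergence applies.\<close>

lemma sine_weight_small:
  assumes e: "e > 0"
  obtains eta :: real where "eta > 0" "(LINT r:{0..1}|lborel. eta / ((sin (2 * pi * r))\<^sup>2 + eta)) \<le> e"
proof -
  let ?w = "\<lambda>n r. (1 / real (Suc n)) / ((sin (2 * pi * r))\<^sup>2 + 1 / real (Suc n))"
  have pos: "(sin (2 * pi * r))\<^sup>2 + 1 / real (Suc n) > 0" for n r
    by (intro add_nonneg_pos) auto
  have "(\<lambda>n. \<integral>r. indicator {0..1} r * ?w n r \<partial>lborel) \<longlonglongrightarrow> (\<integral>r. 0 \<partial>(lborel :: real measure))"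
  proof (rule integral_dominated_convergence[where w = "indicator {0..1}"])
    show "integrable lborel (indicator {0..1} :: real \<Rightarrow> real)"
      by (rule integrable_real_indicator) (auto simp: emeasure_lborel_Icc_eq)
    have "?w n r \<le> 1 \<and> 0 \<le> ?w n r" for n r
      using pos[of r n] by (simp add: divide_simps)
    then show "AE r in lborel. norm (indicator {0..1} r * ?w n r) \<le> indicator {0..1} r" for n
      by (intro AE_I2) (auto simp: indicator_def)
    have ae: "AE r in lborel. r \<notin> {0, 1/2, 1::real}"
      by (intro AE_not_in finite_imp_null_set_lborel) auto
    show "AE r in lborel. (\<lambda>n. indicator {0..1} r * ?w n r) \<longlonglongrightarrow> 0"
      using ae
    proof eventually_elim
      case (elim r)
      show ?case
      proof (cases "r \<in> {0..1}")
        case True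
        have "sin (2 * pi * r) \<noteq> 0"
        proof
          assume "sin (2 * pi * r) = 0"
          then obtain i :: int where "2 * pi * r = of_int i * pi" unfolding sin_zero_iff_int2 by blast
          then have "2 * r = of_int i" by simp
          then have "0 \<le> i" "i \<le> 2" using True by auto
          then have "i = 0 \<or> i = 1 \<or> i = 2" by auto
          then show False using \<open>2 * r = of_int i\<close> elim by auto
        qed
        then have s: "(sin (2 * pi * r))\<^sup>2 + 0 \<noteq> 0" by simp
        have "(\<lambda>n. 1 / real (Suc n)) \<longlonglongrightarrow> 0" using LIMSEQ_inverse_real_of_nat by (simp add: inverse_eq_divide)
        then have "(\<lambda>n. ?w n r) \<longlonglongrightarrow> 0 / ((sin (2 * pi * r))\<^sup>2 + 0)"
          using s by (intro tendsto_divide tendsto_add tendsto_const)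
        then show ?thesis using True by simp
      next
        case False
        then have "indicator {0..1} r = (0::real)" by (rule indicator_simps(2))
        then show ?thesis by (simp only: mult_zero_left tendsto_const)
      qed
    qed
  qed auto
  then have "(\<lambda>n. LINT r:{0..1}|lborel. ?w n r) \<longlonglongrightarrow> 0"
    by (simp add: set_lebesgue_integral_def)
  then have "\<forall>\<^sub>F n in sequentially. (LINT r:{0..1}|lborel. ?w n r) < e"
    using e by (rule order_tendstoD(2))
  then obtain n where "(LINT r:{0..1}|lborel. ?w n r) < e" by (auto simp: eventually_sequentially)
  then show ?thesis using that[of "1 / real (Suc n)"] by simp
qed

text \<open>
  The weight \<open>sin\<^sup>2 / (sin\<^sup>2 + eta)\<close> removes the critical points of \<open>r \<mapsto> cos (2 \<pi> r)\<close>, so that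
  integration by parts against a primitive \<open>E\<close> of sublinear growth applies.
\<close>

lemma cosine_window_average:
  fixes f E :: "real \<Rightarrow> real"
  assumes E0: "\<And>u. (E has_real_derivative f u) (at u)" and fc: "continuous_on UNIV f"
    and Eb: "\<And>u. \<bar>E u\<bar> \<le> e * \<bar>u\<bar> + C" and M: "M > 0" and e: "e \<ge> 0"
    and fb: "\<And>u. \<bar>f u\<bar> \<le> F" and eta: "eta > 0"
    and kb: "\<And>r. r \<in> {0..1} \<Longrightarrow> \<bar>kd r\<bar> \<le> L"
    and kd: "\<And>r. kd r = (2 * pi * cos (2 * pi * r) * (eta - (sin (2 * pi * r))\<^sup>2)) / ((sin (2 * pi * r))\<^sup>2 + eta)\<^sup>2"
  shows "\<bar>LINT r:{0..1}|lborel. f (2 * M * cos (2 * pi * r))\<bar> \<le>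
     F * (LINT r:{0..1}|lborel. eta / ((sin (2 * pi * r))\<^sup>2 + eta)) + (2 * e + C / M) * L"
proof -
  let ?S = "\<lambda>r. (sin (2 * pi * r))\<^sup>2 + eta"
  have pos: "?S r > 0" for r using eta by (intro add_nonneg_pos) auto
  then have ne: "?S r \<noteq> 0" for r by (metis less_irrefl)
  define k where "k r = sin (2 * pi * r) / ?S r" for r
  define u where "u r = 2 * M * cos (2 * pi * r)" for r
  have kder: "(k has_real_derivative kd r) (at r)" for r
    unfolding k_def kd using ne[of r]
    by (auto intro!: derivative_eq_intros simp: power2_eq_square algebra_simps)
  have uder: "(u has_real_derivative - (4 * pi * M * sin (2 * pi * r))) (at r)" for r
    unfolding u_def by (auto intro!: derivative_eq_intros)
  \<comment> \<open>The product to be integrated by parts; \<open>k\<close> contains the factor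
    \<open>sin (2 * pi * r)\<close>, so the boundary terms at 0 and 1 vanish.\<close>
  define Y where "Y r = E (u r) * k r" for r
  define y where "y r = - (4 * pi * M) * (f (u r) * (1 - eta / ?S r)) + E (u r) * kd r" for r
  have Yder: "(Y has_real_derivative y r) (at r)" for r
  proof -
    have "(Y has_real_derivative (f (u r) * - (4 * pi * M * sin (2 * pi * r))) * k r + kd r * E (u r)) (at r)"
      unfolding Y_def by (rule DERIV_mult[OF DERIV_chain2[OF E0 uder] kder])
    moreover have "1 - eta / ?S r = sin (2 * pi * r) * k r" using ne[of r]
      by (simp add: k_def field_simps power2_eq_square)
    ultimately show ?thesis by (simp add: y_def mult_ac)
  qed
  have uc: "continuous_on A u" for A unfolding u_def by (intro continuous_intros)
  have fuc: "continuous_on A (\<lambda>r. f (u r))" for A by (rule continuous_on_compose2[OF fc uc]) auto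
  have Ec: "continuous_on UNIV E" using E0 by (intro DERIV_continuous_on) (auto intro: has_field_derivative_at_within)
  have Euc: "continuous_on A (\<lambda>r. E (u r))" for A by (rule continuous_on_compose2[OF Ec uc]) auto
  have wc: "continuous_on A (\<lambda>r. eta / ?S r)" for A using ne by (intro continuous_intros) auto
  have kdc: "continuous_on A kd" for A unfolding kd using ne by (intro continuous_intros) auto
  have yc: "continuous_on A y" for A
    unfolding y_def by (intro continuous_on_add continuous_on_mult continuous_on_const continuous_on_diff fuc Euc wc kdc)
  have "(LBINT r. y r * indicator {0..1} r) = Y 1 - Y 0"
    using Yder yc[of UNIV] by (intro integral_FTC_Icc_real) (auto simp: continuous_on_eq_continuous_at)
  then have y0: "(LINT r:{0..1}|lborel. y r) = 0"
    by (simp add: set_lebesgue_integral_def mult.commute Y_def k_def)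
  have i: "set_integrable lborel {0..1} g" if "continuous_on {0..1} g" for g :: "real \<Rightarrow> real"
    using that by (rule borel_integrable_atLeastAtMost')
  have i1: "set_integrable lborel {0..1} (\<lambda>r. f (u r) * (eta / ?S r))"
    by (intro i continuous_on_mult fuc wc)
  have i2: "set_integrable lborel {0..1} (\<lambda>r. E (u r) * kd r)"
    by (intro i continuous_on_mult Euc kdc)
  \<comment> \<open>Solving the definition of \<open>y\<close> for \<open>f (u r)\<close>: the total
    derivative integrates to 0, leaving the small weight and the term with \<open>E\<close>.\<close>
  have "(LINT r:{0..1}|lborel. f (u r)) = (LINT r:{0..1}|lborel. f (u r) * (eta / ?S r) + (1 / (4 * pi * M)) * (E (u r) * kd r) - (1 / (4 * pi * M)) * y r)"
    unfolding y_def using M by (intro set_lebesgue_integral_cong) (auto simp: field_simps)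
  also have "\<dots> = (LINT r:{0..1}|lborel. f (u r) * (eta / ?S r)) + (1 / (4 * pi * M)) * (LINT r:{0..1}|lborel. E (u r) * kd r)"
    using i1 i2 i[OF yc] by (simp add: set_integral_diff(2) set_integral_add(2) y0)
  finally have eq: "(LINT r:{0..1}|lborel. f (u r)) = \<dots>" .
  have "\<bar>LINT r:{0..1}|lborel. f (u r) * (eta / ?S r)\<bar> \<le> (LINT r:{0..1}|lborel. \<bar>f (u r) * (eta / ?S r)\<bar>)"
    using set_integral_norm_bound[OF i1] by simp
  also have "\<dots> \<le> (LINT r:{0..1}|lborel. F * (eta / ?S r))"
  proof (rule set_integral_mono[OF set_integrable_abs[OF i1]])
    show "set_integrable lborel {0..1} (\<lambda>r. F * (eta / ?S r))"
      by (intro i continuous_on_mult continuous_on_const wc)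
    show "\<bar>f (u r) * (eta / ?S r)\<bar> \<le> F * (eta / ?S r)" for r
      unfolding abs_mult using fb[of "u r"] pos[of r] eta by (intro mult_mono) auto
  qed
  also have "\<dots> = F * (LINT r:{0..1}|lborel. eta / ?S r)" by (rule set_integral_mult_right)
  finally have 1: "\<bar>LINT r:{0..1}|lborel. f (u r) * (eta / ?S r)\<bar> \<le> F * (LINT r:{0..1}|lborel. eta / ?S r)" .
  have C0: "C \<ge> 0" using Eb[of 0] by simp
  have L0: "L \<ge> 0" using kb[of 0] by simp
  have "\<bar>LINT r:{0..1}|lborel. E (u r) * kd r\<bar> \<le> (e * (2 * M) + C) * L"
  proof (rule set_integral_unit_bound)
    show "continuous_on {0..1} (\<lambda>r. E (u r) * kd r)" by (intro continuous_on_mult Euc kdc)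
    fix r :: real assume r: "r \<in> {0..1}"
    have "\<bar>u r\<bar> \<le> 2 * M * 1" unfolding u_def abs_mult using M by (intro mult_mono) auto
    then have "\<bar>E (u r)\<bar> \<le> e * (2 * M) + C" using Eb[of "u r"] e
      by (smt (verit) mult_left_mono)
    then show "\<bar>E (u r) * kd r\<bar> \<le> (e * (2 * M) + C) * L"
      unfolding abs_mult using kb[OF r] e M C0 by (intro mult_mono) auto
  qed
  then have "\<bar>(1 / (4 * pi * M)) * (LINT r:{0..1}|lborel. E (u r) * kd r)\<bar> \<le> (1 / M) * ((e * (2 * M) + C) * L)"
    unfolding abs_mult using M pi_gt3 e C0 L0 by (intro mult_mono) (auto simp: divide_simps)
  also have "\<dots> = (2 * e + C / M) * L" using M by (simp add: field_simps)
  finally show ?thesis using 1 eq unfolding u_def by linarith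
qed

text \<open>For large \<open>M\<close> the times \<open>2 * M * cos (2 * pi * r)\<close> sweep a
  long orbit segment without lingering. A single \<open>M\<close> serves all starting points because
  the orbit averages are uniform.\<close>

lemma window_average:
  fixes a :: "complex \<times> complex \<Rightarrow> real"
  assumes a: "continuous_on torus a" and e: "e > 0"
  obtains M :: nat where "\<And>z. z \<in> torus \<Longrightarrow>
     \<bar>(LINT r:{0..1}|lborel. a (flow (2 * real M * cos (2 * pi * r)) z)) - (\<integral>z. a z \<partial>mu)\<bar> \<le> e"
proof -
  let ?m = "\<integral>z. a z \<partial>mu"
  obtain B where B: "B > 0" "\<And>z. z \<in> torus \<Longrightarrow> \<bar>a z\<bar> \<le> B"
    using continuous_torus_bounded[OF a] by (metis real_norm_def)
  have m: "\<bar>?m\<bar> \<le> B" by (rule mu_integral_abs_le[OF integrable_mu_continuous[OF a] B(2)])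
  obtain eta :: real where eta: "eta > 0" "(LINT r:{0..1}|lborel. eta / ((sin (2 * pi * r))\<^sup>2 + eta)) \<le> e / (4 * B)"
    using sine_weight_small[of "e / (4 * B)"] e B by auto
  define kd where "kd r = (2 * pi * cos (2 * pi * r) * (eta - (sin (2 * pi * r))\<^sup>2)) / ((sin (2 * pi * r))\<^sup>2 + eta)\<^sup>2" for r :: real
  have "(sin (2 * pi * r))\<^sup>2 + eta \<noteq> 0" for r
    using eta(1) by (smt (verit) zero_le_power2)
  then have "continuous_on {0..1} kd" unfolding kd_def by (intro continuous_intros) auto
  then have "bounded (kd ` {0..1})" by (intro compact_imp_bounded compact_continuous_image) auto
  then obtain L where L: "L > 0" "\<And>r. r \<in> {0..1} \<Longrightarrow> \<bar>kd r\<bar> \<le> L"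
    unfolding bounded_pos by auto
  obtain C where C: "\<And>z E u. z \<in> torus \<Longrightarrow> E 0 = 0 \<Longrightarrow>
     (\<And>u. (E has_real_derivative a (flow u z) - ?m) (at u)) \<Longrightarrow> \<bar>E u\<bar> \<le> (e / (8 * L)) * \<bar>u\<bar> + C"
    using flow_orbit_average[OF a, of "e / (8 * L)"] e L by auto
  \<comment> \<open>Error budget: \<open>e / 2\<close> from the critical points of the cosine,
    \<open>e / 4\<close> from the growth rate of \<open>E\<close>, and \<open>e / 4\<close> from the
    constant \<open>C\<close>, which fixes \<open>M\<close>.\<close>
  define M where "M = nat \<lceil>\<bar>C\<bar> * 4 * L / e\<rceil> + 1"
  have M0: "real M > 0" by (simp add: M_def)
  have "\<bar>C\<bar> * 4 * L / e \<le> real M" unfolding M_def by linarith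
  then have "\<bar>C\<bar> * 4 * L \<le> e * real M" using e by (simp add: field_simps)
  then have CM: "C / real M * L \<le> e / 4"
  proof -
    have "C * L \<le> \<bar>C\<bar> * L" using L by (intro mult_right_mono) auto
    then have "4 * (C * L) \<le> e * real M" using \<open>\<bar>C\<bar> * 4 * L \<le> e * real M\<close> by linarith
    then show ?thesis using M0 by (simp add: field_simps)
  qed
  show ?thesis
  proof (rule that[of M])
    fix z assume z: "z \<in> torus"
    define f where "f u = a (flow u z) - ?m" for u
    have ac: "continuous_on UNIV (\<lambda>u. a (flow u z))"
    proof (rule continuous_on_compose2[OF a])
      show "continuous_on UNIV (\<lambda>u. flow u z)"
        using continuous_on_compose2[OF continuous_flow continuous_on_Pair[OF continuous_on_id continuous_on_const[of _ z]], of UNIV] z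
        by auto
    qed (use z in auto)
    then have fc: "continuous_on UNIV f" unfolding f_def by (intro continuous_on_diff continuous_on_const)
    have "\<exists>F. \<forall>x. -\<infinity> < ereal x \<longrightarrow> ereal x < \<infinity> \<longrightarrow> (F has_vector_derivative f x) (at x)"
      by (rule einterval_antiderivative) (use fc in \<open>auto simp: continuous_on_eq_continuous_at\<close>)
    then obtain E0 where E0: "\<And>u. (E0 has_real_derivative f u) (at u)"
      by (auto simp: has_real_derivative_iff_has_vector_derivative)
    define E where "E u = E0 u - E0 0" for u
    have E: "E 0 = 0" "\<And>u. (E has_real_derivative f u) (at u)"
      unfolding E_def by (auto intro!: derivative_eq_intros E0)
    have Eb: "\<bar>E u\<bar> \<le> (e / (8 * L)) * \<bar>u\<bar> + C" for u
      by (rule C[OF z, of E, OF E(1)]) (use E(2) in \<open>simp add: f_def\<close>)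
    have fb: "\<bar>f u\<bar> \<le> 2 * B" for u using B(2)[of "flow u z"] z m unfolding f_def by auto
    have "\<bar>LINT r:{0..1}|lborel. f (2 * real M * cos (2 * pi * r))\<bar> \<le>
       2 * B * (LINT r:{0..1}|lborel. eta / ((sin (2 * pi * r))\<^sup>2 + eta)) + (2 * (e / (8 * L)) + C / M) * L"
      by (rule cosine_window_average[OF E(2) fc Eb M0 _ fb eta(1) L(2) kd_def]) (use e L in auto)
    also have "\<dots> \<le> 2 * B * (e / (4 * B)) + (2 * (e / (8 * L)) + C / M) * L"
      using eta(2) B by (intro add_right_mono mult_left_mono) auto
    also have "\<dots> = 3 * e / 4 + C / M * L" using B L by (simp add: field_simps)
    also have "\<dots> \<le> e" using CM by linarith
    finally have le: "\<bar>LINT r:{0..1}|lborel. f (2 * real M * cos (2 * pi * r))\<bar> \<le> e" .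
    have "continuous_on {0..1} (\<lambda>r. 2 * real M * cos (2 * pi * r))" by (intro continuous_intros)
    then have si: "set_integrable lborel {0..1} (\<lambda>r. a (flow (2 * real M * cos (2 * pi * r)) z))"
      by (intro borel_integrable_atLeastAtMost' continuous_on_compose2[OF ac]) auto
    have "(LINT r:{0..1}|lborel. f (2 * real M * cos (2 * pi * r))) = (LINT r:{0..1}|lborel. a (flow (2 * real M * cos (2 * pi * r)) z)) - (LINT r:{0..1::real}|lborel. ?m)"
      unfolding f_def by (rule set_integral_diff(2)[OF si]) (intro borel_integrable_atLeastAtMost' continuous_on_const)
    then show "\<bar>(LINT r:{0..1}|lborel. a (flow (2 * real M * cos (2 * pi * r)) z)) - ?m\<bar> \<le> e"
      using le by (simp add: set_lebesgue_integral_def[of _ _ "\<lambda>_. ?m"])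
  qed
qed

section \<open>Weak mixing\<close>

text \<open>The difference of the two sides is the variance.\<close>

lemma (in prob_space) integral_power2_le:
  fixes f :: "'a \<Rightarrow> real"
  assumes "f \<in> borel_measurable M" "\<And>x. x \<in> space M \<Longrightarrow> \<bar>f x\<bar> \<le> B"
  shows "(\<integral>x. f x \<partial>M)\<^sup>2 \<le> (\<integral>x. (f x)\<^sup>2 \<partial>M)"
proof -
  have i: "integrable M f" by (rule integrable_const_bound[where B = B]) (use assms in auto)
  have "integrable M (\<lambda>x. (f x)\<^sup>2)"
  proof (rule integrable_const_bound[where B = "B\<^sup>2"])
    show "AE x in M. norm ((f x)\<^sup>2) \<le> B\<^sup>2"
    proof (rule AE_I2)
      show "norm ((f x)\<^sup>2) \<le> B\<^sup>2" if "x \<in> space M" for x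
        using power_mono[OF assms(2)[OF that], of 2] by simp
    qed
  qed (use assms in auto)
  from variance_eq[OF i this] show ?thesis using variance_positive[of f] by linarith
qed

text \<open>
  Weak mixing follows from arbitrarily good mixing along single times. Choosing such times
  successively gives nearly orthogonal translates \<open>f \<circ> T (ts i)\<close>, so that by Bessel's inequality
  the correlations at the times \<open>t + ts i\<close> are small on average over \<open>i\<close>, for every \<open>t\<close>.
\<close>

lemma weakly_mixing_from_mixing_times:
  fixes T :: "real \<Rightarrow> 'a \<Rightarrow> 'a"
  assumes prob: "prob_space M" and mpf: "measure_preserving_flow M T"
    and times: "\<And>A \<B> e. A \<in> sets M \<Longrightarrow> finite \<B> \<Longrightarrow> \<B> \<subseteq> sets M \<Longrightarrow> e > 0 \<Longrightarrow>
      \<exists>t. \<forall>B\<in>\<B>. \<bar>measure M (T t -` A \<inter> B) - measure M A * measure M B\<bar> < e"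
  shows "weakly_mixing M T"
proof -
  interpret prob_space M by fact
  have Tm [measurable]: "(\<lambda>(t, x). T t x) \<in> borel \<Otimes>\<^sub>M M \<rightarrow>\<^sub>M M"
    and fl: "flow_on (space M) T" and mp: "\<And>t. measure_preserving M (T t)"
    using mpf by (auto simp: measure_preserving_flow_def)
  have Ttm [measurable]: "T t \<in> M \<rightarrow>\<^sub>M M" for t using mp[of t] by (simp add: measure_preserving_def)
  have Tsp: "T t x \<in> space M" if "x \<in> space M" for t x using that fl by (simp add: flow_on_def)
  have Tadd: "T (s + t) x = T s (T t x)" if "x \<in> space M" for s t x using that fl by (simp add: flow_on_def)
  have inv: "(\<integral>x. g (T t x) \<partial>M) = (\<integral>x. g x \<partial>M)" if "g \<in> borel_measurable M" for g :: "'a \<Rightarrow> real" and t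
    using integral_distr[OF Ttm that, of t] mp[of t] by (simp add: measure_preserving_def)
  show ?thesis unfolding weakly_mixing_def
  proof (intro ballI)
    fix A B assume A [measurable]: "A \<in> sets M" and B [measurable]: "B \<in> sets M"
    define c where "c t = measure M (T t -` A \<inter> B) - measure M A * measure M B" for t
    define f where "f x = indicator A x - measure M A" for x
    have fm [measurable]: "f \<in> borel_measurable M" unfolding f_def by simp
    have fb: "\<bar>f x\<bar> \<le> 1" for x
    proof -
      have "indicator A x = (0::real) \<or> indicator A x = (1::real)" by (auto simp: indicator_def)
      then show ?thesis unfolding f_def using prob_le_1[of A] measure_nonneg[of M A] by linarith
    qed
    have meas: "measure M (T t -` A \<inter> C) = (\<integral>x. indicator A (T t x) * indicator C x \<partial>M)"
      if "C \<in> sets M" for C t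
    proof -
      have "measure M (T t -` A \<inter> C) = (\<integral>x. indicator (T t -` A \<inter> C) x \<partial>M)"
        using sets.sets_into_space[OF that] by (simp add: Int_absorb2 le_infI2)
      also have "\<dots> = (\<integral>x. indicator A (T t x) * indicator C x \<partial>M)"
        by (intro Bochner_Integration.integral_cong) (auto simp: indicator_def)
      finally show ?thesis .
    qed
    have bi: "integrable M g" if "g \<in> borel_measurable M" "\<And>x. \<bar>g x\<bar> \<le> 1" for g :: "'a \<Rightarrow> real"
      by (rule integrable_const_bound[where B = 1]) (use that in auto)
    have ceq: "measure M (T t -` A \<inter> C) - measure M A * measure M C = (\<integral>x. f (T t x) * indicator C x \<partial>M)"
      if C [measurable]: "C \<in> sets M" for C t
    proof -
      have "(\<integral>x. f (T t x) * indicator C x \<partial>M) = (\<integral>x. indicator A (T t x) * indicator C x - measure M A * indicator C x \<partial>M)"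
        by (simp add: f_def left_diff_distrib)
      also have "\<dots> = (\<integral>x. indicator A (T t x) * indicator C x \<partial>M) - (\<integral>x. measure M A * indicator C x \<partial>M)"
        by (intro Bochner_Integration.integral_diff bi) (auto simp: indicator_def prob_le_1)
      also have "(\<integral>x. measure M A * indicator C x \<partial>M) = measure M A * measure M C"
        using sets.sets_into_space[OF C] by (simp add: Int_absorb2)
      finally show ?thesis using meas[OF C] by simp
    qed
    have pair: "(\<integral>x. f (T s x) * f (T t x) \<partial>M) = measure M (T t -` A \<inter> (T s -` A \<inter> space M)) - measure M A * measure M (T s -` A \<inter> space M)" for s t
    proof -
      have [measurable]: "T s -` A \<inter> space M \<in> sets M" by simp
      have f0: "(\<integral>x. f (T t x) \<partial>M) = 0"
      proof -
        have "(\<integral>x. f x \<partial>M) = 0"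
          unfolding f_def using sets.sets_into_space[OF A]
          by (subst Bochner_Integration.integral_diff) (auto simp: prob_space Int_absorb2 bi emeasure_eq_measure)
        then show ?thesis using inv[of f t] by simp
      qed
      have "(\<integral>x. f (T s x) * f (T t x) \<partial>M) = (\<integral>x. f (T t x) * indicator (T s -` A \<inter> space M) x - measure M A * f (T t x) \<partial>M)"
        by (intro Bochner_Integration.integral_cong) (auto simp: f_def indicator_def algebra_simps)
      also have "\<dots> = (\<integral>x. f (T t x) * indicator (T s -` A \<inter> space M) x \<partial>M) - (\<integral>x. measure M A * f (T t x) \<partial>M)"
        using fb by (intro Bochner_Integration.integral_diff bi) (auto simp: indicator_def abs_mult prob_le_1 intro!: mult_le_one)
      finally show ?thesis using f0 ceq[of "T s -` A \<inter> space M" t] by simp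
    qed
    \<comment> \<open>Each new time is chosen to mix \<open>A\<close> with its preimages under all
      earlier times.\<close>
    have orth: "\<exists>ts :: nat \<Rightarrow> real. \<forall>j<k. \<forall>i<j. \<bar>\<integral>x. f (T (ts i) x) * f (T (ts j) x) \<partial>M\<bar> < e" if e: "e > 0" for e k
    proof (induction k)
      case (Suc k)
      then obtain ts where ts: "\<And>i j. j < k \<Longrightarrow> i < j \<Longrightarrow> \<bar>\<integral>x. f (T (ts i) x) * f (T (ts j) x) \<partial>M\<bar> < e" by blast
      have "\<exists>t. \<forall>B\<in>(\<lambda>i. T (ts i) -` A \<inter> space M) ` {..<k}. \<bar>measure M (T t -` A \<inter> B) - measure M A * measure M B\<bar> < e"
        by (rule times[OF A _ _ e]) auto
      then obtain t where "\<And>i. i < k \<Longrightarrow> \<bar>\<integral>x. f (T (ts i) x) * f (T t x) \<partial>M\<bar> < e" unfolding pair by auto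
      then show ?case using ts
        by (intro exI[of _ "ts(k := t)"]) (auto simp: less_Suc_eq)
    qed simp
    have cm [measurable]: "c \<in> borel_measurable borel"
    proof -
      have "(\<lambda>t. \<integral>x. (indicator A (T t x) * indicator B x :: real) \<partial>M) \<in> borel_measurable borel"
        by measurable
      then show ?thesis unfolding c_def meas[OF B] by simp
    qed
    have cb: "\<bar>c t\<bar> \<le> 1" for t
      unfolding c_def abs_le_iff using measure_nonneg[of M "T t -` A \<inter> B"] prob_le_1[of "T t -` A \<inter> B"]
        measure_nonneg[of M A] measure_nonneg[of M B] mult_le_one[OF prob_le_1[of A] measure_nonneg prob_le_1[of B]]
      by (smt (verit) mult_nonneg_nonneg)
    have bessel: "(\<Sum>i<k. \<bar>c (ts i + t)\<bar>) \<le> sqrt (k + real k * real k * e)"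
      if ts: "\<And>i j. j < k \<Longrightarrow> i < j \<Longrightarrow> \<bar>\<integral>x. f (T (ts i) x) * f (T (ts j) x) \<partial>M\<bar> < e" and e: "e > 0"
      for ts :: "nat \<Rightarrow> real" and k e t
    proof -
      \<comment> \<open>Signs turn the sum of absolute correlations into one correlation with the
        combination \<open>g\<close>.\<close>
      define sg where "sg i = sgn (c (ts i + t))" for i
      have sg: "\<bar>sg i\<bar> \<le> 1" for i by (simp add: sg_def abs_sgn_eq)
      define g where "g x = (\<Sum>i<k. sg i * f (T (ts i) x))" for x
      have gm [measurable]: "g \<in> borel_measurable M" unfolding g_def by measurable
      have gb: "\<bar>g x\<bar> \<le> real k" for x
      proof -
        have "\<bar>g x\<bar> \<le> (\<Sum>i<k. \<bar>sg i * f (T (ts i) x)\<bar>)" unfolding g_def by (rule sum_abs)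
        also have "\<dots> \<le> (\<Sum>i<k. 1)" using sg fb by (intro sum_mono) (auto simp: abs_mult intro!: mult_le_one)
        finally show ?thesis by simp
      qed
      have "(\<Sum>i<k. \<bar>c (ts i + t)\<bar>) = (\<Sum>i<k. sg i * (\<integral>x. f (T (ts i + t) x) * indicator B x \<partial>M))"
        unfolding sg_def ceq[OF B, symmetric] c_def[symmetric] by (intro sum.cong) (auto simp: abs_sgn mult.commute)
      also have "\<dots> = (\<integral>x. (\<Sum>i<k. sg i * (f (T (ts i + t) x) * indicator B x)) \<partial>M)"
      proof -
        have "integrable M (\<lambda>x. f (T (ts i + t) x) * indicator B x)" for i
          using fb by (intro bi) (auto simp: indicator_def)
        then show ?thesis by (subst Bochner_Integration.integral_sum) auto
      qed
      also have "\<dots> = (\<integral>x. g (T t x) * indicator B x \<partial>M)"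
        by (intro Bochner_Integration.integral_cong) (auto simp: g_def Tadd sum_distrib_right mult.assoc)
      finally have eq: "(\<Sum>i<k. \<bar>c (ts i + t)\<bar>) = (\<integral>x. g (T t x) * indicator B x \<partial>M)" .
      \<comment> \<open>After squaring and dropping the indicator of \<open>B\<close>, invariance
        under \<open>T t\<close> removes \<open>t\<close>, so the bound is uniform in
        \<open>t\<close>.\<close>
      have "(\<Sum>i<k. \<bar>c (ts i + t)\<bar>)\<^sup>2 \<le> (\<integral>x. (g (T t x) * indicator B x)\<^sup>2 \<partial>M)"
        unfolding eq by (rule integral_power2_le[where B = "real k"]) (use gb in \<open>auto simp: indicator_def\<close>)
      also have "\<dots> \<le> (\<integral>x. (g (T t x))\<^sup>2 \<partial>M)"
      proof (rule integral_mono')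
        show "integrable M (\<lambda>x. (g (T t x))\<^sup>2)"
        proof (rule integrable_const_bound[where B = "(real k)\<^sup>2"])
          show "AE x in M. norm ((g (T t x))\<^sup>2) \<le> (real k)\<^sup>2"
          proof (rule AE_I2)
            show "norm ((g (T t x))\<^sup>2) \<le> (real k)\<^sup>2" for x
              using power_mono[OF gb[of "T t x"], of 2] by simp
          qed
        qed simp
      qed (auto simp: indicator_def)
      also have "\<dots> = (\<integral>x. (g x)\<^sup>2 \<partial>M)" by (rule inv) simp
      also have "\<dots> = (\<integral>x. (\<Sum>i<k. \<Sum>j<k. sg i * sg j * (f (T (ts i) x) * f (T (ts j) x))) \<partial>M)"
        by (simp add: g_def power2_eq_square sum_product mult_ac)
      also have "\<dots> = (\<Sum>i<k. \<Sum>j<k. sg i * sg j * (\<integral>x. f (T (ts i) x) * f (T (ts j) x) \<partial>M))"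
      proof -
        have "integrable M (\<lambda>x. f (T (ts i) x) * f (T (ts j) x))" for i j
          using fb by (intro bi) (auto simp: abs_mult intro!: mult_le_one)
        then show ?thesis by (subst Bochner_Integration.integral_sum; auto intro!: sum.cong)+
      qed
      also have "\<dots> \<le> (\<Sum>i<k. \<Sum>j<k. (if i = j then 1 else 0) + e)"
      proof (intro sum_mono)
        fix i j assume ij: "i \<in> {..<k}" "j \<in> {..<k}"
        let ?I = "\<integral>x. f (T (ts i) x) * f (T (ts j) x) \<partial>M"
        have "\<bar>?I\<bar> \<le> (if i = j then 1 else 0) + e"
        proof (cases i j rule: linorder_cases)
          case less then show ?thesis using ts[of j i] ij by auto
        next
          case greater then show ?thesis using ts[of i j] ij by (simp add: mult.commute)
        next
          case equal
          have "\<bar>?I\<bar> \<le> 1"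
            by (rule order_trans[OF integral_abs_bound integral_le_const])
               (use fb in \<open>auto simp: abs_mult intro!: mult_le_one bi\<close>)
          then show ?thesis using equal e by simp
        qed
        moreover have "sg i * sg j * ?I \<le> \<bar>?I\<bar>"
        proof -
          have "\<bar>sg i * sg j\<bar> \<le> 1" unfolding abs_mult using sg by (intro mult_le_one) auto
          then have "\<bar>sg i * sg j\<bar> * \<bar>?I\<bar> \<le> 1 * \<bar>?I\<bar>" by (intro mult_right_mono) auto
          then show ?thesis by (simp add: abs_mult[symmetric])
        qed
        ultimately show "sg i * sg j * ?I \<le> (if i = j then 1 else 0) + e" by linarith
      qed
      also have "\<dots> = k + real k * real k * e" by (simp add: sum.distrib algebra_simps)
      finally show ?thesis by (rule real_le_rsqrt)
    qed
    have nonneg: "0 \<le> (1 / R) * (LINT t:{0..R}|lborel. \<bar>c t\<bar>)" if "R > 0" for R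
      using that unfolding set_lebesgue_integral_def
      by (intro mult_nonneg_nonneg Bochner_Integration.integral_nonneg) auto
    have small: "\<forall>\<^sub>F R in at_top. (1 / R) * (LINT t:{0..R}|lborel. \<bar>c t\<bar>) < d" if d: "d > 0" for d
    proof -
      \<comment> \<open>Chosen so that \<open>sqrt (2 * k) / k < d / 2\<close>.\<close>
      define k where "k = nat \<lceil>8 / d\<^sup>2\<rceil> + 1"
      have k0: "real k > 0" and k: "8 / d\<^sup>2 < real k" unfolding k_def by linarith+
      obtain ts :: "nat \<Rightarrow> real" where ts: "\<And>i j. j < k \<Longrightarrow> i < j \<Longrightarrow> \<bar>\<integral>x. f (T (ts i) x) * f (T (ts j) x) \<partial>M\<bar> < 1 / real k"
        using orth[of "1 / real k" k] k0 by auto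
      have bes: "(\<Sum>i<k. \<bar>c (ts i + t)\<bar>) \<le> sqrt (2 * real k)" for t
      proof -
        have "1 / real k > 0" using k0 by simp
        from bessel[of k ts "1 / real k" t, OF ts this]
        have "(\<Sum>i<k. \<bar>c (ts i + t)\<bar>) \<le> sqrt (k + real k * real k * (1 / real k))" .
        then show ?thesis using k0 by simp
      qed
      \<comment> \<open>The total cost of shifting the averaging window by the times
        \<open>ts i\<close>; it does not grow with \<open>R\<close>.\<close>
      define D where "D = (\<Sum>i<k. 2 * \<bar>ts i\<bar>)"
      have main: "real k * (LINT t:{0..R}|lborel. \<bar>c t\<bar>) \<le> R * sqrt (2 * real k) + D" if R: "R > 0" for R
      proof -
        have ci: "set_integrable lborel {a..b} (\<lambda>t. \<bar>c (s + t)\<bar>)" for s a b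
          unfolding set_integrable_def using cb
          by (intro integrableI_bounded_set_indicator[where B = 1]) (auto simp: emeasure_lborel_Icc_eq)
        have 1: "(LINT t:{0..R}|lborel. \<bar>c t\<bar>) \<le> (LINT t:{0..R}|lborel. \<bar>c (ts i + t)\<bar>) + 2 * \<bar>ts i\<bar>" for i
        proof -
          have "(LINT t:{0..R}|lborel. \<bar>c (ts i + t)\<bar>) = (LBINT v. \<bar>c v\<bar> * indicator {ts i..ts i + R} v)"
            unfolding set_lebesgue_integral_def
            by (subst lborel_integral_real_affine[where c = 1 and t = "ts i" and f = "\<lambda>v. \<bar>c v\<bar> * indicator {ts i..ts i + R} v"])
               (auto intro!: Bochner_Integration.integral_cong simp: indicator_def)
          moreover have "(LINT t:{0..R}|lborel. \<bar>c t\<bar>) = (LBINT v. \<bar>c v\<bar> * indicator {0..R} v)"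
            by (simp add: set_lebesgue_integral_def mult.commute)
          ultimately show ?thesis
            using window_shift_bound[of "\<lambda>v. \<bar>c v\<bar>" R "ts i"] cb R by auto
        qed
        have "real k * (LINT t:{0..R}|lborel. \<bar>c t\<bar>) = (\<Sum>i<k. LINT t:{0..R}|lborel. \<bar>c t\<bar>)" by simp
        also have "\<dots> \<le> (\<Sum>i<k. (LINT t:{0..R}|lborel. \<bar>c (ts i + t)\<bar>) + 2 * \<bar>ts i\<bar>)"
          by (intro sum_mono 1)
        also have "\<dots> = (\<Sum>i<k. LINT t:{0..R}|lborel. \<bar>c (ts i + t)\<bar>) + D" by (simp add: sum.distrib D_def)
        also have "(\<Sum>i<k. LINT t:{0..R}|lborel. \<bar>c (ts i + t)\<bar>) = (LINT t:{0..R}|lborel. (\<Sum>i<k. \<bar>c (ts i + t)\<bar>))"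
          unfolding set_lebesgue_integral_def scaleR_sum_right
          by (rule Bochner_Integration.integral_sum[symmetric]) (use ci in \<open>simp add: set_integrable_def\<close>)
        also have "\<dots> \<le> (LINT t:{0..R}|lborel. sqrt (2 * real k))"
        proof (rule set_integral_mono)
          show "set_integrable lborel {0..R} (\<lambda>t. \<Sum>i<k. \<bar>c (ts i + t)\<bar>)"
            unfolding set_integrable_def scaleR_sum_right
            by (rule Bochner_Integration.integrable_sum) (use ci in \<open>simp add: set_integrable_def\<close>)
        qed (use bes in \<open>auto intro!: borel_integrable_atLeastAtMost'\<close>)
        also have "\<dots> = R * sqrt (2 * real k)" using R by (simp add: set_lebesgue_integral_def)
        finally show ?thesis by simp
      qed
      have sq: "sqrt (2 * real k) / real k < d / 2"
      proof -
        have "2 * real k < (d / 2 * real k)\<^sup>2"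
          using k k0 d by (simp add: power2_eq_square field_simps)
        then have "sqrt (2 * real k) < d / 2 * real k"
          using d k0 by (intro real_less_lsqrt) auto
        then show ?thesis using k0 by (simp add: field_simps)
      qed
      have "\<forall>\<^sub>F R in at_top. D / (real k * R) < d / 2"
      proof -
        have "((\<lambda>R. D / (real k * R)) \<longlongrightarrow> 0) at_top" using k0 by real_asymp
        then show ?thesis using d by (intro order_tendstoD(2)) auto
      qed
      then show ?thesis using eventually_gt_at_top[of 0]
      proof eventually_elim
        case (elim R)
        have "(1 / R) * (LINT t:{0..R}|lborel. \<bar>c t\<bar>) = (real k * (LINT t:{0..R}|lborel. \<bar>c t\<bar>)) / (real k * R)"
          using k0 by simp
        also have "\<dots> \<le> (R * sqrt (2 * real k) + D) / (real k * R)"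
          using main[of R] elim k0 by (intro divide_right_mono) auto
        also have "\<dots> = sqrt (2 * real k) / real k + D / (real k * R)"
          using elim k0 by (simp add: add_divide_distrib)
        also have "\<dots> < d" using sq elim by linarith
        finally show ?case .
      qed
    qed
    have "((\<lambda>R. (1 / R) * (LINT t:{0..R}|lborel. \<bar>c t\<bar>)) \<longlongrightarrow> 0) at_top"
    proof (rule order_tendstoI)
      show "\<forall>\<^sub>F R in at_top. y < (1 / R) * (LINT t:{0..R}|lborel. \<bar>c t\<bar>)" if "y < 0" for y
        using eventually_gt_at_top[of 0] by eventually_elim (use nonneg that in force)
    qed (rule small)
    then show "((\<lambda>R. 1 / R * (LINT t:{0..R}|lborel. \<bar>measure M (T t -` A \<inter> B) - measure M A * measure M B\<bar>)) \<longlongrightarrow> 0) at_top"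
      by (simp add: c_def)
  qed
qed

text \<open>A half turn negates the first harmonic and fixes the second, so
  \<open>gap 2 u = - 2 * Re u\<close> and the point is moved by about
  \<open>2 * M * Re (chi (s k) z)\<close> along its orbit. Equidistribution of
  \<open>chi (s k)\<close> independently of \<open>z\<close> then gives the limit.\<close>

lemma flow_tau_limit:
  fixes a b :: "complex \<times> complex \<Rightarrow> real"
  assumes a: "continuous_on torus a" and b: "continuous_on torus b"
    and s: "\<And>k. amp (s k) = M" "filterlim s at_top sequentially"
  shows "(\<lambda>k. \<integral>z. a (flow (2 * tau (s k)) z) * b z \<partial>mu) \<longlonglongrightarrow>
    (\<integral>z. (LINT r:{0..1}|lborel. a (flow (2 * M * cos (2 * pi * r)) z)) * b z \<partial>mu)"
proof -
  have M0: "M \<ge> 0" using s(1) amp_nonneg by metis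
  have ac: "continuous_on (UNIV \<times> torus) (\<lambda>(t, z). a (flow t z))"
    unfolding case_prod_unfold
    by (rule continuous_on_compose2[OF a continuous_flow[unfolded case_prod_unfold]]) auto
  define K where "K p = a (flow (2 * M * Re (snd p)) (fst p)) * b (fst p)" for p
  have "continuous_on (torus \<times> sphere 0 1) (\<lambda>p. (2 * M * Re (snd p), fst p))" by (intro continuous_intros)
  then have Kac: "continuous_on (torus \<times> sphere 0 1) (\<lambda>p. a (flow (2 * M * Re (snd p)) (fst p)))"
    using continuous_on_compose2[OF ac] by fastforce
  have Kc: "continuous_on (torus \<times> sphere 0 1) K"
    unfolding K_def
    by (intro continuous_on_mult Kac continuous_on_compose2[OF b continuous_on_fst[OF continuous_on_id]]) auto
  have L: "(\<lambda>k. \<integral>z. K (z, chi (s k) z) \<partial>mu) \<longlonglongrightarrow> (\<integral>z. (LINT r:{0..1}|lborel. K (z, cis (2 * pi * r))) \<partial>mu)"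
    by (rule equidistribution_chi[OF Kc s(2)])
  obtain B where B: "B > 0" "\<And>z. z \<in> torus \<Longrightarrow> \<bar>b z\<bar> \<le> B"
    using continuous_torus_bounded[OF b] by (metis real_norm_def)
  have flc: "continuous_on torus (flow t)" for t
    using continuous_on_compose2[OF continuous_flow continuous_on_Pair[OF continuous_on_const[of _ t] continuous_on_id], of torus]
    by auto
  have i1: "integrable mu (\<lambda>z. a (flow t z) * b z)" for t
    by (intro integrable_mu_continuous continuous_on_mult continuous_on_compose2[OF a flc] b) auto
  have i2: "integrable mu (\<lambda>z. K (z, chi n z))" for n
    by (intro integrable_mu_continuous continuous_on_compose2[OF Kc] continuous_on_Pair continuous_on_id continuous_chi)
       (auto simp: cmod_chi)
  have D: "(\<lambda>k. (\<integral>z. a (flow (2 * tau (s k)) z) * b z \<partial>mu) - (\<integral>z. K (z, chi (s k) z) \<partial>mu)) \<longlonglongrightarrow> 0"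
  proof (rule LIMSEQ_I)
    fix e :: real assume e: "e > 0"
    \<comment> \<open>The comparison time is at most \<open>2 * M\<close> in modulus; the extra 1
      leaves room for the error \<open>er k\<close>.\<close>
    define R where "R = 2 * M + 1"
    have "compact ({-R..R} \<times> torus)" by (intro compact_Times compact_torus) simp
    moreover have "continuous_on ({-R..R} \<times> torus) (\<lambda>(t, z). a (flow t z))"
      by (rule continuous_on_subset[OF ac]) auto
    ultimately have "uniformly_continuous_on ({-R..R} \<times> torus) (\<lambda>(t, z). a (flow t z))"
      by (intro compact_uniformly_continuous)
    then obtain d where d: "d > 0" "\<And>p p'. p \<in> {-R..R} \<times> torus \<Longrightarrow> p' \<in> {-R..R} \<times> torus \<Longrightarrow> dist p' p < d \<Longrightarrow>
        dist (case p' of (t, z) \<Rightarrow> a (flow t z)) (case p of (t, z) \<Rightarrow> a (flow t z)) < e / (2 * B)"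
      unfolding uniformly_continuous_on_def using e B by (metis divide_pos_pos mult_pos_pos zero_less_numeral)
    define er where "er k = 6 * pi * \<bar>2\<bar> * (1/2) ^ s k * (2 + M)" for k
    have "(\<lambda>k. (1/2::real) ^ s k) \<longlonglongrightarrow> 0"
      using filterlim_compose[OF LIMSEQ_realpow_zero s(2), of "1/2"] by simp
    then have "er \<longlonglongrightarrow> 6 * pi * \<bar>2\<bar> * 0 * (2 + M)" unfolding er_def by (intro tendsto_intros)
    then have ev1: "\<forall>\<^sub>F k in sequentially. er k < min (d / 2) 1" using d by (intro order_tendstoD(2)[where y = 0]) auto
    have "(\<lambda>k. dist (torus_proj (slope * (2 * real (tau (s k))), 2 * real (tau (s k)))) (1, 1)) \<longlonglongrightarrow> 0"
      using filterlim_compose[OF dist_lin_tau_tendsto[of 2] s(2)] by simp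
    then have ev2: "\<forall>\<^sub>F k in sequentially. dist (torus_proj (slope * (2 * real (tau (s k))), 2 * real (tau (s k)))) (1, 1) < d / 2"
      using d by (intro order_tendstoD(2)) auto
    have "\<forall>\<^sub>F k in sequentially. \<bar>(\<integral>z. a (flow (2 * tau (s k)) z) * b z \<partial>mu) - (\<integral>z. K (z, chi (s k) z) \<partial>mu)\<bar> < e"
      using ev1 ev2
    proof eventually_elim
      case (elim k)
      let ?t = "2 * real (tau (s k))"
      have pw: "\<bar>a (flow ?t z) * b z - K (z, chi (s k) z)\<bar> \<le> e / 2" if z: "z \<in> torus" for z
      proof -
        let ?u = "?t - Phi ?t z" and ?v = "2 * M * Re (chi (s k) z)"
        have "cis pi = -1" by (simp add: complex_eq_iff)
        then have "gap 2 u = - 2 * Re u" for u by (simp add: gap_def hcirc_def)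
        then have uv: "\<bar>?u - ?v\<bar> \<le> er k"
          using Phi_tau[of 2 z "s k"] z s(1) by (simp add: er_def abs_minus_commute algebra_simps)
        have "\<bar>Re (chi (s k) z)\<bar> \<le> 1" using abs_Re_le_cmod[of "chi (s k) z"] cmod_chi[OF z, of "s k"] by simp
        then have v: "\<bar>?v\<bar> \<le> 2 * M"
          using M0 mult_left_mono[of "\<bar>Re (chi (s k) z)\<bar>" 1 "2 * M"] by (simp add: abs_mult)
        have "dist (?u, lin ?t z) (?v, z) \<le> \<bar>?u - ?v\<bar> + dist (lin ?t z) z"
          unfolding dist_Pair_Pair dist_real_def using sqrt_sum_squares_le_sum_abs[of "\<bar>?u - ?v\<bar>" "dist (lin ?t z) z"] by simp
        also have "\<dots> < d"
          using uv elim unfolding dist_lin[OF z, of ?t] min_less_iff_conj by linarith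
        finally have "dist (?u, lin ?t z) (?v, z) < d" .
        moreover have "?v \<in> {-R..R}" "?u \<in> {-R..R}"
          using uv v elim(1) unfolding R_def atLeastAtMost_iff min_less_iff_conj by linarith+
        ultimately have "dist (a (flow ?u (lin ?t z))) (a (flow ?v z)) < e / (2 * B)"
          using d(2)[of "(?v, z)" "(?u, lin ?t z)"] z by simp
        then have "\<bar>a (flow ?t z) - a (flow ?v z)\<bar> \<le> e / (2 * B)"
          using flow_via_lin[OF z, of ?t] by (simp add: dist_real_def)
        then have "\<bar>a (flow ?t z) - a (flow ?v z)\<bar> * \<bar>b z\<bar> \<le> e / (2 * B) * B"
          using B z by (intro mult_mono) auto
        then show ?thesis using B by (simp add: K_def abs_mult[symmetric] left_diff_distrib)
      qed
      have "\<bar>\<integral>z. a (flow ?t z) * b z - K (z, chi (s k) z) \<partial>mu\<bar> \<le> e / 2"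
        by (rule mu_integral_abs_le[OF Bochner_Integration.integrable_diff[OF i1 i2] pw])
      then show ?case using e i1 i2 by simp
    qed
    then show "\<exists>k0. \<forall>k\<ge>k0. norm ((\<integral>z. a (flow (2 * tau (s k)) z) * b z \<partial>mu) - (\<integral>z. K (z, chi (s k) z) \<partial>mu) - 0) < e"
      by (auto simp: eventually_sequentially)
  qed
  have "(\<integral>z. (LINT r:{0..1}|lborel. K (z, cis (2 * pi * r))) \<partial>mu) = (\<integral>z. (LINT r:{0..1}|lborel. a (flow (2 * M * cos (2 * pi * r)) z)) * b z \<partial>mu)"
    by (intro Bochner_Integration.integral_cong refl) (simp add: K_def)
  with tendsto_add[OF D L] show ?thesis by simp
qed

text \<open>The length \<open>M\<close> is determined by the approximation of \<open>A\<close>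
  alone, uniformly in the point, so the same sequence of times serves every \<open>B\<close> and
  finitely many can be treated at once.\<close>

lemma mixing_times:
  assumes A: "A \<in> sets mu" and \<B>: "finite \<B>" "\<B> \<subseteq> sets mu" and e: "e > 0"
  shows "\<exists>t. \<forall>B\<in>\<B>. \<bar>measure mu (flow t -` A \<inter> B) - measure mu A * measure mu B\<bar> < e"
proof -
  \<comment> \<open>The errors below total \<open>6 * d\<close>: two for replacing indicators, one
    each for the limit and the window average, two for the product of measures.\<close>
  define d where "d = e / 8"
  have d: "d > 0" using e by (simp add: d_def)
  have approx: "\<exists>g :: _ \<Rightarrow> real. continuous_on torus g \<and> (\<forall>z. 0 \<le> g z \<and> g z \<le> 1) \<and> (\<integral>z. \<bar>indicator B z - g z\<bar> \<partial>mu) \<le> d"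
    if B: "B \<in> sets mu" for B
  proof -
    have B': "B \<in> sets torus_lebesgue" using B by simp
    obtain g :: "_ \<Rightarrow> real" where g: "continuous_on UNIV g" "\<And>z. 0 \<le> g z \<and> g z \<le> 1"
      "(\<integral>z. \<bar>indicator B z - g z\<bar> \<partial>torus_lebesgue) < 2/3 * d"
      using indicator_approx_continuous[OF B', of "2/3 * d"] d by auto
    have gt: "continuous_on torus g" using g(1) continuous_on_subset by blast
    have "integrable torus_lebesgue (\<lambda>z. \<bar>indicator B z - g z\<bar>)"
      using B' integrable_continuous_torus[OF gt]
      by (intro integrable_abs Bochner_Integration.integrable_diff integrable_real_indicator) (simp_all add: leb.emeasure_eq_measure)
    from integral_mu_le[OF this] g(3) have "(\<integral>z. \<bar>indicator B z - g z\<bar> \<partial>mu) \<le> d" by simp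
    then show ?thesis using gt g(2) by blast
  qed
  obtain a where a: "continuous_on torus a" "\<And>z. 0 \<le> a z \<and> a z \<le> (1::real)" "(\<integral>z. \<bar>indicator A z - a z\<bar> \<partial>mu) \<le> d"
    using approx[OF A] by blast
  obtain b where b: "\<And>B. B \<in> \<B> \<Longrightarrow> continuous_on torus (b B)" "\<And>B z. B \<in> \<B> \<Longrightarrow> 0 \<le> b B z \<and> b B z \<le> (1::real)"
     "\<And>B. B \<in> \<B> \<Longrightarrow> (\<integral>z. \<bar>indicator B z - b B z\<bar> \<partial>mu) \<le> d"
    using approx \<B>(2) by (metis subsetD)
  let ?m = "\<integral>z. a z \<partial>mu"
  define V where "V M z = (LINT r:{0..1}|lborel. a (flow (2 * M * cos (2 * pi * r)) z))" for M z
  obtain M :: nat where M: "\<And>z. z \<in> torus \<Longrightarrow> \<bar>V M z - ?m\<bar> \<le> d"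
    using window_average[OF a(1) d] unfolding V_def by blast
  obtain s where s: "\<And>k. amp (s k) = real M" "filterlim s at_top sequentially"
    using amp_subsequence by blast
  have am: "a \<in> borel_measurable mu" using borel_measurable_continuous_torus[OF a(1)] by simp
  have flm [measurable]: "flow t \<in> mu \<rightarrow>\<^sub>M mu" for t by measurable
  have ai: "integrable mu a" by (rule integrable_mu_continuous[OF a(1)])
  have fl_dist: "distr mu mu (flow t) = mu" for t using measure_preserving_flow_mu[of t] by (simp add: measure_preserving_def)
  have inv: "(\<integral>z. g (flow t z) \<partial>mu) = (\<integral>z. g z \<partial>mu)" if "g \<in> borel_measurable mu" for g :: "_ \<Rightarrow> real" and t
    using integral_distr[OF flm[of t] that] by (simp add: fl_dist)
  have bnd: "integrable mu g" if "g \<in> borel_measurable mu" "\<And>z. \<bar>g z\<bar> \<le> 1" for g :: "_ \<Rightarrow> real"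
    by (rule mu.integrable_const_bound[where B = 1]) (use that in auto)
  have "\<forall>\<^sub>F k in sequentially. \<bar>measure mu (flow (2 * tau (s k)) -` A \<inter> B) - measure mu A * measure mu B\<bar> < e"
    if B: "B \<in> \<B>" for B
  proof -
    have Bm [measurable]: "B \<in> sets mu" using B \<B> by blast
    have [measurable]: "b B \<in> borel_measurable mu" "a \<in> borel_measurable mu" "A \<in> sets mu"
      using borel_measurable_continuous_torus[OF b(1)[OF B]] am A by auto
    have Bt: "B \<subseteq> torus" "A \<subseteq> torus" using sets.sets_into_space[OF Bm] sets.sets_into_space[OF A] by auto
    have b1: "\<bar>b B z\<bar> \<le> 1" "\<bar>a z\<bar> \<le> 1" for z using b(2)[OF B, of z] a(2)[of z] by auto
    have i1: "\<bar>indicator C z - g z\<bar> \<le> (1::real)" if "0 \<le> g z \<and> g z \<le> 1" for C and g :: "_ \<Rightarrow> real" and z :: "complex \<times> complex"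
      using that by (auto simp: indicator_def)
    have lim: "(\<lambda>k. \<integral>z. a (flow (2 * tau (s k)) z) * b B z \<partial>mu) \<longlonglongrightarrow> (\<integral>z. V M z * b B z \<partial>mu)"
      unfolding V_def by (rule flow_tau_limit[OF a(1) b(1)[OF B] s])
    have Vb: "\<bar>(\<integral>z. V M z * b B z \<partial>mu) - ?m * (\<integral>z. b B z \<partial>mu)\<bar> \<le> d"
    proof -
      have "continuous_on ({0..1} \<times> torus) (\<lambda>p. (2 * M * cos (2 * pi * fst p), snd p))" by (intro continuous_intros)
      then have "continuous_on ({0..1} \<times> torus) (\<lambda>p. flow (2 * M * cos (2 * pi * fst p)) (snd p))"
        using continuous_on_compose2[OF continuous_flow] by fastforce
      then have "continuous_on ({0..1} \<times> torus) (\<lambda>(r, z). a (flow (2 * M * cos (2 * pi * r)) z))"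
        unfolding case_prod_unfold by (rule continuous_on_compose2[OF a(1)]) auto
      from continuous_on_unit_integral[OF this] have [measurable]: "V M \<in> borel_measurable mu"
        by (simp add: V_def[abs_def])
      have "\<bar>(V M z - ?m) * b B z\<bar> \<le> d" if "z \<in> torus" for z
        unfolding abs_mult using mult_mono[OF M[OF that] b1(1)[of z]] d by simp
      moreover have Vi: "integrable mu (\<lambda>z. (V M z - ?m) * b B z)"
        by (rule mu.integrable_const_bound[where B = d]) (use calculation in \<open>auto intro!: AE_I2 simp del: split_paired_All\<close>)
      ultimately have "\<bar>\<integral>z. (V M z - ?m) * b B z \<partial>mu\<bar> \<le> d" by (intro mu_integral_abs_le)
      moreover have "(\<integral>z. V M z * b B z \<partial>mu) = (\<integral>z. (V M z - ?m) * b B z + ?m * b B z \<partial>mu)"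
        by (simp add: algebra_simps)
      moreover have "\<dots> = (\<integral>z. (V M z - ?m) * b B z \<partial>mu) + ?m * (\<integral>z. b B z \<partial>mu)"
        using Vi bnd[of "b B"] b1 by (subst Bochner_Integration.integral_add) auto
      ultimately show ?thesis by simp
    qed
    have iA: "measure mu A = (\<integral>z. indicator A z \<partial>mu)" and iB: "measure mu B = (\<integral>z. indicator B z \<partial>mu)"
      using Bt by (simp_all add: Int_absorb2)
    have Am: "\<bar>measure mu A - ?m\<bar> \<le> d"
    proof -
      have "\<bar>\<integral>z. indicator A z - a z \<partial>mu\<bar> \<le> (\<integral>z. \<bar>indicator A z - a z\<bar> \<partial>mu)" by (rule integral_abs_bound)
      moreover have "(\<integral>z. indicator A z - a z \<partial>mu) = measure mu A - ?m"
        using ai Bt bnd[of "indicator A"]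
        by (subst Bochner_Integration.integral_diff) (auto simp: Int_absorb2 indicator_def[of A])
      ultimately show ?thesis using a(3) by linarith
    qed
    have Bmm: "\<bar>measure mu B - (\<integral>z. b B z \<partial>mu)\<bar> \<le> d"
    proof -
      have "\<bar>\<integral>z. indicator B z - b B z \<partial>mu\<bar> \<le> (\<integral>z. \<bar>indicator B z - b B z\<bar> \<partial>mu)" by (rule integral_abs_bound)
      moreover have "(\<integral>z. indicator B z - b B z \<partial>mu) = measure mu B - (\<integral>z. b B z \<partial>mu)"
        using bnd[of "b B"] b1 Bt bnd[of "indicator B"]
        by (subst Bochner_Integration.integral_diff) (auto simp: Int_absorb2 indicator_def[of B])
      ultimately show ?thesis using b(3)[OF B] by linarith
    qed
    have prod: "\<bar>?m * (\<integral>z. b B z \<partial>mu) - measure mu A * measure mu B\<bar> \<le> 2 * d"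
    proof -
      have "\<bar>?m\<bar> \<le> 1" by (rule mu_integral_abs_le[OF ai b1(2)])
      then have "\<bar>?m * ((\<integral>z. b B z \<partial>mu) - measure mu B)\<bar> \<le> 1 * d"
        unfolding abs_mult using Bmm by (intro mult_mono) (auto simp: abs_minus_commute)
      moreover have "\<bar>(?m - measure mu A) * measure mu B\<bar> \<le> d * 1"
        unfolding abs_mult using Am d by (intro mult_mono) (auto simp: abs_minus_commute)
      moreover have "?m * (\<integral>z. b B z \<partial>mu) - measure mu A * measure mu B = ?m * ((\<integral>z. b B z \<partial>mu) - measure mu B) + (?m - measure mu A) * measure mu B"
        by (simp add: algebra_simps)
      ultimately show ?thesis by linarith
    qed
    have meas: "\<bar>measure mu (flow t -` A \<inter> B) - (\<integral>z. a (flow t z) * b B z \<partial>mu)\<bar> \<le> 2 * d" for t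
    proof -
      have "measure mu (flow t -` A \<inter> B) = (\<integral>z. indicator (flow t -` A \<inter> B) z \<partial>mu)"
        using Bt by (simp add: Int_absorb2 le_infI2)
      also have "\<dots> = (\<integral>z. indicator A (flow t z) * indicator B z \<partial>mu)"
        by (intro Bochner_Integration.integral_cong) (auto simp: indicator_def)
      finally have eq: "measure mu (flow t -` A \<inter> B) = \<dots>" .
      have I: "integrable mu (\<lambda>z. indicator A (flow t z) * indicator B z :: real)" "integrable mu (\<lambda>z. a (flow t z) * b B z)"
        by (rule bnd; simp add: indicator_def) (rule bnd; simp add: abs_mult b1 mult_le_one)
      have J: "integrable mu (\<lambda>z. \<bar>indicator A (flow t z) - a (flow t z)\<bar>)" "integrable mu (\<lambda>z. \<bar>indicator B z - b B z\<bar>)"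
      proof -
        show "integrable mu (\<lambda>z. \<bar>indicator A (flow t z) - a (flow t z)\<bar>)"
          by (rule bnd) (measurable, unfold abs_abs, intro i1 a(2))
        show "integrable mu (\<lambda>z. \<bar>indicator B z - b B z\<bar>)"
          by (rule bnd) (measurable, unfold abs_abs, intro i1 b(2)[OF B])
      qed
      have "\<bar>(\<integral>z. indicator A (flow t z) * indicator B z - a (flow t z) * b B z \<partial>mu)\<bar>
          \<le> (\<integral>z. \<bar>indicator A (flow t z) - a (flow t z)\<bar> + \<bar>indicator B z - b B z\<bar> \<partial>mu)"
      proof (rule order_trans[OF integral_abs_bound integral_mono])
        show "integrable mu (\<lambda>z. \<bar>indicator A (flow t z) * indicator B z - a (flow t z) * b B z\<bar>)"
          using I by (intro integrable_abs Bochner_Integration.integrable_diff)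
        show "integrable mu (\<lambda>z. \<bar>indicator A (flow t z) - a (flow t z)\<bar> + \<bar>indicator B z - b B z\<bar>)"
          using J by (intro Bochner_Integration.integrable_add)
        fix z
        have eq: "indicator A (flow t z) * indicator B z - a (flow t z) * b B z =
            (indicator A (flow t z) - a (flow t z)) * indicator B z + a (flow t z) * (indicator B z - b B z)"
          by (simp add: algebra_simps)
        have "\<bar>(indicator A (flow t z) - a (flow t z)) * indicator B z\<bar> \<le> \<bar>indicator A (flow t z) - a (flow t z)\<bar> * 1"
          unfolding abs_mult by (intro mult_left_mono) (auto simp: indicator_def)
        moreover have "\<bar>a (flow t z) * (indicator B z - b B z)\<bar> \<le> 1 * \<bar>indicator B z - b B z\<bar>"
          unfolding abs_mult using b1 by (intro mult_right_mono) auto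
        ultimately show "\<bar>indicator A (flow t z) * indicator B z - a (flow t z) * b B z\<bar> \<le> \<bar>indicator A (flow t z) - a (flow t z)\<bar> + \<bar>indicator B z - b B z\<bar>"
          unfolding eq mult_1_left mult_1_right by (rule order_trans[OF abs_triangle_ineq add_mono])
      qed
      also have "\<dots> = (\<integral>z. \<bar>indicator A (flow t z) - a (flow t z)\<bar> \<partial>mu) + (\<integral>z. \<bar>indicator B z - b B z\<bar> \<partial>mu)"
        using J by simp
      also have "(\<integral>z. \<bar>indicator A (flow t z) - a (flow t z)\<bar> \<partial>mu) = (\<integral>z. \<bar>indicator A z - a z\<bar> \<partial>mu)"
        by (rule inv[of "\<lambda>z. \<bar>indicator A z - a z\<bar>"]) simp
      finally show ?thesis unfolding eq using I a(3) b(3)[OF B] by simp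
    qed
    have "\<forall>\<^sub>F k in sequentially. \<bar>(\<integral>z. a (flow (2 * tau (s k)) z) * b B z \<partial>mu) - (\<integral>z. V M z * b B z \<partial>mu)\<bar> < d"
      using lim d unfolding tendsto_iff dist_real_def by blast
    then show ?thesis
    proof eventually_elim
      case (elim k)
      then show ?case using meas[of "2 * tau (s k)"] Vb prod d unfolding d_def by linarith
    qed
  qed
  then have "\<forall>\<^sub>F k in sequentially. \<forall>B\<in>\<B>. \<bar>measure mu (flow (2 * tau (s k)) -` A \<inter> B) - measure mu A * measure mu B\<bar> < e"
    using \<B>(1) by (simp add: eventually_ball_finite)
  then show ?thesis by (auto simp: eventually_sequentially)
qed

lemma weakly_mixing_flow: "weakly_mixing mu flow"
  by (rule weakly_mixing_from_mixing_times[OF prob_space_mu measure_preserving_flow_flow mixing_times])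

section \<open>Irreversibility\<close>

lemma pred_eq_torus:
  assumes f: "f \<in> M \<rightarrow>\<^sub>M torus_lebesgue" and g: "g \<in> M \<rightarrow>\<^sub>M torus_lebesgue"
  shows "Measurable.pred M (\<lambda>x. f x = g x)"
proof -
  have id: "(\<lambda>z. z) \<in> torus_lebesgue \<rightarrow>\<^sub>M (borel :: (complex \<times> complex) measure)"
    by (rule borel_measurable_continuous_torus) (rule continuous_on_id)
  note [measurable] = measurable_compose[OF f id] measurable_compose[OF g id]
  have "Measurable.pred M (\<lambda>x. dist (f x) (g x) = 0)" by measurable
  then show ?thesis by simp
qed

text \<open>Both points lie on one orbit, at a linear time \<open>s\<close> comparable with
  \<open>x - y\<close>. Either \<open>s\<close> is small, or by irrationality and compactness the
  points are at least \<open>m\<close> apart. The form linear in \<open>dist v w\<close> is made to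
  be integrated.\<close>

lemma flow_separation:
  assumes C: "C > 0" and e: "e > 0"
  obtains L where "L > 0" "\<And>x y v w. \<bar>x\<bar> \<le> C \<Longrightarrow> \<bar>y\<bar> \<le> C \<Longrightarrow> v \<in> torus \<Longrightarrow> w \<in> torus \<Longrightarrow>
     flow x v = flow y w \<Longrightarrow> \<bar>x - y\<bar> \<le> e + L * dist v w"
proof -
  define r where "r s = dist (torus_proj (slope * s, s)) (1, 1)" for s
  have rc: "continuous_on A r" for A
    unfolding r_def torus_proj_def by (intro continuous_intros)
  have r0: "r s > 0" if "s \<noteq> 0" for s
  proof (rule ccontr)
    assume "\<not> r s > 0"
    then have "torus_proj (slope * s, s) = (1, 1)" by (simp add: r_def)
    then have "cis (2 * pi * (slope * s)) = 1" "cis (2 * pi * s) = 1" by (simp_all add: torus_proj_def)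
    then obtain m n :: int where m: "2 * pi * (slope * s) = of_int m * (2 * pi)" and n: "2 * pi * s = of_int n * (2 * pi)"
      unfolding cis_conv_exp exp_eq_1 by auto
    have "slope * s = of_int m" "s = of_int n" using m n by simp_all
    then have "of_int n * slope + of_int (- m) = 0" by (simp add: mult.commute)
    from slope_irrational(1)[OF this] show False using \<open>s = of_int n\<close> that by simp
  qed
  \<comment> \<open>The linear times that are neither small nor excluded by the bound
    \<open>C\<close>; on this compact set the displacement \<open>r\<close> has a positive
    minimum.\<close>
  define A where "A = {s. e / 2 \<le> \<bar>s\<bar> \<and> \<bar>s\<bar> \<le> 4 * C}"
  have "A = {-(4 * C)..4 * C} - {- (e/2) <..< e/2}" by (auto simp: A_def)
  then have "compact A" by (simp add: compact_diff)
  obtain m where m: "m > 0" "\<And>s. s \<in> A \<Longrightarrow> m \<le> r s"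
  proof (cases "A = {}")
    case True
    then show ?thesis using that[of 1] by simp
  next
    case False
    then obtain s0 where s0: "s0 \<in> A" "\<And>s. s \<in> A \<Longrightarrow> r s0 \<le> r s"
      using continuous_attains_inf[OF \<open>compact A\<close> False rc] by blast
    have "s0 \<noteq> 0" using s0(1) e by (auto simp: A_def)
    then show ?thesis using that[of "r s0"] s0 r0 by blast
  qed
  show ?thesis
  proof (rule that[of "2 * C / m"])
    show "2 * C / m > 0" using C m by simp
    fix x y v w assume xy: "\<bar>x\<bar> \<le> C" "\<bar>y\<bar> \<le> C" and vw: "v \<in> torus" "w \<in> torus" and eq: "flow x v = flow y w"
    have "v = flow (- x) (flow y w)" using eq flow_cancel(1)[OF vw(1), of x] by simp
    also have "\<dots> = flow (y - x) w" using vw by (simp flip: flow_add)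
    finally have v: "v = lin (clock (y - x) w) w" by (simp add: flow_def)
    define s where "s = clock (y - x) w"
    have dr: "dist v w = r s" using v dist_lin[OF vw(2)] by (simp add: s_def r_def)
    have le: "\<bar>x - y\<bar> \<le> 2 * C" using xy by linarith
    have s1: "\<bar>s\<bar> \<le> 2 * \<bar>x - y\<bar>" using clock_lipschitz[OF vw(2), of "y - x" 0] vw by (simp add: s_def abs_minus_commute)
    have "\<bar>x - y\<bar> = \<bar>Phi s w - Phi 0 w\<bar>" using vw by (simp add: s_def abs_minus_commute)
    also have "\<dots> \<le> 3/2 * \<bar>s\<bar>" using Phi_lipschitz[OF vw(2), of s 0] by simp
    finally have s2: "\<bar>x - y\<bar> \<le> 3/2 * \<bar>s\<bar>" .
    show "\<bar>x - y\<bar> \<le> e + 2 * C / m * dist v w"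
    proof (cases "\<bar>s\<bar> < e / 2")
      case True
      moreover have "0 \<le> 2 * C / m * dist v w" using C m by simp
      ultimately show ?thesis using s2 e by linarith
    next
      case False
      then have "s \<in> A" using s1 le by (simp add: A_def)
      then have "2 * C / m * m \<le> 2 * C / m * dist v w"
        using m C unfolding dr by (intro mult_left_mono) auto
      then show ?thesis using le m e by simp
    qed
  qed
qed

text \<open>The time \<open>Phi t z\<close> depends on \<open>z\<close>, whereas the reversing
  relation is known almost everywhere at fixed times only. By Fubini it holds, for almost every
  \<open>z\<close>, at almost every time \<open>u\<close>, both at \<open>z\<close> and at
  \<open>lin t z\<close>; a common \<open>u\<close> is chosen and cancelled by the group
  law.\<close>

lemma reversal_along_lin:
  assumes S: "S \<in> mu \<rightarrow>\<^sub>M mu" and rev: "\<And>t. AE z in mu. flow t (S z) = S (flow (- t) z)"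
  shows "AE z in torus_lebesgue. flow (- t) (S z) = flow (Phi t z - t) (S (lin t z))"
proof -
  interpret pair_sigma_finite "lborel :: real measure" torus_lebesgue ..
  have Sm [measurable]: "S \<in> torus_lebesgue \<rightarrow>\<^sub>M torus_lebesgue" using S by (simp cong: measurable_cong_sets)
  have St: "S z \<in> torus" if "z \<in> torus" for z using measurable_space[OF Sm] that by simp
  have rev': "AE z in torus_lebesgue. flow u (S z) = S (flow (- u) z)" for u
    using rev[of u] by (simp add: AE_mu_iff)
  have swap: "AE z in torus_lebesgue. AE u in lborel. flow (u + c) (S z) = S (flow (- (u + c)) z)" for c
  proof -
    have "{p \<in> space (lborel \<Otimes>\<^sub>M torus_lebesgue). flow (fst p + c) (S (snd p)) = S (flow (- (fst p + c)) (snd p))}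
       \<in> sets (lborel \<Otimes>\<^sub>M torus_lebesgue)"
      unfolding pred_def[symmetric] by (rule pred_eq_torus) measurable
    from AE_commute[OF this] show ?thesis by (rule iffD1[OF _ AE_I2[OF rev']])
  qed
  have lm [measurable]: "lin t \<in> torus_lebesgue \<rightarrow>\<^sub>M torus_lebesgue" by measurable
  have dl: "distr torus_lebesgue torus_lebesgue (lin t) = torus_lebesgue"
    using distr_rot[of "torus_proj (slope * t, t)"] by (simp add: lin_def[abs_def])
  have "AE z in distr torus_lebesgue torus_lebesgue (lin t). AE u in lborel. flow (u + 0) (S z) = S (flow (- (u + 0)) z)"
    unfolding dl by (rule swap)
  from AE_distrD[OF lm this]
  have 1: "AE z in torus_lebesgue. AE u in lborel. flow u (S (lin t z)) = S (flow (- u) (lin t z))" by simp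
  have 2: "AE z in torus_lebesgue. AE u in lborel. flow (u - t) (S z) = S (flow (t - u) z)"
    using swap[of "- t"] by simp
  show ?thesis
    using 1 2 AE_space
  proof eventually_elim
    case (elim z)
    then have z: "z \<in> torus" by simp
    let ?x = "Phi t z - t"
    have zm [measurable]: "(\<lambda>_. lin t z) \<in> borel \<rightarrow>\<^sub>M torus_lebesgue" using z by simp
    have "Measurable.pred borel (\<lambda>u. flow u (S (lin t z)) = S (flow (- u) (lin t z)))"
      by (rule pred_eq_torus) measurable
    \<comment> \<open>Null sets of times are translation invariant, so the time may be shifted by
      the point-dependent \<open>?x\<close> once \<open>z\<close> is fixed.\<close>
    from AE_borel_affine[OF _ this elim(1), of 1 ?x]
    have "AE u in lborel. flow (?x + u) (S (lin t z)) = S (flow (- (?x + u)) (lin t z))" by simp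
    then have "AE u in lborel. flow (?x + u) (S (lin t z)) = S (flow (- (?x + u)) (lin t z)) \<and> flow (u - t) (S z) = S (flow (t - u) z)"
      using elim(2) by eventually_elim simp
    moreover have "ae_filter (lborel :: real measure) \<noteq> bot" by (simp add: ae_filter_eq_bot_iff)
    ultimately obtain u where u: "flow (?x + u) (S (lin t z)) = S (flow (- (?x + u)) (lin t z))" "flow (u - t) (S z) = S (flow (t - u) z)"
      using eventually_happens' by blast
    have "flow (- (?x + u)) (lin t z) = flow (- (?x + u) + Phi t z) z" by (simp only: flow_add[OF z] flow_Phi[OF z])
    then have "flow (u - t) (S z) = flow (u + ?x) (S (lin t z))" using u by (simp add: add.commute)
    then have "flow (- u) (flow (u + - t) (S z)) = flow (- u) (flow (u + ?x) (S (lin t z)))" by simp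
    then show ?case using z St by (simp flip: flow_add)
  qed
qed

lemma gap_deviation:
  fixes j :: real
  assumes j: "j \<in> \<int>" and z: "z \<in> torus" and n: "amp n = 1"
  shows "\<bar>Phi (j * tau n) z - j * tau n - gap j (chi n z)\<bar> \<le> 18 * pi * \<bar>j\<bar> * (1/2) ^ n"
    "\<bar>Phi (j * tau n) z - j * tau n\<bar> \<le> 24 * pi * \<bar>j\<bar>"
proof -
  show 1: "\<bar>Phi (j * tau n) z - j * tau n - gap j (chi n z)\<bar> \<le> 18 * pi * \<bar>j\<bar> * (1/2) ^ n"
    using Phi_tau[OF j z, of n] n by simp
  have "18 * pi * \<bar>j\<bar> * (1/2) ^ n \<le> 18 * pi * \<bar>j\<bar> * 1"
    by (intro mult_left_mono power_le_one) auto
  then show "\<bar>Phi (j * tau n) z - j * tau n\<bar> \<le> 24 * pi * \<bar>j\<bar>"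
    using 1 gap_bound[OF cmod_chi[OF z], of j n] by linarith
qed

text \<open>
  A reversing map \<open>S\<close> sends \<open>T\<^bsub>j \<tau>\<^esub> z\<close> to \<open>T\<^bsub>-j \<tau>\<^esub> (S z)\<close>. Both points are displaced along the
  orbit by a function of \<open>chi n\<close>, and since orbits have no approximate returns the displacements
  agree up to a small error in mean.
\<close>

lemma reversal_gap:
  fixes j :: real
  assumes S: "S \<in> mu \<rightarrow>\<^sub>M mu" and rev: "\<And>t. AE z in mu. flow t (S z) = S (flow (- t) z)"
    and j: "j \<in> \<int>" "j \<noteq> 0" and s: "\<And>k. amp (s k) = 1" "filterlim s at_top sequentially"
  shows "(\<lambda>k. \<integral>z. \<bar>gap j (chi (s k) z) + gap (- j) (chi (s k) (S z))\<bar> \<partial>torus_lebesgue) \<longlonglongrightarrow> 0"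
proof (rule LIMSEQ_I)
  fix e :: real assume e: "e > 0"
  have Sm [measurable]: "S \<in> torus_lebesgue \<rightarrow>\<^sub>M torus_lebesgue" using S by (simp cong: measurable_cong_sets)
  have St: "S z \<in> torus" if "z \<in> torus" for z using measurable_space[OF Sm] that by simp
  define C where "C = 24 * pi * \<bar>j\<bar>"
  have C: "C > 0" using j by (simp add: C_def)
  obtain L where L: "L > 0" "\<And>x y v w. \<bar>x\<bar> \<le> C \<Longrightarrow> \<bar>y\<bar> \<le> C \<Longrightarrow> v \<in> torus \<Longrightarrow> w \<in> torus \<Longrightarrow>
     flow x v = flow y w \<Longrightarrow> \<bar>x - y\<bar> \<le> e/2 + L * dist v w"
    using flow_separation[OF C, of "e/2"] e by auto
  have jm: "- j \<in> \<int>" using j by simp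
  define er where "er k = 18 * pi * \<bar>j\<bar> * (1/2) ^ s k" for k
  define rr where "rr k = dist (torus_proj (slope * (- j * tau (s k)), - j * tau (s k))) (1, 1)" for k
  define II where "II k = (\<integral>z. norm (S (lin (j * tau (s k)) z) - S z) \<partial>torus_lebesgue)" for k
  have idm: "(\<lambda>z. z) \<in> torus_lebesgue \<rightarrow>\<^sub>M (borel :: (complex \<times> complex) measure)"
    by (rule borel_measurable_continuous_torus) (rule continuous_on_id)
  note [measurable] = measurable_compose[OF _ idm]
  have nS: "norm z \<le> 2" if "z \<in> torus" for z
    using that norm_Pair_le[of "fst z" "snd z"] by (simp add: torus_iff)
  have Sb [measurable]: "S \<in> borel_measurable torus_lebesgue" using measurable_compose[OF Sm idm] .
  have Si: "integrable torus_lebesgue S"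
  proof (rule leb.integrable_const_bound[where B = 2])
    show "AE z in torus_lebesgue. norm (S z) \<le> 2" by (rule AE_I2) (simp add: nS St)
  qed simp
  have "(\<lambda>n. torus_proj (slope * (j * tau (s n)), j * tau (s n))) \<longlonglongrightarrow> (1, 1)"
    using filterlim_compose[OF torus_proj_tau_tendsto[OF j(1)] s(2)] .
  from rot_L1_continuous[OF Si _ this] have II: "II \<longlonglongrightarrow> 0" unfolding II_def lin_def by simp
  have rr: "rr \<longlonglongrightarrow> 0" unfolding rr_def using filterlim_compose[OF dist_lin_tau_tendsto[OF jm] s(2)] .
  have "(\<lambda>k. (1/2::real) ^ s k) \<longlonglongrightarrow> 0"
    using filterlim_compose[OF LIMSEQ_realpow_zero s(2), of "1/2"] by simp
  then have er: "er \<longlonglongrightarrow> 18 * pi * \<bar>j\<bar> * 0" unfolding er_def by (intro tendsto_intros)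
  have "(\<lambda>k. 2 * er k + L * (rr k + II k)) \<longlonglongrightarrow> 2 * (18 * pi * \<bar>j\<bar> * 0) + L * (0 + 0)"
    by (intro tendsto_intros er rr II)
  then have ev: "\<forall>\<^sub>F k in sequentially. 2 * er k + L * (rr k + II k) < e/2"
    using e by (intro order_tendstoD(2)[where y = 0]) auto
  have "\<forall>\<^sub>F k in sequentially. (\<integral>z. \<bar>gap j (chi (s k) z) + gap (- j) (chi (s k) (S z))\<bar> \<partial>torus_lebesgue) < e"
    using ev
  proof eventually_elim
    case (elim k)
    let ?n = "s k" let ?t = "j * real (tau (s k))"
    define D where "D z = norm (S (lin ?t z) - S z)" for z
    have Di: "integrable torus_lebesgue D"
      unfolding D_def using Si integrable_rot[OF torus_proj_in_torus Si, of "(slope * ?t, ?t)"]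
      by (intro integrable_norm Bochner_Integration.integrable_diff) (simp_all add: lin_def)
    have ae: "AE z in torus_lebesgue. \<bar>gap j (chi ?n z) + gap (- j) (chi ?n (S z))\<bar> \<le> 2 * er k + (e/2 + L * (rr k + D z))"
      using reversal_along_lin[OF S rev, of ?t] AE_space
    proof eventually_elim
      case (elim z)
      then have z: "z \<in> torus" and Sz: "S z \<in> torus" using St by auto
      \<comment> \<open>\<open>?x\<close> is close to \<open>gap j (chi n z)\<close> and
        \<open>?y\<close> to \<open>- gap (- j) (chi n (S z))\<close>, so separating the two times
        bounds the sum of the gaps.\<close>
      let ?x = "Phi ?t z - ?t" and ?y = "- ?t - Phi (- ?t) (S z)"
      have x: "\<bar>?x - gap j (chi ?n z)\<bar> \<le> er k" "\<bar>?x\<bar> \<le> C"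
        using gap_deviation[OF j(1) z s(1)[of k]] by (simp_all add: er_def C_def)
      have y: "\<bar>?y + gap (- j) (chi ?n (S z))\<bar> \<le> er k" "\<bar>?y\<bar> \<le> C"
        using gap_deviation[OF jm Sz s(1)[of k]] unfolding er_def C_def by (simp_all add: abs_minus_commute add.commute)
      have eq: "flow ?y (lin (- ?t) (S z)) = flow ?x (S (lin ?t z))"
        using elim flow_via_lin[OF Sz, of "- ?t"] by simp
      have "\<bar>?y - ?x\<bar> \<le> e/2 + L * dist (lin (- ?t) (S z)) (S (lin ?t z))"
        by (rule L(2)[OF y(2) x(2) _ _ eq]) (use z Sz St in auto)
      also have "dist (lin (- ?t) (S z)) (S (lin ?t z)) \<le> dist (lin (- ?t) (S z)) (S z) + dist (S z) (S (lin ?t z))"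
        by (rule dist_triangle)
      also have "\<dots> = rr k + D z" unfolding dist_lin[OF Sz] by (simp add: rr_def D_def dist_norm norm_minus_commute)
      finally have "\<bar>?y - ?x\<bar> \<le> e/2 + L * (rr k + D z)" using L(1) by simp
      then show ?case using x(1) y(1) by linarith
    qed
    have "(\<integral>z. \<bar>gap j (chi ?n z) + gap (- j) (chi ?n (S z))\<bar> \<partial>torus_lebesgue) \<le> (\<integral>z. 2 * er k + (e/2 + L * (rr k + D z)) \<partial>torus_lebesgue)"
    proof (rule integral_mono_AE)
      have gm: "(\<lambda>z. gap i (chi ?n (f z))) \<in> borel_measurable torus_lebesgue" if "f \<in> torus_lebesgue \<rightarrow>\<^sub>M torus_lebesgue" for f i
        by (rule measurable_compose[OF that])
           (intro borel_measurable_continuous_torus continuous_on_compose2[OF continuous_gap[of UNIV]] continuous_chi; simp)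
      have "\<bar>gap j (chi ?n z) + gap (- j) (chi ?n (S z))\<bar> \<le> 12 * pi * \<bar>j\<bar>" if "z \<in> torus" for z
        using gap_bound[OF cmod_chi[OF that], of j ?n] gap_bound[OF cmod_chi[OF St[OF that]], of "- j" ?n] by simp
      then show "integrable torus_lebesgue (\<lambda>z. \<bar>gap j (chi ?n z) + gap (- j) (chi ?n (S z))\<bar>)"
        using gm[OF measurable_ident_sets[OF refl], of j] gm[OF Sm, of "- j"]
        by (intro leb.integrable_const_bound[where B = "12 * pi * \<bar>j\<bar>"] AE_I2) simp_all
      show "integrable torus_lebesgue (\<lambda>z. 2 * er k + (e/2 + L * (rr k + D z)))"
        using Di by simp
    qed (rule ae)
    also have "\<dots> = 2 * er k + (e/2 + L * (rr k + II k))"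
      using Di leb.prob_space by (simp add: II_def D_def[symmetric])
    finally show ?case using elim by simp
  qed
  then show "\<exists>k0. \<forall>k\<ge>k0. norm ((\<integral>z. \<bar>gap j (chi (s k) z) + gap (- j) (chi (s k) (S z))\<bar> \<partial>torus_lebesgue) - 0) < e"
    by (auto simp: eventually_sequentially)
qed

text \<open>
  If \<open>x\<^sub>1\<close>, \<open>x\<^sub>2\<close> are the displacements at the times \<open>\<tau>\<close>, \<open>2\<tau>\<close>, this is \<open>x y (x - y)\<close> for the two
  successive increments \<open>x = x\<^sub>1\<close>, \<open>y = x\<^sub>2 - x\<^sub>1\<close>; it is antisymmetric under their exchange.
\<close>

definition asym :: "real \<Rightarrow> real \<Rightarrow> real" where
  "asym x y = x * (y - x) * (2 * x - y)"

lemma asym_lipschitz: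
  assumes "\<bar>x\<bar> \<le> B" "\<bar>y\<bar> \<le> B" "\<bar>x'\<bar> \<le> B" "\<bar>y'\<bar> \<le> B"
  shows "\<bar>asym x y - asym x' y'\<bar> \<le> 36 * B\<^sup>2 * (\<bar>x - x'\<bar> + \<bar>y - y'\<bar>)"
proof -
  let ?d = "\<bar>x - x'\<bar> + \<bar>y - y'\<bar>"
  have B: "B \<ge> 0" using assms by linarith
  have eq: "asym x y - asym x' y' = (x - x') * (y - x) * (2 * x - y) + x' * ((y - x) - (y' - x')) * (2 * x - y)
     + x' * (y' - x') * ((2 * x - y) - (2 * x' - y'))"
    by (simp add: asym_def algebra_simps)
  have "\<bar>(x - x') * (y - x) * (2 * x - y)\<bar> \<le> ?d * (2 * B) * (3 * B)"
    unfolding abs_mult using assms B by (intro mult_mono) auto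
  moreover have "\<bar>x' * ((y - x) - (y' - x')) * (2 * x - y)\<bar> \<le> B * ?d * (3 * B)"
    unfolding abs_mult using assms B by (intro mult_mono) auto
  moreover have "\<bar>x' * (y' - x') * ((2 * x - y) - (2 * x' - y'))\<bar> \<le> B * (2 * B) * (2 * ?d)"
    unfolding abs_mult
  proof (intro mult_mono)
    show "\<bar>(2 * x - y) - (2 * x' - y')\<bar> \<le> 2 * ?d"
    proof -
      have "\<bar>2 * (x - x') - (y - y')\<bar> \<le> 2 * \<bar>x - x'\<bar> + \<bar>y - y'\<bar>"
        using abs_triangle_ineq4[of "2 * (x - x')" "y - y'"] by (simp only: abs_mult abs_numeral)
      also have "\<dots> \<le> 2 * ?d" by simp
      also have "2 * (x - x') - (y - y') = (2 * x - y) - (2 * x' - y')" by simp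
      finally show ?thesis .
    qed
  qed (use assms B in auto)
  moreover have "?d * (2 * B) * (3 * B) + B * ?d * (3 * B) + B * (2 * B) * (2 * ?d) = 13 * B\<^sup>2 * ?d"
    by (simp add: power2_eq_square algebra_simps)
  moreover have "13 * B\<^sup>2 * ?d \<le> 36 * B\<^sup>2 * ?d" by (intro mult_right_mono) auto
  ultimately show ?thesis unfolding eq by linarith
qed

text \<open>The second pair consists of the increments read backwards from the same phase. Up to a
  half turn it is the first pair with its increments exchanged, so the mean over the circle is twice
  that of \<open>asym\<close> on the forward pair.\<close>

definition asym_diff :: "complex \<Rightarrow> real" where
  "asym_diff u = asym (gap 1 u) (gap 2 u) - asym (- gap (-1) u) (- gap (-2) u)"

text \<open>Everything reduces to a cubic polynomial in \<open>cos (4 * pi * r)\<close>, linearised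
  here by the multiple-angle formulas so that the mean can be read off as the constant term.\<close>

lemma asym_diff_cis:
  "asym_diff (cis (2 * pi * r)) = 32 * cos (4 * pi * r) - 8 - 8 * cos (8 * pi * r) + 8 * cos (12 * pi * r)"
proof -
  define x where "x = 2 * pi * r"
  have h: "hcirc (cis (2 * pi * r) * cis (2 * pi * (j / 4))) = hfun (r + j / 4)" for j
    by (simp only: cis_mult distrib_left[symmetric] hcirc_cis)
  have arg: "2 * pi * (r + j / 4) = x + j * (pi / 2)" "4 * pi * (r + j / 4) = 2 * x + j * pi" for j
    by (simp_all add: x_def field_simps)
  have h0: "hcirc (cis (2 * pi * r)) = cos x + cos (2 * x)" unfolding hcirc_cis hfun_def x_def by (simp add: mult.assoc)
  have g1: "gap 1 (cis (2 * pi * r)) = - sin x - cos x - 2 * cos (2 * x)"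
    unfolding gap_def h h0 hfun_def arg by (simp add: cos_add)
  have g2: "gap 2 (cis (2 * pi * r)) = - 2 * cos x"
    unfolding gap_def h h0 hfun_def arg by (simp add: cos_add)
  have g3: "gap (-1) (cis (2 * pi * r)) = sin x - cos x - 2 * cos (2 * x)"
    unfolding gap_def h h0 hfun_def arg by (simp add: cos_add cos_diff)
  have g4: "gap (-2) (cis (2 * pi * r)) = - 2 * cos x"
    unfolding gap_def h h0 hfun_def arg by (simp add: cos_add cos_diff)
  define K where "K = cos (2 * x)"
  have s2: "(sin x)\<^sup>2 = (1 - K) / 2" and c2: "(cos x)\<^sup>2 = (1 + K) / 2"
    using cos_double_sin[of x] cos_double_cos[of x] by (simp_all add: K_def field_simps)
  have "asym_diff (cis (2 * pi * r)) = 24 * (sin x)\<^sup>2 * K + 32 * K ^ 3 - 8 * (cos x)\<^sup>2 * K"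
    unfolding asym_diff_def g1 g2 g3 g4 asym_def K_def[symmetric]
    by (simp add: power2_eq_square power3_eq_cube algebra_simps)
  also have "\<dots> = 8 * K - 16 * K\<^sup>2 + 32 * K ^ 3"
    unfolding s2 c2 by (simp add: power2_eq_square power3_eq_cube field_simps)
  also have "\<dots> = 32 * cos (4 * pi * r) - 8 - 8 * cos (8 * pi * r) + 8 * cos (12 * pi * r)"
  proof -
    have a: "4 * pi * r = 2 * x" "8 * pi * r = 2 * (2 * x)" "12 * pi * r = 3 * (2 * x)" by (simp_all add: x_def)
    show ?thesis unfolding a cos_double_cos[of "2 * x"] cos_treble_cos[of "2 * x"] K_def[symmetric]
      by (simp add: algebra_simps)
  qed
  finally show ?thesis .
qed

lemma integral_asym_diff: "(LINT r:{0..1}|lborel. asym_diff (cis (2 * pi * r))) = - 8"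
proof -
  define P where "P r = 8 / pi * sin (4 * pi * r) - 8 * r - 1 / pi * sin (8 * pi * r) + 2 / (3 * pi) * sin (12 * pi * r)" for r :: real
  have "(P has_real_derivative asym_diff (cis (2 * pi * r))) (at r)" for r
    unfolding P_def asym_diff_cis by (auto intro!: derivative_eq_intros simp: field_simps)
  moreover have "isCont (\<lambda>r. asym_diff (cis (2 * pi * r))) r" for r
    unfolding asym_diff_cis by (intro continuous_intros)
  ultimately have "(LBINT r. asym_diff (cis (2 * pi * r)) * indicator {0..1} r) = P 1 - P 0"
    by (intro integral_FTC_Icc_real) auto
  moreover have "P 1 = - 8" "P 0 = 0"
  proof -
    have "sin (4 * pi) = 0" "sin (8 * pi) = 0" "sin (12 * pi) = 0"
      using sin_npi[of 4] sin_npi[of 8] sin_npi[of 12] by simp_all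
    then show "P 1 = - 8" "P 0 = 0" by (simp_all add: P_def)
  qed
  ultimately show ?thesis by (simp add: set_lebesgue_integral_def mult.commute)
qed

lemma continuous_asym_gap: "continuous_on A (\<lambda>u. asym (gap i u) (gap j u))"
  "continuous_on A (\<lambda>u. asym (- gap i u) (- gap j u))"
  unfolding asym_def by (intro continuous_intros continuous_gap)+

text \<open>The mean of \<open>FX - FY\<close> along indices with amplitude 1 would tend to 0 by
  reversal of the gaps for \<open>j = 1\<close> and \<open>j = 2\<close>, whereas equidistribution
  gives the limit \<open>- 8\<close>.\<close>

lemma not_reversible_flow: "\<not> reversible mu flow"
proof
  assume "reversible mu flow"
  then obtain S where imp: "invertible_measure_preserving mu S" and rev: "\<And>t. AE z in mu. flow t (S z) = S (flow (- t) z)"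
    unfolding reversible_def by blast
  have S: "S \<in> mu \<rightarrow>\<^sub>M mu" and dS: "distr mu mu S = mu"
    using imp by (auto simp: invertible_measure_preserving_def measure_preserving_def)
  have Sm [measurable]: "S \<in> torus_lebesgue \<rightarrow>\<^sub>M torus_lebesgue" using S by (simp cong: measurable_cong_sets)
  have St: "S z \<in> torus" if "z \<in> torus" for z using measurable_space[OF Sm] that by simp
  obtain s where s: "\<And>k. amp (s k) = real 1" "filterlim s at_top sequentially"
    using amp_subsequence by blast
  have s1: "amp (s k) = 1" for k using s(1) by simp
  define G1 where "G1 k z = \<bar>gap 1 (chi (s k) z) + gap (- 1) (chi (s k) (S z))\<bar>" for k z
  define G2 where "G2 k z = \<bar>gap 2 (chi (s k) z) + gap (- 2) (chi (s k) (S z))\<bar>" for k z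
  have L1: "(\<lambda>k. \<integral>z. G1 k z \<partial>torus_lebesgue) \<longlonglongrightarrow> 0"
    unfolding G1_def by (rule reversal_gap[OF S rev _ _ s1 s(2)]) auto
  have L2: "(\<lambda>k. \<integral>z. G2 k z \<partial>torus_lebesgue) \<longlonglongrightarrow> 0"
    unfolding G2_def by (rule reversal_gap[OF S rev _ _ s1 s(2)]) auto
  define B where "B = 12 * pi"
  have gb: "\<bar>gap j (chi n z)\<bar> \<le> B" if "z \<in> torus" "\<bar>j\<bar> \<le> 2" for j n z
  proof -
    have "\<bar>gap j (chi n z)\<bar> \<le> 6 * pi * \<bar>j\<bar>" by (rule gap_bound[OF cmod_chi[OF that(1)]])
    also have "\<dots> \<le> 6 * pi * 2" using that(2) by (intro mult_left_mono) auto
    finally show ?thesis by (simp add: B_def)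
  qed
  define FX where "FX n z = asym (gap 1 (chi n z)) (gap 2 (chi n z))" for n z
  define FY where "FY n z = asym (- gap (-1) (chi n z)) (- gap (-2) (chi n z))" for n z
  have FXc: "continuous_on torus (FX n)" and FYc: "continuous_on torus (FY n)" for n
    unfolding FX_def FY_def
    using continuous_on_compose2[OF continuous_asym_gap(1)[of UNIV] continuous_chi]
      continuous_on_compose2[OF continuous_asym_gap(2)[of UNIV] continuous_chi] by auto
  have FYm [measurable]: "FY n \<in> borel_measurable torus_lebesgue" for n
    using FYc by (rule borel_measurable_continuous_torus)
  have gm [measurable]: "(\<lambda>z. gap i (chi n z)) \<in> borel_measurable torus_lebesgue" for i n
    by (intro borel_measurable_continuous_torus continuous_on_compose2[OF continuous_gap[of UNIV]] continuous_chi) simp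
  note [measurable] = measurable_compose[OF Sm gm]
  have Gi: "integrable torus_lebesgue (G1 k)" "integrable torus_lebesgue (G2 k)" for k
  proof -
    have le: "\<bar>\<bar>gap i (chi (s k) z) + gap j (chi (s k) (S z))\<bar>\<bar> \<le> 2 * B" if "z \<in> torus" "\<bar>i\<bar> \<le> 2" "\<bar>j\<bar> \<le> 2" for z i j
      using gb[OF that(1,2), of "s k"] gb[OF St[OF that(1)] that(3), of "s k"] by linarith
    have "\<bar>G1 k z\<bar> \<le> 2 * B" "\<bar>G2 k z\<bar> \<le> 2 * B" if "z \<in> torus" for z
      unfolding G1_def G2_def by (rule le[OF that]; simp)+
    moreover have "G1 k \<in> borel_measurable torus_lebesgue" "G2 k \<in> borel_measurable torus_lebesgue"
      unfolding G1_def G2_def by measurable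
    ultimately show "integrable torus_lebesgue (G1 k)" "integrable torus_lebesgue (G2 k)"
      by (auto intro!: leb.integrable_const_bound[where B = "2 * B"] AE_I2)
  qed
  have FXi: "integrable mu (FX n)" and FYi: "integrable mu (FY n)" for n
    by (rule integrable_mu_continuous[OF FXc], rule integrable_mu_continuous[OF FYc])
  have FYS: "(\<integral>z. FY n (S z) \<partial>mu) = (\<integral>z. FY n z \<partial>mu)" for n
    using integral_distr[OF S, of "FY n"] by (simp add: dS)
  have FYSi: "integrable mu (\<lambda>z. FY n (S z))" for n
    using integrable_distr[OF S, of "FY n"] FYi by (simp add: dS)
  have bound: "\<bar>(\<integral>z. FX (s k) z - FY (s k) z \<partial>mu)\<bar> \<le> 3/2 * (36 * B\<^sup>2 * ((\<integral>z. G1 k z \<partial>torus_lebesgue) + (\<integral>z. G2 k z \<partial>torus_lebesgue)))" for k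
  proof -
    let ?n = "s k"
    have Ii: "integrable torus_lebesgue (\<lambda>z. 36 * B\<^sup>2 * (G1 k z + G2 k z))" using Gi by simp
    \<comment> \<open>\<open>S\<close> preserves \<open>mu\<close>, so \<open>FY\<close> may be
      composed with \<open>S\<close>; after that the arguments of \<open>asym\<close> nearly agree
      in mean.\<close>
    have "(\<integral>z. FX ?n z - FY ?n z \<partial>mu) = (\<integral>z. FX ?n z - FY ?n (S z) \<partial>mu)"
      using FXi[of ?n] FYi[of ?n] FYSi[of ?n] FYS[of ?n] by simp
    also have "\<bar>\<dots>\<bar> \<le> (\<integral>z. 36 * B\<^sup>2 * (G1 k z + G2 k z) \<partial>mu)"
    proof (rule order_trans[OF integral_abs_bound integral_mono'])
      show "integrable mu (\<lambda>z. 36 * B\<^sup>2 * (G1 k z + G2 k z))"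
      proof -
        have "integrable torus_lebesgue (\<lambda>z. phi z * (36 * B\<^sup>2 * (G1 k z + G2 k z)))"
        proof (rule Bochner_Integration.integrable_bound[OF integrable_mult_right[OF Ii, of "3/2"]])
          show "AE z in torus_lebesgue. norm (phi z * (36 * B\<^sup>2 * (G1 k z + G2 k z))) \<le> norm (3/2 * (36 * B\<^sup>2 * (G1 k z + G2 k z)))"
          proof (rule AE_I2)
            fix z assume "z \<in> space torus_lebesgue"
            then have "\<bar>phi z\<bar> \<le> \<bar>3/2\<bar>" using phi_bounds[of z] by simp
            then show "norm (phi z * (36 * B\<^sup>2 * (G1 k z + G2 k z))) \<le> norm (3/2 * (36 * B\<^sup>2 * (G1 k z + G2 k z)))"
              unfolding abs_mult[of "phi z"] abs_mult[of "3/2"] real_norm_def by (rule mult_right_mono) simp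
          qed
        qed (use Gi in simp)
        then show ?thesis unfolding mu_def using Gi
          by (subst integrable_real_density) (auto simp: phi_nonneg)
      qed
      show "\<bar>FX ?n z - FY ?n (S z)\<bar> \<le> 36 * B\<^sup>2 * (G1 k z + G2 k z)" if "z \<in> space mu" for z
      proof -
        have z: "z \<in> torus" using that by simp
        show ?thesis unfolding FX_def FY_def
          using asym_lipschitz[of "gap 1 (chi ?n z)" B "gap 2 (chi ?n z)" "- gap (-1) (chi ?n (S z))" "- gap (-2) (chi ?n (S z))"]
            gb[OF z, of _ ?n] gb[OF St[OF z], of _ ?n] by (simp add: G1_def G2_def)
      qed
    qed (auto simp: G1_def G2_def)
    also have "\<dots> \<le> 3/2 * (\<integral>z. 36 * B\<^sup>2 * (G1 k z + G2 k z) \<partial>torus_lebesgue)"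
      by (rule integral_mu_le[OF Ii]) (auto simp: G1_def G2_def)
    finally show ?thesis using Gi by simp
  qed
  define bd where "bd k = 3/2 * (36 * B\<^sup>2 * ((\<integral>z. G1 k z \<partial>torus_lebesgue) + (\<integral>z. G2 k z \<partial>torus_lebesgue)))" for k
  have "bd \<longlonglongrightarrow> 3/2 * (36 * B\<^sup>2 * (0 + 0))"
    unfolding bd_def by (intro tendsto_intros L1 L2)
  then have bd0: "bd \<longlonglongrightarrow> 0" by simp
  have Z: "(\<lambda>k. \<integral>z. FX (s k) z - FY (s k) z \<partial>mu) \<longlonglongrightarrow> 0"
    by (rule Lim_null_comparison[OF _ bd0], rule always_eventually)
       (use bound in \<open>simp only: bd_def real_norm_def\<close>, blast)
  have "continuous_on (torus \<times> sphere 0 1) (\<lambda>p. asym_diff (snd p))"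
    unfolding asym_diff_def
    by (intro continuous_on_diff continuous_on_compose2[OF continuous_asym_gap(1)[of UNIV]] continuous_on_compose2[OF continuous_asym_gap(2)[of UNIV]]
        continuous_on_snd continuous_on_id) auto
  from equidistribution_chi[OF this s(2)]
  have "(\<lambda>k. \<integral>z. FX (s k) z - FY (s k) z \<partial>mu) \<longlonglongrightarrow> - 8"
    using mu.prob_space by (simp add: asym_diff_def[of "chi _ _"] FX_def FY_def integral_asym_diff)
  from LIMSEQ_unique[OF Z this] show False by simp
qed

section \<open>Power series of separately holomorphic functions\<close>

lemma has_sum_mult_Times:
  fixes f :: "'i \<Rightarrow> 'a :: {real_normed_field, banach}"
  assumes f: "(f has_sum F) A" "(\<lambda>x. norm (f x)) summable_on A"
    and g: "(g has_sum G) B" "(\<lambda>x. norm (g x)) summable_on B"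
  shows "((\<lambda>(x, y). f x * g y) has_sum F * G) (A \<times> B)"
    and "(\<lambda>(x, y). norm (f x * g y)) summable_on A \<times> B"
proof -
  obtain G' where G': "((\<lambda>x. norm (g x)) has_sum G') B" using g(2) by (auto simp: summable_on_def)
  have "(\<lambda>p. norm (f (fst p) * g (snd p))) summable_on A \<times> B"
  proof (rule summable_on_SigmaI)
    show "((\<lambda>y. norm (f (fst (x, y)) * g (snd (x, y)))) has_sum norm (f x) * G') B" for x
      using has_sum_cmult_right[OF G'] by (simp add: norm_mult)
    show "(\<lambda>x. norm (f x) * G') summable_on A"
      using f(2) by (rule summable_on_cmult_left)
  qed simp
  then show s: "(\<lambda>(x, y). norm (f x * g y)) summable_on A \<times> B" by (simp add: case_prod_unfold)
  have "((\<lambda>p. f (fst p) * g (snd p)) has_sum F * G) (A \<times> B)"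
  proof (rule has_sum_SigmaI)
    show "((\<lambda>y. f (fst (x, y)) * g (snd (x, y))) has_sum f x * G) B" for x
      using has_sum_cmult_right[OF g(1)] by simp
    show "((\<lambda>x. f x * G) has_sum F * G) A" using f(1) by (rule has_sum_cmult_left)
    show "(\<lambda>p. f (fst p) * g (snd p)) summable_on A \<times> B"
      by (rule abs_summable_summable) (rule s[unfolded case_prod_unfold])
  qed
  then show "((\<lambda>(x, y). f x * g y) has_sum F * G) (A \<times> B)" by (simp add: case_prod_unfold)
qed

lemma has_sum_geometric:
  fixes z :: "'a :: {real_normed_field, banach}"
  assumes "norm z < 1"
  shows "((\<lambda>n. z ^ n) has_sum (1 / (1 - z))) UNIV" "(\<lambda>n. norm (z ^ n)) summable_on UNIV"
proof -
  have s: "summable (\<lambda>n. norm (z ^ n))" using assms by (simp add: norm_power summable_geometric)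
  then show "((\<lambda>n. z ^ n) has_sum (1 / (1 - z))) UNIV"
    using geometric_sums[OF assms] by (rule norm_summable_imp_has_sum)
  have "summable (\<lambda>n. norm (norm (z ^ n)))" using s by simp
  then show "(\<lambda>n. norm (z ^ n)) summable_on UNIV" by (rule norm_summable_imp_summable_on)
qed

lemma has_sum_geometric3:
  fixes x y z :: "'a :: {real_normed_field, banach}"
  assumes "norm x < 1" "norm y < 1" "norm z < 1"
  shows "((\<lambda>(i, j, k). x ^ i * (y ^ j * z ^ k)) has_sum (1 / (1 - x)) * ((1 / (1 - y)) * (1 / (1 - z)))) UNIV"
    and "(\<lambda>(i, j, k). norm x ^ i * (norm y ^ j * norm z ^ k)) summable_on UNIV"
proof -
  note yz = has_sum_mult_Times[OF has_sum_geometric[OF assms(2)] has_sum_geometric[OF assms(3)]]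
  have s: "(\<lambda>p. norm (case p of (j, k) \<Rightarrow> y ^ j * z ^ k)) summable_on UNIV"
    using yz(2) by (simp add: case_prod_unfold)
  note xyz = has_sum_mult_Times[OF has_sum_geometric[OF assms(1)] yz(1)[unfolded UNIV_Times_UNIV] s]
  show "((\<lambda>(i, j, k). x ^ i * (y ^ j * z ^ k)) has_sum (1 / (1 - x)) * ((1 / (1 - y)) * (1 / (1 - z)))) UNIV"
    using xyz(1) by (simp add: case_prod_unfold)
  show "(\<lambda>(i, j, k). norm x ^ i * (norm y ^ j * norm z ^ k)) summable_on UNIV"
    using xyz(2) by (simp add: case_prod_unfold norm_mult norm_power)
qed

text \<open>The majorant \<open>b\<close> gives uniform convergence along the net of finite subsets,
  so the unordered sum may be integrated termwise.\<close>

lemma has_sum_integral_unit: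
  fixes g :: "'i \<Rightarrow> real \<Rightarrow> complex"
  assumes le: "\<And>i t. t \<in> {0..1} \<Longrightarrow> norm (g i t) \<le> b i" and b: "b summable_on UNIV"
    and g: "\<And>t. t \<in> {0..1} \<Longrightarrow> ((\<lambda>i. g i t) has_sum G t) UNIV"
    and cont: "\<And>i. continuous_on {0..1} (g i)"
  shows "((\<lambda>i. integral {0..1} (g i)) has_sum integral {0..1} G) UNIV"
proof -
  have "uniform_limit {0..1} (\<lambda>X t. \<Sum>i\<in>X. g i t) G (finite_subsets_at_top UNIV)"
    by (rule Weierstrass_m_test_general'[OF _ _ b]) (use le g in auto)
  then obtain I J where IJ: "\<And>X. ((\<lambda>t. \<Sum>i\<in>X. g i t) has_integral I X) {0..1}" "(G has_integral J) {0..1}"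
      "(I \<longlongrightarrow> J) (finite_subsets_at_top UNIV)"
    unfolding box_real(2)[symmetric]
    by (rule uniform_limit_integral_cbox) (auto intro!: continuous_on_sum cont)
  have gi: "g i integrable_on {0..1}" for i using cont by (rule integrable_continuous_interval)
  have "I X = (\<Sum>i\<in>X. integral {0..1} (g i))" for X
    using integral_unique[OF IJ(1)[of X]] by (cases "finite X") (simp_all add: integral_sum gi)
  then show ?thesis
    using IJ(3) unfolding has_sum_def integral_unique[OF IJ(2)] by presburger
qed

section \<open>Separately holomorphic functions on a polydisc\<close>

abbreviation polydisc :: "real \<Rightarrow> (complex \<times> complex \<times> complex) set" where
  "polydisc r \<equiv> cball 0 r \<times> cball 0 r \<times> cball 0 r"

text \<open>Joint continuity on the closed polydisc together with holomorphy in each variable is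
  what the iterated Cauchy formula consumes, and both pass to uniform limits slice by slice.\<close>

definition separately_holomorphic :: "real \<Rightarrow> (complex \<times> complex \<times> complex \<Rightarrow> complex) \<Rightarrow> bool" where
  "separately_holomorphic r f \<longleftrightarrow> continuous_on (polydisc r) f \<and>
     (\<forall>b\<in>cball 0 r. \<forall>c\<in>cball 0 r. (\<lambda>a. f (a, b, c)) holomorphic_on ball 0 r) \<and>
     (\<forall>a\<in>cball 0 r. \<forall>c\<in>cball 0 r. (\<lambda>b. f (a, b, c)) holomorphic_on ball 0 r) \<and>
     (\<forall>a\<in>cball 0 r. \<forall>b\<in>cball 0 r. (\<lambda>c. f (a, b, c)) holomorphic_on ball 0 r)"

text \<open>On a circle around 0 the measure \<open>du / (2 * pi * \<i> * u)\<close> is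
  \<open>dt\<close> on the unit interval; the remaining kernel is the sum of a geometric series in
  \<open>w / u\<close>.\<close>

lemma Cauchy_integral_unit:
  assumes g: "continuous_on (cball 0 r) g" "g holomorphic_on ball 0 r" and w: "w \<in> ball 0 r"
  shows "((\<lambda>t. g (circlepath 0 r t) * (1 / (1 - w / circlepath 0 r t))) has_integral g w) {0..1}"
proof -
  have r: "r > 0" using w by (auto intro: le_less_trans[OF norm_ge_zero])
  have "((\<lambda>u. g u / (u - w)) has_contour_integral (2 * of_real pi * \<i> * g w)) (circlepath 0 r)"
    using w by (intro Cauchy_integral_circlepath g) simp
  then have "((\<lambda>t. g (circlepath 0 r t) / (circlepath 0 r t - w) * vector_derivative (circlepath 0 r) (at t within {0..1}))
      has_integral (2 * of_real pi * \<i> * g w)) {0..1}"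
    by (simp add: has_contour_integral_def)
  from has_integral_mult_right[OF this, of "1 / (2 * of_real pi * \<i>)"]
  have "((\<lambda>t. 1 / (2 * of_real pi * \<i>) * (g (circlepath 0 r t) / (circlepath 0 r t - w) * vector_derivative (circlepath 0 r) (at t within {0..1})))
      has_integral g w) {0..1}" by simp
  then show ?thesis
  proof (rule has_integral_eq[rotated])
    fix t :: real assume t: "t \<in> {0..1}"
    have "vector_derivative (circlepath 0 r) (at t within {0..1}) = 2 * of_real pi * \<i> * circlepath 0 r t"
      using vector_derivative_circlepath01[of t 0 r] t by (simp add: circlepath)
    moreover have n: "cmod (circlepath 0 r t) = r" using r by (simp add: circlepath norm_mult)
    then have "circlepath 0 r t \<noteq> 0" "circlepath 0 r t \<noteq> w" using r w by auto
    ultimately show "1 / (2 * of_real pi * \<i>) * (g (circlepath 0 r t) / (circlepath 0 r t - w) * vector_derivative (circlepath 0 r) (at t within {0..1})) =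
        g (circlepath 0 r t) * (1 / (1 - w / circlepath 0 r t))"
      by (simp add: field_simps)
  qed
qed

text \<open>
  The iterated Cauchy formula, with the three kernels expanded into geometric series.
\<close>

lemma separately_holomorphic_expansion:
  assumes f: "separately_holomorphic r f" and r: "r > 0"
  obtains coef :: "nat \<times> nat \<times> nat \<Rightarrow> complex" where
    "\<And>a b c. a \<in> ball 0 r \<Longrightarrow> b \<in> ball 0 r \<Longrightarrow> c \<in> ball 0 r \<Longrightarrow>
      ((\<lambda>(i, j, k). (a ^ i * (b ^ j * c ^ k)) * coef (i, j, k)) has_sum f (a, b, c)) UNIV"
proof -
  define u where "u = circlepath 0 r"
  have un: "cmod (u t) = r" for t using r by (simp add: u_def circlepath norm_mult)
  have u0: "u t \<noteq> 0" for t using un[of t] r by auto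
  have uc: "continuous_on A u" for A unfolding u_def circlepath by (intro continuous_intros)
  have ub: "u t \<in> cball 0 r" for t by (simp add: un)
  have fc: "continuous_on (polydisc r) f" using f by (simp add: separately_holomorphic_def)
  have "bounded (f ` polydisc r)" by (intro compact_imp_bounded compact_continuous_image fc compact_Times compact_cball)
  then obtain B where B: "\<And>p. p \<in> polydisc r \<Longrightarrow> cmod (f p) \<le> B" unfolding bounded_iff by blast
  have tri: "continuous_on A (\<lambda>p. f (u (fst (fst p)), u (snd (fst p)), u (snd p)))" for A
    by (rule continuous_on_compose2[OF fc])
       (use ub in \<open>auto intro!: continuous_intros continuous_on_compose2[OF uc[of UNIV]]\<close>)
  define m where "m = (\<lambda>(i, j, k) t1 t2 t3. 1 / (u t1 ^ i * (u t2 ^ j * u t3 ^ k)))"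
  define coef where "coef \<alpha> = integral {0..1} (\<lambda>t1. integral {0..1} (\<lambda>t2. integral {0..1} (\<lambda>t3. f (u t1, u t2, u t3) * m \<alpha> t1 t2 t3)))" for \<alpha>
  show ?thesis
  proof (rule that[of coef])
    fix a b c :: complex assume abc: "a \<in> ball 0 r" "b \<in> ball 0 r" "c \<in> ball 0 r"
    define K where "K w t = 1 / (1 - w / u t)" for w t
    define x where "x = (\<lambda>(i, j, k). a ^ i * (b ^ j * c ^ k))"
    define g where "g \<alpha> t1 t2 t3 = x \<alpha> * (f (u t1, u t2, u t3) * m \<alpha> t1 t2 t3)" for \<alpha> t1 t2 t3
    define bd where "bd = (\<lambda>(i, j, k). B * ((cmod a / r) ^ i * ((cmod b / r) ^ j * (cmod c / r) ^ k)))"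
    have small: "norm (w / u t) < 1" if "w \<in> ball 0 r" for w t
      using that un[of t] r by (simp add: norm_divide)
    have "(\<lambda>(i, j, k). norm (cmod a / r) ^ i * (norm (cmod b / r) ^ j * norm (cmod c / r) ^ k)) summable_on UNIV"
      by (rule has_sum_geometric3(2)) (use abc r in auto)
    from summable_on_cmult_right[OF this, of B]
    have bds: "bd summable_on UNIV" using r by (simp add: bd_def case_prod_unfold)
    have gle: "norm (g \<alpha> t1 t2 t3) \<le> bd \<alpha>" for \<alpha> t1 t2 t3
    proof -
      obtain i j k where \<alpha>: "\<alpha> = (i, j, k)" by (cases \<alpha>)
      have "norm (g \<alpha> t1 t2 t3) = cmod (f (u t1, u t2, u t3)) * ((cmod a / r) ^ i * ((cmod b / r) ^ j * (cmod c / r) ^ k))"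
        by (simp add: g_def \<alpha> x_def m_def norm_mult norm_divide norm_power un power_divide)
      also have "\<dots> \<le> B * ((cmod a / r) ^ i * ((cmod b / r) ^ j * (cmod c / r) ^ k))"
        by (intro mult_right_mono B mult_nonneg_nonneg zero_le_power) (use ub r in auto)
      finally show ?thesis by (simp add: bd_def \<alpha>)
    qed
    have gsum: "((\<lambda>\<alpha>. g \<alpha> t1 t2 t3) has_sum f (u t1, u t2, u t3) * (K a t1 * (K b t2 * K c t3))) UNIV" for t1 t2 t3
    proof -
      have "g \<alpha> t1 t2 t3 = f (u t1, u t2, u t3) * (case \<alpha> of (i, j, k) \<Rightarrow> (a / u t1) ^ i * ((b / u t2) ^ j * (c / u t3) ^ k))" for \<alpha>
        by (cases \<alpha>) (simp add: g_def x_def m_def power_divide)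
      then show ?thesis unfolding K_def
        using has_sum_cmult_right[OF has_sum_geometric3(1)[OF small[OF abc(1), of t1] small[OF abc(2), of t2] small[OF abc(3), of t3]], of "f (u t1, u t2, u t3)"]
        by simp
    qed
    have gcont: "continuous_on A (\<lambda>p. g \<alpha> (fst (fst p)) (snd (fst p)) (snd p))" for \<alpha> A
    proof -
      obtain i j k where \<alpha>: "\<alpha> = (i, j, k)" by (cases \<alpha>)
      have "continuous_on A (\<lambda>p. u (fst (fst p)))" "continuous_on A (\<lambda>p. u (snd (fst p)))" "continuous_on A (\<lambda>p. u (snd p))"
        by (rule continuous_on_compose2[OF uc[of UNIV]], intro continuous_intros, simp)+
      note uu = this
      show ?thesis unfolding g_def \<alpha> m_def split
        by (intro continuous_on_mult continuous_on_const tri continuous_on_divide continuous_on_power uu) (simp add: u0)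
    qed
    define g2 where "g2 \<alpha> t1 t2 = integral {0..1} (g \<alpha> t1 t2)" for \<alpha> t1 t2
    define g1 where "g1 \<alpha> t1 = integral {0..1} (g2 \<alpha> t1)" for \<alpha> t1
    have g2cont: "continuous_on A (\<lambda>p. g2 \<alpha> (fst p) (snd p))" for \<alpha> A
      unfolding g2_def box_real(2)[symmetric]
      by (rule integral_continuous_on_param) (use gcont in \<open>simp add: case_prod_unfold\<close>)
    have g1cont: "continuous_on A (g1 \<alpha>)" for \<alpha> A
      unfolding g1_def box_real(2)[symmetric]
      by (rule integral_continuous_on_param) (use g2cont in \<open>simp add: case_prod_unfold\<close>)
    have slice: "continuous_on A (g \<alpha> t1 t2)" "continuous_on A (g2 \<alpha> t1)" for \<alpha> t1 t2 A
    proof -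
      show "continuous_on A (g \<alpha> t1 t2)"
        using continuous_on_compose2[OF gcont[of UNIV \<alpha>] continuous_on_Pair[OF continuous_on_const[of A "(t1, t2)"] continuous_on_id]] by simp
      show "continuous_on A (g2 \<alpha> t1)"
        using continuous_on_compose2[OF g2cont[of UNIV \<alpha>] continuous_on_Pair[OF continuous_on_const[of A t1] continuous_on_id]] by simp
    qed
    have int_le: "norm (integral {0..1} h) \<le> C" if "continuous_on {0..1} h" "\<And>t. norm (h t) \<le> C" for h :: "real \<Rightarrow> complex" and C
      using integral_bound[of 0 1 h C] that by simp
    have g2le: "norm (g2 \<alpha> t1 t2) \<le> bd \<alpha>" for \<alpha> t1 t2
      unfolding g2_def by (intro int_le slice gle)
    have g1le: "norm (g1 \<alpha> t1) \<le> bd \<alpha>" for \<alpha> t1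
      unfolding g1_def by (intro int_le slice g2le)
    have hol: "continuous_on (cball 0 r) (\<lambda>a. f (a, b, c))" "(\<lambda>a. f (a, b, c)) holomorphic_on ball 0 r"
       "continuous_on (cball 0 r) (\<lambda>b. f (a, b, c))" "(\<lambda>b. f (a, b, c)) holomorphic_on ball 0 r"
       "continuous_on (cball 0 r) (\<lambda>c. f (a, b, c))" "(\<lambda>c. f (a, b, c)) holomorphic_on ball 0 r"
      if "a \<in> cball 0 r" "b \<in> cball 0 r" "c \<in> cball 0 r" for a b c
      using f that unfolding separately_holomorphic_def
      by (auto intro!: continuous_on_compose2[OF fc] continuous_intros)
    have bc: "b \<in> cball 0 r" "c \<in> cball 0 r" using abc by auto
    \<comment> \<open>The variables are integrated out from the last to the first: the series passes
      under the integral, and Cauchy's formula evaluates its sum.\<close>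
    have "((\<lambda>\<alpha>. g2 \<alpha> t1 t2) has_sum integral {0..1} (\<lambda>t3. f (u t1, u t2, u t3) * (K a t1 * (K b t2 * K c t3)))) UNIV" for t1 t2
      unfolding g2_def by (rule has_sum_integral_unit[OF gle bds gsum slice(1)])
    moreover have "integral {0..1} (\<lambda>t3. f (u t1, u t2, u t3) * (K a t1 * (K b t2 * K c t3))) = f (u t1, u t2, c) * (K a t1 * K b t2)" for t1 t2
    proof -
      have "((\<lambda>t3. f (u t1, u t2, u t3) * K c t3) has_integral f (u t1, u t2, c)) {0..1}"
        unfolding K_def u_def by (rule Cauchy_integral_unit[OF _ _ abc(3)]) (use hol(5,6)[OF ub ub bc(2)] in \<open>auto simp: u_def\<close>)
      from has_integral_mult_left[OF this, of "K a t1 * K b t2"] show ?thesis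
        by (intro integral_unique) (simp add: mult_ac)
    qed
    ultimately have s2: "((\<lambda>\<alpha>. g2 \<alpha> t1 t2) has_sum f (u t1, u t2, c) * (K a t1 * K b t2)) UNIV" for t1 t2 by simp
    have "((\<lambda>\<alpha>. g1 \<alpha> t1) has_sum integral {0..1} (\<lambda>t2. f (u t1, u t2, c) * (K a t1 * K b t2))) UNIV" for t1
      unfolding g1_def by (rule has_sum_integral_unit[OF g2le bds s2 slice(2)])
    moreover have "integral {0..1} (\<lambda>t2. f (u t1, u t2, c) * (K a t1 * K b t2)) = f (u t1, b, c) * K a t1" for t1
    proof -
      have "((\<lambda>t2. f (u t1, u t2, c) * K b t2) has_integral f (u t1, b, c)) {0..1}"
        unfolding K_def u_def by (rule Cauchy_integral_unit[OF _ _ abc(2)]) (use hol(3,4)[OF ub bc(1) bc(2)] in \<open>auto simp: u_def\<close>)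
      from has_integral_mult_left[OF this, of "K a t1"] show ?thesis
        by (intro integral_unique) (simp add: mult_ac)
    qed
    ultimately have s1: "((\<lambda>\<alpha>. g1 \<alpha> t1) has_sum f (u t1, b, c) * K a t1) UNIV" for t1 by simp
    have "((\<lambda>\<alpha>. integral {0..1} (g1 \<alpha>)) has_sum integral {0..1} (\<lambda>t1. f (u t1, b, c) * K a t1)) UNIV"
      by (rule has_sum_integral_unit[OF g1le bds s1 g1cont])
    moreover have "integral {0..1} (\<lambda>t1. f (u t1, b, c) * K a t1) = f (a, b, c)"
      unfolding K_def u_def
      by (rule integral_unique[OF Cauchy_integral_unit[OF _ _ abc(1)]]) (use hol(1,2)[OF bc(1) bc] in auto)
    moreover have "integral {0..1} (g1 \<alpha>) = x \<alpha> * coef \<alpha>" for \<alpha>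
      by (simp add: g1_def[abs_def] g2_def[abs_def] g_def[abs_def] coef_def)
    ultimately have "((\<lambda>\<alpha>. x \<alpha> * coef \<alpha>) has_sum f (a, b, c)) UNIV" by simp
    then show "((\<lambda>(i, j, k). (a ^ i * (b ^ j * c ^ k)) * coef (i, j, k)) has_sum f (a, b, c)) UNIV"
      by (simp add: x_def case_prod_unfold)
  qed
qed

lemma has_sum_Pair:
  fixes f :: "'i \<Rightarrow> 'a :: real_normed_vector" and g :: "'i \<Rightarrow> 'b :: real_normed_vector"
  assumes "(f has_sum F) A" "(g has_sum G) A"
  shows "((\<lambda>x. (f x, g x)) has_sum (F, G)) A"
proof -
  have "((\<lambda>x. (f x, 0) + (0, g x)) has_sum (F, 0) + (0, G)) A"
    by (intro has_sum_add has_sum_bounded_linear[OF bounded_linear_Pair[OF bounded_linear_ident bounded_linear_zero] assms(1)]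
        has_sum_bounded_linear[OF bounded_linear_Pair[OF bounded_linear_zero bounded_linear_ident] assms(2)])
  then show ?thesis by simp
qed

text \<open>The extension need agree with \<open>f\<close> only at real points near the base point;
  its power series, restricted to real increments, is the required expansion, with both components
  sharing one index set.\<close>

lemma real_analytic_from_extension:
  fixes f :: "real \<times> real \<times> real \<Rightarrow> complex \<times> complex"
  assumes extension: "\<And>t x y. \<exists>r>0. \<exists>F G. separately_holomorphic r F \<and> separately_holomorphic r G \<and>
     (\<forall>a b c. \<bar>a\<bar> < r \<longrightarrow> \<bar>b\<bar> < r \<longrightarrow> \<bar>c\<bar> < r \<longrightarrow>
        f (t + a, x + b, y + c) = (F (of_real a, of_real b, of_real c), G (of_real a, of_real b, of_real c)))"
  shows "real_analytic f"
  unfolding real_analytic_def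
proof
  fix p :: "real \<times> real \<times> real"
  obtain t x y where p: "p = (t, x, y)" by (cases p)
  obtain r F G where r: "r > 0" and F: "separately_holomorphic r F" and G: "separately_holomorphic r G"
    and eq: "\<And>a b c. \<bar>a\<bar> < r \<Longrightarrow> \<bar>b\<bar> < r \<Longrightarrow> \<bar>c\<bar> < r \<Longrightarrow>
        f (t + a, x + b, y + c) = (F (of_real a, of_real b, of_real c), G (of_real a, of_real b, of_real c))"
    using extension[of t x y] by blast
  obtain cF where cF: "\<And>a b c. a \<in> ball 0 r \<Longrightarrow> b \<in> ball 0 r \<Longrightarrow> c \<in> ball 0 r \<Longrightarrow>
      ((\<lambda>(i, j, k). (a ^ i * (b ^ j * c ^ k)) * cF (i, j, k)) has_sum F (a, b, c)) UNIV"
    using separately_holomorphic_expansion[OF F r] by blast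
  obtain cG where cG: "\<And>a b c. a \<in> ball 0 r \<Longrightarrow> b \<in> ball 0 r \<Longrightarrow> c \<in> ball 0 r \<Longrightarrow>
      ((\<lambda>(i, j, k). (a ^ i * (b ^ j * c ^ k)) * cG (i, j, k)) has_sum G (a, b, c)) UNIV"
    using separately_holomorphic_expansion[OF G r] by blast
  let ?e1 = "(1, 0, 0) :: real \<times> real \<times> real" and ?e2 = "(0, 1, 0) :: real \<times> real \<times> real" and ?e3 = "(0, 0, 1) :: real \<times> real \<times> real"
  have Basis: "(Basis :: (real \<times> real \<times> real) set) = {?e1, ?e2, ?e3}"
    by (auto simp: Basis_prod_def zero_prod_def)
  \<comment> \<open>An extensional multi-index is determined by its three values on
    \<open>Basis\<close>, so sums can be reindexed by triples.\<close>
  define J :: "((real \<times> real \<times> real) \<Rightarrow> nat) \<Rightarrow> nat \<times> nat \<times> nat" where "J \<alpha> = (\<alpha> ?e1, \<alpha> ?e2, \<alpha> ?e3)" for \<alpha>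
  have bij: "bij_betw J (Basis \<rightarrow>\<^sub>E UNIV) UNIV"
  proof (rule bij_betwI[where g = "\<lambda>(i, j, k). \<lambda>b\<in>Basis. if b = ?e1 then i else if b = ?e2 then j else k"])
    show "(case J \<alpha> of (i, j, k) \<Rightarrow> \<lambda>b\<in>Basis. if b = ?e1 then i else if b = ?e2 then j else k) = \<alpha>"
      if "\<alpha> \<in> Basis \<rightarrow>\<^sub>E UNIV" for \<alpha>
    proof (rule ext)
      fix b :: "real \<times> real \<times> real"
      show "(case J \<alpha> of (i, j, k) \<Rightarrow> \<lambda>b\<in>Basis. if b = ?e1 then i else if b = ?e2 then j else k) b = \<alpha> b"
      proof (cases "b \<in> Basis")
        case True
        then have "b = ?e1 \<or> b = ?e2 \<or> b = ?e3" by (simp only: Basis insert_iff empty_iff simp_thms)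
        then show ?thesis using True by (elim disjE) (simp_all add: J_def)
      next
        case False
        then show ?thesis using PiE_arb[OF that False] by (simp add: J_def)
      qed
    qed
    show "J \<in> (Basis \<rightarrow>\<^sub>E UNIV) \<rightarrow> UNIV" by simp
    show "(\<lambda>(i, j, k). \<lambda>b\<in>Basis. if b = ?e1 then i else if b = ?e2 then j else k) \<in> UNIV \<rightarrow> (Basis \<rightarrow>\<^sub>E UNIV)"
      by (rule funcsetI) (simp add: case_prod_unfold)
    have "?e1 \<in> Basis" "?e2 \<in> Basis" "?e3 \<in> Basis" unfolding Basis by simp_all
    then show "J (case v of (i, j, k) \<Rightarrow> \<lambda>b\<in>Basis. if b = ?e1 then i else if b = ?e2 then j else k) = v" for v
      by (cases v) (simp add: J_def)
  qed
  show "\<exists>r>0. \<exists>c. \<forall>q\<in>ball p r. ((\<lambda>\<alpha>. (\<Prod>b\<in>Basis. ((q - p) \<bullet> b) ^ \<alpha> b) *\<^sub>R c \<alpha>) has_sum f q) (Basis \<rightarrow>\<^sub>E UNIV)"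
  proof (intro exI[of _ r] conjI r exI[of _ "\<lambda>\<alpha>. (cF (J \<alpha>), cG (J \<alpha>))"] ballI)
    fix q assume q: "q \<in> ball p r"
    obtain a b c where abc: "q - p = (a, b, c)" by (cases "q - p")
    have n: "norm (a, b, c) < r" using q unfolding mem_ball dist_norm norm_minus_commute[of p] abc .
    \<comment> \<open>The Euclidean ball lies in the polydisc of the same radius.\<close>
    have "\<bar>a\<bar> \<le> norm (a, b, c)" "norm (b, c) \<le> norm (a, b, c)" "\<bar>b\<bar> \<le> norm (b, c)" "\<bar>c\<bar> \<le> norm (b, c)"
      using norm_fst_le[of a "(b, c)"] norm_snd_le[of "(b, c)" a] norm_fst_le[of b c] norm_snd_le[of c b] by simp_all
    then have lt: "\<bar>a\<bar> < r" "\<bar>b\<bar> < r" "\<bar>c\<bar> < r" using n by linarith+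
    have "q = (t + a, x + b, y + c)" using arg_cong[OF abc, of "\<lambda>v. v + p"] p by (simp add: add.commute)
    then have fq: "f q = (F (of_real a, of_real b, of_real c), G (of_real a, of_real b, of_real c))"
      using eq[OF lt] by simp
    have ball: "of_real a \<in> ball (0::complex) r" "of_real b \<in> ball (0::complex) r" "of_real c \<in> ball (0::complex) r"
      using lt by simp_all
    define h where "h = (\<lambda>(i, j, k). (a ^ i * (b ^ j * c ^ k)) *\<^sub>R (cF (i, j, k), cG (i, j, k)))"
    have "(h has_sum f q) UNIV"
      unfolding fq h_def using has_sum_Pair[OF cF[OF ball] cG[OF ball]]
      by (simp add: case_prod_unfold scaleR_conv_of_real)
    then have "((\<lambda>\<alpha>. h (J \<alpha>)) has_sum f q) (Basis \<rightarrow>\<^sub>E UNIV)"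
      using has_sum_reindex_bij_betw[OF bij] by blast
    moreover have "h (J \<alpha>) = (\<Prod>b\<in>Basis. ((q - p) \<bullet> b) ^ \<alpha> b) *\<^sub>R (cF (J \<alpha>), cG (J \<alpha>))" for \<alpha>
      by (simp add: h_def J_def abc Basis)
    ultimately show "((\<lambda>\<alpha>. (\<Prod>b\<in>Basis. ((q - p) \<bullet> b) ^ \<alpha> b) *\<^sub>R (cF (J \<alpha>), cG (J \<alpha>))) has_sum f q) (Basis \<rightarrow>\<^sub>E UNIV)"
      by simp
  qed
qed

section \<open>Analyticity of the flow\<close>

lemma separately_holomorphic_const: "separately_holomorphic r (\<lambda>_. c)"
  by (simp add: separately_holomorphic_def)

lemma separately_holomorphic_coords:
  "separately_holomorphic r fst" "separately_holomorphic r (\<lambda>p. fst (snd p))" "separately_holomorphic r (\<lambda>p. snd (snd p))"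
  unfolding separately_holomorphic_def by (auto intro!: continuous_intros holomorphic_intros)

lemma separately_holomorphic_add:
  "separately_holomorphic r f \<Longrightarrow> separately_holomorphic r g \<Longrightarrow> separately_holomorphic r (\<lambda>p. f p + g p)"
  unfolding separately_holomorphic_def by (auto intro!: continuous_on_add holomorphic_on_add)

lemma separately_holomorphic_cmult:
  "separately_holomorphic r f \<Longrightarrow> separately_holomorphic r (\<lambda>p. c * f p)"
  unfolding separately_holomorphic_def by (auto intro!: continuous_on_mult holomorphic_on_mult)

lemma separately_holomorphic_diff:
  assumes "separately_holomorphic r f" "separately_holomorphic r g"
  shows "separately_holomorphic r (\<lambda>p. f p - g p)"
  using separately_holomorphic_add[OF assms(1) separately_holomorphic_cmult[OF assms(2), of "-1"]] by simp

lemma separately_holomorphic_sum: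
  "(\<And>i. i \<in> I \<Longrightarrow> separately_holomorphic r (f i)) \<Longrightarrow> separately_holomorphic r (\<lambda>p. \<Sum>i\<in>I. f i p)"
  by (induction I rule: infinite_finite_induct)
     (auto intro: separately_holomorphic_const separately_holomorphic_add)

lemma separately_holomorphic_compose:
  assumes f: "separately_holomorphic r f" and g: "g holomorphic_on UNIV"
  shows "separately_holomorphic r (\<lambda>p. g (f p))"
proof -
  have "continuous_on UNIV g" using g by (rule holomorphic_on_imp_continuous_on)
  then have "continuous_on (polydisc r) (\<lambda>p. g (f p))"
    by (rule continuous_on_compose2) (use f in \<open>auto simp: separately_holomorphic_def\<close>)
  moreover have "(\<lambda>x. g (h x)) holomorphic_on A" if "h holomorphic_on A" for h A
    using holomorphic_on_compose_gen[OF that g] by (simp add: o_def)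
  ultimately show ?thesis using f by (simp add: separately_holomorphic_def)
qed

text \<open>The one-variable theorem on uniform limits of holomorphic functions, applied to every
  coordinate slice.\<close>

lemma separately_holomorphic_limit:
  assumes F: "\<And>n. separately_holomorphic r (F n)" and lim: "uniform_limit (polydisc r) F G sequentially"
  shows "separately_holomorphic r G"
proof -
  have slice: "(\<lambda>x. G (s x)) holomorphic_on ball 0 r"
    if s: "s ` cball 0 r \<subseteq> polydisc r" "continuous_on (cball 0 r) s" "\<And>n. (\<lambda>x. F n (s x)) holomorphic_on ball 0 r" for s
  proof -
    have ul: "uniform_limit (cball 0 r) (\<lambda>n x. F n (s x)) (\<lambda>x. G (s x)) sequentially"
    proof (rule uniform_limitI)
      fix e :: real assume "e > 0"
      from uniform_limitD[OF lim this] show "\<forall>\<^sub>F n in sequentially. \<forall>x\<in>cball 0 r. dist (F n (s x)) (G (s x)) < e"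
        by eventually_elim (use s(1) in blast)
    qed
    have "continuous_on (cball 0 r) (\<lambda>x. F n (s x))" for n
      by (rule continuous_on_compose2[OF _ s(2,1)]) (use F[of n] in \<open>simp add: separately_holomorphic_def\<close>)
    then have "\<forall>\<^sub>F n in sequentially. continuous_on (cball 0 r) (\<lambda>x. F n (s x)) \<and> (\<lambda>x. F n (s x)) holomorphic_on ball 0 r"
      using s(3) by simp
    then show ?thesis by (rule holomorphic_uniform_limit[OF _ ul trivial_limit_sequentially])
  qed
  have "continuous_on (polydisc r) G"
    by (rule uniform_limit_theorem[OF _ lim]) (use F in \<open>auto simp: separately_holomorphic_def\<close>)
  moreover have "(\<lambda>a. G (a, b, c)) holomorphic_on ball 0 r" if "b \<in> cball 0 r" "c \<in> cball 0 r" for b c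
    by (rule slice, use that in force, intro continuous_on_Pair continuous_on_id continuous_on_const)
       (use F that in \<open>simp add: separately_holomorphic_def\<close>)
  moreover have "(\<lambda>b. G (a, b, c)) holomorphic_on ball 0 r" if "a \<in> cball 0 r" "c \<in> cball 0 r" for a c
    by (rule slice, use that in force, intro continuous_on_Pair continuous_on_id continuous_on_const)
       (use F that in \<open>simp add: separately_holomorphic_def\<close>)
  moreover have "(\<lambda>c. G (a, b, c)) holomorphic_on ball 0 r" if "a \<in> cball 0 r" "b \<in> cball 0 r" for a b
    by (rule slice, use that in force, intro continuous_on_Pair continuous_on_id continuous_on_const)
       (use F that in \<open>simp add: separately_holomorphic_def\<close>)
  ultimately show ?thesis by (simp add: separately_holomorphic_def)
qed

section \<open>Complexification of the time change\<close>

definition hcx :: "complex \<Rightarrow> complex" where "hcx w = cos (2 * of_real pi * w) + cos (4 * of_real pi * w)"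

lemma hcx_of_real: "hcx (of_real w) = of_real (hfun w)"
proof -
  have "2 * complex_of_real pi * of_real w = of_real (2 * pi * w)" "4 * complex_of_real pi * of_real w = of_real (4 * pi * w)"
    by simp_all
  then show ?thesis by (simp only: hcx_def hfun_def cos_of_real of_real_add)
qed

lemma norm_sin_le: "cmod (sin z) \<le> exp \<bar>Im z\<bar>"
proof -
  have "cmod (sin z) = cmod (exp (\<i> * z) - exp (- (\<i> * z))) / 2"
    by (simp add: sin_exp_eq norm_divide norm_mult)
  also have "\<dots> \<le> (cmod (exp (\<i> * z)) + cmod (exp (- (\<i> * z)))) / 2"
    by (intro divide_right_mono norm_triangle_ineq4) auto
  also have "\<dots> \<le> (exp \<bar>Im z\<bar> + exp \<bar>Im z\<bar>) / 2"
    by (intro divide_right_mono add_mono) (auto simp: norm_exp_eq_Re)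
  finally show ?thesis by simp
qed

text \<open>The strip is convex, so a derivative bound suffices; its growth is that of the second
  harmonic.\<close>

lemma hcx_lipschitz:
  assumes "\<bar>Im v\<bar> \<le> B" "\<bar>Im w\<bar> \<le> B"
  shows "cmod (hcx v - hcx w) \<le> 6 * pi * exp (4 * pi * B) * cmod (v - w)"
proof -
  define d where "d w = - 2 * of_real pi * (sin (2 * of_real pi * w) + 2 * sin (4 * of_real pi * w))" for w :: complex
  have B: "B \<ge> 0" using assms(1) by linarith
  have "{w. \<bar>Im w\<bar> \<le> B} = {w. Im w \<le> B} \<inter> {w. Im w \<ge> -B}" by auto
  then have "convex {w. \<bar>Im w\<bar> \<le> B}" by (simp add: convex_Int convex_halfspace_Im_le convex_halfspace_Im_ge)
  moreover have "(hcx has_field_derivative d w) (at w within S)" for w S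
    unfolding hcx_def[abs_def] d_def by (auto intro!: derivative_eq_intros simp: algebra_simps)
  moreover have "cmod (d w) \<le> 6 * pi * exp (4 * pi * B)" if "w \<in> {w. \<bar>Im w\<bar> \<le> B}" for w
  proof -
    have 1: "cmod (sin (2 * of_real pi * w)) \<le> exp (4 * pi * B)"
    proof (rule order_trans[OF norm_sin_le])
      have "\<bar>Im (2 * of_real pi * w)\<bar> = 2 * pi * \<bar>Im w\<bar>" by (simp add: abs_mult)
      also have "\<dots> \<le> 4 * pi * B" using that B by (intro mult_mono) auto
      finally show "exp \<bar>Im (2 * of_real pi * w)\<bar> \<le> exp (4 * pi * B)" by simp
    qed
    have 2: "cmod (sin (4 * of_real pi * w)) \<le> exp (4 * pi * B)"
    proof (rule order_trans[OF norm_sin_le])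
      have "\<bar>Im (4 * of_real pi * w)\<bar> = 4 * pi * \<bar>Im w\<bar>" by (simp add: abs_mult)
      also have "\<dots> \<le> 4 * pi * B" using that by (intro mult_left_mono) auto
      finally show "exp \<bar>Im (4 * of_real pi * w)\<bar> \<le> exp (4 * pi * B)" by simp
    qed
    have "cmod (d w) = 2 * pi * cmod (sin (2 * of_real pi * w) + 2 * sin (4 * of_real pi * w))"
      by (simp add: d_def norm_mult)
    also have "\<dots> \<le> 2 * pi * (cmod (sin (2 * of_real pi * w)) + cmod (2 * sin (4 * of_real pi * w)))"
      by (intro mult_left_mono norm_triangle_ineq) auto
    also have "\<dots> \<le> 2 * pi * (exp (4 * pi * B) + 2 * exp (4 * pi * B))"
      using 1 2 by (intro mult_left_mono add_mono) (auto simp: norm_mult)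
    finally show ?thesis by simp
  qed
  ultimately show ?thesis
    by (rule field_differentiable_bound) (use assms in auto)
qed

text \<open>From \<open>16 * pi \<le> 52\<close> and \<open>exp 1 \<le> 4\<close>, which give the
  exponent \<open>2 * 52 = 104\<close>.\<close>

lemma exp_den_le: "exp (16 * pi * den m) \<le> 2 ^ (104 * den m)"
proof -
  have "16 * pi * den m \<le> real (52 * den m)" using pi_less_4 pi_approx(2) by (simp add: mult_right_mono)
  then have "exp (16 * pi * den m) \<le> exp (real (52 * den m))" by simp
  also have "\<dots> = exp 1 ^ (52 * den m)" by (simp add: exp_of_nat_mult[of "52 * den m" 1, simplified])
  also have "\<dots> \<le> 4 ^ (52 * den m)" using exp_le by (intro power_mono) auto
  also have "\<dots> = 2 ^ (104 * den m)" using power_mult[of "2::real" 2 "52 * den m"] by (simp add: mult.assoc[symmetric])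
  finally show ?thesis .
qed

text \<open>The growth \<open>2 ^ (104 * den m)\<close> of the complexified phase is paid out of the
  decay \<open>(1/2) ^ (200 * den m)\<close>; the remainder still beats the weights used on the real
  line.\<close>

lemma amp_drift_exp: "6 * pi * exp (4 * pi * (4 * den m)) * (amp m * drift m) \<le> 1/4 * (1/2) ^ m"
proof -
  have "exp (4 * pi * (4 * den m)) * (amp m * drift m) \<le> 2 ^ (104 * den m) * (1/2) ^ (200 * den m)"
  proof (intro mult_mono)
    show "exp (4 * pi * (4 * den m)) \<le> 2 ^ (104 * den m)" using exp_den_le[of m] by (simp add: mult_ac)
  qed (simp_all add: amp_drift_le less_imp_le)
  also have "\<dots> = 2 ^ (104 * den m) * ((1/2) ^ (104 * den m) * (1/2) ^ (96 * den m))"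
    by (simp add: power_add[symmetric])
  also have "\<dots> = (1/2) ^ (96 * den m)" by (simp add: power_divide)
  also have "\<dots> \<le> (1/2) ^ (m + 7)" using den_gt[of m] by (intro power_decreasing) auto
  finally have "6 * pi * (exp (4 * pi * (4 * den m)) * (amp m * drift m)) \<le> 6 * pi * (1/2) ^ (m + 7)"
    by (intro mult_left_mono) auto
  also have "\<dots> \<le> 24 * (1/2) ^ (m + 7)" using pi_less_4 by (intro mult_right_mono) auto
  also have "\<dots> \<le> 1/4 * (1/2) ^ m" by (simp add: power_add power_divide field_simps)
  finally show ?thesis by (simp add: mult_ac)
qed

definition psi_term :: "nat \<Rightarrow> complex \<Rightarrow> complex \<Rightarrow> complex \<Rightarrow> complex" where
  "psi_term m s x y = of_real (amp m) *
     (hcx (of_real (den m) * x - of_real (num m) * y + of_real (drift m) * s) - hcx (of_real (den m) * x - of_real (num m) * y))"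

definition psi :: "complex \<Rightarrow> complex \<Rightarrow> complex \<Rightarrow> complex" where
  "psi s x y = (\<Sum>m. psi_term m s x y)"

lemma drift_le_1: "drift m \<le> 1"
proof -
  have "1 / (2 * real (tau m)) \<le> 1" using tau_ge[of m] den_gt[of m] by simp
  then show ?thesis using drift_le[of m] by linarith
qed

lemma psi_term_lipschitz:
  assumes "\<bar>Im s\<bar> \<le> 1" "\<bar>Im s'\<bar> \<le> 1" "\<bar>Im x\<bar> \<le> 1" "\<bar>Im y\<bar> \<le> 1"
  shows "cmod (psi_term m s x y - psi_term m s' x y) \<le> cmod (s - s') * (1/4 * (1/2) ^ m)"
proof -
  let ?w = "of_real (den m) * x - of_real (num m) * y"
  \<comment> \<open>The frequencies contribute at most \<open>den m\<close> and
    \<open>2 * den m\<close>, the drift at most \<open>1 \<le> den m\<close>.\<close>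
  have Im: "\<bar>Im (?w + of_real (drift m) * s)\<bar> \<le> 4 * den m" if "\<bar>Im s\<bar> \<le> 1" for s
  proof -
    have "\<bar>den m * Im x\<bar> \<le> real (den m) * 1" unfolding abs_mult using assms(3) by (intro mult_mono) auto
    moreover have "\<bar>num m * Im y\<bar> \<le> real (2 * den m) * 1" unfolding abs_mult using assms(4) num_le[of m]
      by (intro mult_mono) auto
    moreover have "\<bar>drift m * Im s\<bar> \<le> 1 * 1" unfolding abs_mult using that drift_le_1[of m]
      by (intro mult_mono) (auto simp: abs_of_pos)
    moreover have "1 \<le> real (den m)" using den_pos[of m] by linarith
    moreover have "Im (?w + of_real (drift m) * s) = den m * Im x - num m * Im y + drift m * Im s" by simp
    ultimately show ?thesis by linarith
  qed
  have "cmod (psi_term m s x y - psi_term m s' x y) = amp m * cmod (hcx (?w + of_real (drift m) * s) - hcx (?w + of_real (drift m) * s'))"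
    by (simp add: psi_term_def norm_mult flip: right_diff_distrib)
  also have "\<dots> \<le> amp m * (6 * pi * exp (4 * pi * (4 * den m)) * cmod ((?w + of_real (drift m) * s) - (?w + of_real (drift m) * s')))"
    by (intro mult_left_mono hcx_lipschitz Im[OF assms(1), simplified] Im[OF assms(2), simplified]) (use Im[OF assms(1)] Im[OF assms(2)] in auto)
  also have "cmod ((?w + of_real (drift m) * s) - (?w + of_real (drift m) * s')) = drift m * cmod (s - s')"
    by (simp add: norm_mult abs_of_pos flip: right_diff_distrib)
  also have "amp m * (6 * pi * exp (4 * pi * (4 * den m)) * (drift m * cmod (s - s'))) = cmod (s - s') * (6 * pi * exp (4 * pi * (4 * den m)) * (amp m * drift m))"
    by simp
  also have "\<dots> \<le> cmod (s - s') * (1/4 * (1/2) ^ m)"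
    by (intro mult_left_mono amp_drift_exp) auto
  finally show ?thesis .
qed

lemma psi_term_bound:
  assumes "\<bar>Im s\<bar> \<le> 1" "\<bar>Im x\<bar> \<le> 1" "\<bar>Im y\<bar> \<le> 1"
  shows "cmod (psi_term m s x y) \<le> cmod s * (1/4 * (1/2) ^ m)"
proof -
  have "psi_term m 0 x y = 0" by (simp add: psi_term_def)
  then show ?thesis using psi_term_lipschitz[of s 0 x y m] assms by simp
qed

lemma summable_psi_term:
  assumes "\<bar>Im s\<bar> \<le> 1" "\<bar>Im x\<bar> \<le> 1" "\<bar>Im y\<bar> \<le> 1"
  shows "summable (\<lambda>m. psi_term m s x y)"
  by (rule summable_comparison_test'[OF summable_mult[OF summable_weight, of "cmod s"], where N = 0])
     (use psi_term_bound[OF assms] in auto)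

text \<open>The weights are the same as on the real line and sum to \<open>1/2\<close>, so solving
  for the complex clock is a fixed-point problem.\<close>

lemma psi_contraction:
  assumes "\<bar>Im s\<bar> \<le> 1" "\<bar>Im s'\<bar> \<le> 1" "\<bar>Im x\<bar> \<le> 1" "\<bar>Im y\<bar> \<le> 1"
  shows "cmod (psi s x y - psi s' x y) \<le> cmod (s - s') / 2"
proof -
  have "psi s x y - psi s' x y = (\<Sum>m. psi_term m s x y - psi_term m s' x y)"
    unfolding psi_def using assms by (intro suminf_diff summable_psi_term)
  also have "cmod \<dots> \<le> (\<Sum>m. cmod (s - s') * (1/4 * (1/2) ^ m))"
    by (rule norm_suminf_le[OF psi_term_lipschitz[OF assms] summable_mult[OF summable_weight]])
  also have "\<dots> = cmod (s - s') / 2"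
    using suminf_mult[OF summable_weight, of "cmod (s - s')"] unfolding suminf_weight by simp
  finally show ?thesis .
qed

lemma Phi_of_real:
  fixes s x y :: real
  shows "of_real (Phi s (torus_proj (x, y))) = of_real s + psi (of_real s) (of_real x) (of_real y)"
proof -
  have "psi_term m (of_real s) (of_real x) (of_real y) = of_real (Phi_term m s (torus_proj (x, y)))" for m
  proof -
    have "Phi_term m s (torus_proj (x, y)) = amp m * (hfun (den m * x - num m * y + drift m * s) - hfun (den m * x - num m * y))"
      by (simp add: Phi_term_def chi_torus_proj cis_mult hcirc_cis flip: distrib_left)
    then show ?thesis unfolding psi_term_def
      by (simp add: hcx_of_real[symmetric])
  qed
  then show ?thesis
    by (simp add: Phi_eq psi_def suminf_of_real summable_Phi_term)
qed

text \<open>Closeness of \<open>f\<close> to the real number \<open>s0\<close> keeps its values in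
  the strip of width 1, where the series has a uniform summable majorant.\<close>

lemma separately_holomorphic_psi:
  assumes f: "separately_holomorphic r f" and fb: "\<And>p. p \<in> polydisc r \<Longrightarrow> cmod (f p - of_real s0) \<le> 1" and r: "r \<le> 1"
  shows "separately_holomorphic r (\<lambda>p. psi (f p) (of_real x0 + fst (snd p)) (of_real y0 + snd (snd p)))"
proof (rule separately_holomorphic_limit)
  let ?X = "\<lambda>p::complex \<times> complex \<times> complex. of_real x0 + fst (snd p)" and ?Y = "\<lambda>p::complex \<times> complex \<times> complex. of_real y0 + snd (snd p)"
  have hcx: "hcx holomorphic_on UNIV" unfolding hcx_def[abs_def] by (intro holomorphic_intros)
  have "separately_holomorphic r (\<lambda>p. psi_term m (f p) (?X p) (?Y p))" for m
    unfolding psi_term_def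
    by (intro separately_holomorphic_cmult separately_holomorphic_diff separately_holomorphic_compose[OF _ hcx]
        separately_holomorphic_add separately_holomorphic_const separately_holomorphic_coords f)
  then show "separately_holomorphic r (\<lambda>p. \<Sum>m<n. psi_term m (f p) (?X p) (?Y p))" for n
    by (intro separately_holomorphic_sum)
  show "uniform_limit (polydisc r) (\<lambda>n p. \<Sum>m<n. psi_term m (f p) (?X p) (?Y p)) (\<lambda>p. psi (f p) (?X p) (?Y p)) sequentially"
    unfolding psi_def
  proof (rule Weierstrass_m_test)
    show "summable (\<lambda>m. (\<bar>s0\<bar> + 1) * (1/4 * (1/2) ^ m))" by (rule summable_mult[OF summable_weight])
    fix m p assume p: "p \<in> polydisc r"
    have "cmod (f p) \<le> \<bar>s0\<bar> + 1" using fb[OF p] norm_triangle_sub[of "f p" "of_real s0"] by simp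
    have im: "\<bar>Im (of_real c + z)\<bar> \<le> 1" if "cmod z \<le> 1" for c z
      using abs_Im_le_cmod[of z] that by simp
    have "\<bar>Im (f p)\<bar> \<le> 1" using im[of "f p - of_real s0" s0] fb[OF p] by simp
    moreover have "cmod (fst (snd p)) \<le> 1" "cmod (snd (snd p)) \<le> 1" using p r by auto
    then have "\<bar>Im (?X p)\<bar> \<le> 1" "\<bar>Im (?Y p)\<bar> \<le> 1" using im by blast+
    ultimately have "norm (psi_term m (f p) (?X p) (?Y p)) \<le> cmod (f p) * (1/4 * (1/2) ^ m)" by (rule psi_term_bound)
    also have "\<dots> \<le> (\<bar>s0\<bar> + 1) * (1/4 * (1/2) ^ m)" using \<open>cmod (f p) \<le> \<bar>s0\<bar> + 1\<close> by (intro mult_right_mono) auto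
    finally show "norm (psi_term m (f p) (?X p) (?Y p)) \<le> (\<bar>s0\<bar> + 1) * (1/4 * (1/2) ^ m)" .
  qed
qed

text \<open>
  On the strip \<open>\<bar>Im s\<bar> \<le> 1\<close> the equation \<open>s + psi s x y = t\<close> is solved by iterating a contraction;
  the iterates are holomorphic in each variable, hence so is their limit, which extends \<open>clock\<close>.
\<close>

lemma clock_extension:
  fixes t0 x0 y0 :: real
  obtains r S where "r > 0" "separately_holomorphic r S"
    "\<And>a b c :: real. \<bar>a\<bar> < r \<Longrightarrow> \<bar>b\<bar> < r \<Longrightarrow> \<bar>c\<bar> < r \<Longrightarrow>
       S (of_real a, of_real b, of_real c) = of_real (clock (t0 + a) (torus_proj (x0 + b, y0 + c)))"
proof -
  define s0 where "s0 = clock t0 (torus_proj (x0, y0))"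
  define N where "N s p = of_real t0 + fst p - psi s (of_real x0 + fst (snd p)) (of_real y0 + snd (snd p))" for s and p :: "complex \<times> complex \<times> complex"
  have N0: "N (of_real s0) (0, 0, 0) = of_real s0"
    using Phi_of_real[of s0 x0 y0] by (simp add: N_def s0_def algebra_simps)
  have Nsep: "separately_holomorphic r (\<lambda>p. N (f p) p)"
    if "separately_holomorphic r f" "\<And>p. p \<in> polydisc r \<Longrightarrow> cmod (f p - of_real s0) \<le> 1" "r \<le> 1" for r f
    unfolding N_def
    by (intro separately_holomorphic_diff separately_holomorphic_add separately_holomorphic_const separately_holomorphic_coords
        separately_holomorphic_psi[OF that])
  \<comment> \<open>Continuity at the origin, where \<open>s0\<close> is a fixed point, makes the
    first iterate move \<open>s0\<close> by at most \<open>1/2\<close> on a small polydisc.\<close>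
  have "separately_holomorphic 1 (\<lambda>p. N (of_real s0) p)" by (rule Nsep) (auto intro: separately_holomorphic_const)
  then have "continuous_on (polydisc 1) (N (of_real s0))" by (simp add: separately_holomorphic_def)
  then obtain d where d: "d > 0" "\<And>p. p \<in> polydisc 1 \<Longrightarrow> dist p (0, 0, 0) < d \<Longrightarrow> dist (N (of_real s0) p) (N (of_real s0) (0, 0, 0)) < 1/2"
    unfolding continuous_on_iff by (metis (no_types, lifting) SigmaI cball_trivial centre_in_cball zero_le_one half_gt_zero zero_less_one)
  \<comment> \<open>The product norm is at most the sum of three moduli, hence at most
    \<open>3 * d / 4 < d\<close>.\<close>
  define r where "r = min 1 (d / 4)"
  have r: "r > 0" "r \<le> 1" using d by (auto simp: r_def)
  have start: "cmod (N (of_real s0) p - of_real s0) \<le> 1/2" if p: "p \<in> polydisc r" for p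
  proof -
    obtain a b c where abc: "p = (a, b, c)" by (cases p)
    have "norm (a, b, c) \<le> cmod a + (cmod b + cmod c)"
      using norm_Pair_le[of a "(b, c)"] norm_Pair_le[of b c] by linarith
    also have "\<dots> < d" using p abc d(1) by (auto simp: r_def)
    finally have "dist p (0, 0, 0) < d" by (simp add: abc dist_norm)
    moreover have "p \<in> polydisc 1" using p r by auto
    ultimately show ?thesis using d(2)[of p] by (simp add: N0 dist_norm)
  qed
  have im: "\<bar>Im (of_real c + z)\<bar> \<le> 1" if "cmod z \<le> 1" for c z
    using abs_Im_le_cmod[of z] that by simp
  have im0: "\<bar>Im s\<bar> \<le> 1" if "cmod (s - of_real s0) \<le> 1" for s
    using im[of "s - of_real s0" s0] that by simp
  have contr: "cmod (N s p - N s' p) \<le> cmod (s - s') / 2"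
    if "p \<in> polydisc r" "\<bar>Im s\<bar> \<le> 1" "\<bar>Im s'\<bar> \<le> 1" for s s' p
  proof -
    have "cmod (fst (snd p)) \<le> 1" "cmod (snd (snd p)) \<le> 1" using that(1) r by auto
    then have "\<bar>Im (of_real x0 + fst (snd p))\<bar> \<le> 1" "\<bar>Im (of_real y0 + snd (snd p))\<bar> \<le> 1"
      using im by blast+
    from psi_contraction[OF that(2,3) this] show ?thesis by (simp add: N_def norm_minus_commute)
  qed
  define S where "S n p = ((\<lambda>s. N s p) ^^ n) (of_real s0)" for n p
  have S0: "S 0 p = of_real s0" and SS: "S (Suc n) p = N (S n p) p" for n p by (simp_all add: S_def)
  \<comment> \<open>The first step moves by at most \<open>1/2\<close> and the contraction halves a
    distance of at most 1, so the iterates never leave the unit disc around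
    \<open>s0\<close>.\<close>
  have near: "cmod (S n p - of_real s0) \<le> 1" if p: "p \<in> polydisc r" for n p
  proof (induction n)
    case (Suc n)
    have "cmod (N (S n p) p - N (of_real s0) p) \<le> cmod (S n p - of_real s0) / 2"
      by (rule contr[OF p im0[OF Suc] im0]) simp
    then have "cmod (N (S n p) p - of_real s0) \<le> 1/2 + 1/2"
      using Suc start[OF p] norm_triangle_ineq[of "N (S n p) p - N (of_real s0) p" "N (of_real s0) p - of_real s0"] by simp
    then show ?case by (simp add: SS)
  qed (simp add: S0)
  have sep: "separately_holomorphic r (S n)" for n
  proof (induction n)
    case 0
    then show ?case using separately_holomorphic_const by (simp add: S0[abs_def])
  next
    case (Suc n)
    then show ?case using Nsep[OF Suc near r(2)] by (simp add: SS[abs_def])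
  qed
  have step: "cmod (S (Suc n) p - S n p) \<le> (1/2) ^ n" if p: "p \<in> polydisc r" for n p
  proof (induction n)
    case 0
    then show ?case using start[OF p] by (simp add: S0 SS)
  next
    case (Suc n)
    have "cmod (N (S (Suc n) p) p - N (S n p) p) \<le> cmod (S (Suc n) p - S n p) / 2"
      by (rule contr[OF p im0[OF near[OF p]] im0[OF near[OF p]]])
    then show ?case using Suc by (simp add: SS)
  qed
  define L where "L p = of_real s0 + (\<Sum>n. S (Suc n) p - S n p)" for p
  have tel: "S n p = of_real s0 + (\<Sum>k<n. S (Suc k) p - S k p)" for n p
    using sum_lessThan_telescope[of "\<lambda>k. S k p" n] by (simp add: S0)
  have "uniform_limit (polydisc r) (\<lambda>n p. \<Sum>k<n. S (Suc k) p - S k p) (\<lambda>p. \<Sum>n. S (Suc n) p - S n p) sequentially"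
    by (rule Weierstrass_m_test[OF step]) (auto intro: summable_geometric)
  then have "uniform_limit (polydisc r) (\<lambda>n p. of_real s0 + (\<Sum>k<n. S (Suc k) p - S k p)) L sequentially"
    unfolding L_def by (intro uniform_limit_intros)
  then have ul: "uniform_limit (polydisc r) S L sequentially" by (simp only: tel[symmetric])
  have Lsep: "separately_holomorphic r L" by (rule separately_holomorphic_limit[OF sep ul])
  show ?thesis
  proof (rule that[OF r(1) Lsep])
    fix a b c :: real assume abc: "\<bar>a\<bar> < r" "\<bar>b\<bar> < r" "\<bar>c\<bar> < r"
    let ?p = "(of_real a, of_real b, of_real c) :: complex \<times> complex \<times> complex"
    define q where "q = clock (t0 + a) (torus_proj (x0 + b, y0 + c))"
    have p: "?p \<in> polydisc r" using abc by auto
    \<comment> \<open>At real points the true clock value is a fixed point, so the iterates converge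
      to it.\<close>
    have fixed: "N (of_real q) ?p = of_real q"
      using Phi_of_real[of q "x0 + b" "y0 + c"] by (simp add: N_def q_def algebra_simps)
    have dec: "cmod (S n ?p - of_real q) \<le> (1/2) ^ n * cmod (of_real s0 - of_real q)" for n
    proof (induction n)
      case (Suc n)
      have "cmod (N (S n ?p) ?p - N (of_real q) ?p) \<le> cmod (S n ?p - of_real q) / 2"
        by (rule contr[OF p im0[OF near[OF p]]]) simp
      then show ?case using Suc by (simp add: SS fixed)
    qed (simp add: S0)
    have "(\<lambda>n. (1/2) ^ n * cmod (of_real s0 - of_real q)) \<longlonglongrightarrow> 0 * cmod (of_real s0 - of_real q)"
      by (intro tendsto_mult tendsto_const LIMSEQ_realpow_zero) auto
    then have "(\<lambda>n. S n ?p - of_real q) \<longlonglongrightarrow> 0"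
      by (intro Lim_null_comparison[OF always_eventually[OF allI[OF dec]]]) simp
    then have "(\<lambda>n. S n ?p) \<longlonglongrightarrow> of_real q" by (simp add: LIM_zero_iff)
    moreover have "(\<lambda>n. S n ?p) \<longlonglongrightarrow> L ?p" using tendsto_uniform_limitI[OF ul p] .
    ultimately show "L ?p = of_real (clock (t0 + a) (torus_proj (x0 + b, y0 + c)))"
      unfolding q_def[symmetric] by (rule LIMSEQ_unique[symmetric])
  qed
qed

lemma real_analytic_flow: "real_analytic (\<lambda>q :: real \<times> real \<times> real. flow (fst q) (torus_proj (snd q)))"
proof (rule real_analytic_from_extension)
  fix t x y :: real
  obtain r S where r: "r > 0" and S: "separately_holomorphic r S" and eq: "\<And>a b c :: real. \<bar>a\<bar> < r \<Longrightarrow> \<bar>b\<bar> < r \<Longrightarrow> \<bar>c\<bar> < r \<Longrightarrow>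
       S (of_real a, of_real b, of_real c) = of_real (clock (t + a) (torus_proj (x + b, y + c)))"
    using clock_extension[of t x y] by blast
  define E where "E z = exp (\<i> * (2 * of_real pi) * z)" for z :: complex
  have E: "E holomorphic_on UNIV" unfolding E_def[abs_def] by (intro holomorphic_intros)
  define F where "F p = E ((of_real x + fst (snd p)) + of_real slope * S p)" for p
  define G where "G p = E ((of_real y + snd (snd p)) + S p)" for p
  have "separately_holomorphic r F" "separately_holomorphic r G"
    unfolding F_def G_def
    by (intro separately_holomorphic_compose[OF _ E] separately_holomorphic_add separately_holomorphic_const
        separately_holomorphic_coords separately_holomorphic_cmult S)+
  moreover have "flow (fst (t + a, x + b, y + c)) (torus_proj (snd (t + a, x + b, y + c))) =
      (F (of_real a, of_real b, of_real c), G (of_real a, of_real b, of_real c))"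
    if "\<bar>a\<bar> < r" "\<bar>b\<bar> < r" "\<bar>c\<bar> < r" for a b c
  proof -
    have cis: "E (of_real v) = cis (2 * pi * v)" for v by (simp add: E_def cis_conv_exp mult.assoc)
    define s where "s = clock (t + a) (torus_proj (x + b, y + c))"
    have "flow (t + a) (torus_proj (x + b, y + c)) = torus_proj (slope * s + (x + b), s + (y + c))"
      by (simp add: flow_def s_def[symmetric] lin_def rot_torus_proj)
    moreover have "F (of_real a, of_real b, of_real c) = E (of_real (slope * s + (x + b)))"
      "G (of_real a, of_real b, of_real c) = E (of_real (s + (y + c)))"
      using eq[OF that] by (simp_all add: F_def G_def flip: s_def, simp_all add: add_ac)
    ultimately show ?thesis by (simp only: fst_conv snd_conv cis torus_proj_def)
  qed
  ultimately show "\<exists>r>0. \<exists>F G. separately_holomorphic r F \<and> separately_holomorphic r G \<and>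
     (\<forall>a b c. \<bar>a\<bar> < r \<longrightarrow> \<bar>b\<bar> < r \<longrightarrow> \<bar>c\<bar> < r \<longrightarrow>
        flow (fst (t + a, x + b, y + c)) (torus_proj (snd (t + a, x + b, y + c))) =
        (F (of_real a, of_real b, of_real c), G (of_real a, of_real b, of_real c)))"
    using r by blast
qed

lemma real_analytic_torus_flow_flow: "real_analytic_torus_flow flow"
  unfolding real_analytic_torus_flow_def using flow_on_torus real_analytic_flow by blast

section \<open>Smoothness of the density\<close>

text \<open>The bounds on the derivatives do not depend on the point, so the derived series
  converges uniformly with an error controlled by the tail of \<open>b\<close>.\<close>

lemma has_derivative_suminf:
  fixes f :: "nat \<Rightarrow> 'a :: real_normed_vector \<Rightarrow> real"
  assumes d: "\<And>n x. (f n has_derivative f' n x) (at x)"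
    and b: "\<And>n x h. \<bar>f' n x h\<bar> \<le> b n * norm h" "summable b"
    and s: "\<And>x. summable (\<lambda>n. f n x)"
  shows "((\<lambda>x. \<Sum>n. f n x) has_derivative (\<lambda>h. \<Sum>n. f' n x h)) (at x)"
proof -
  have sh: "summable (\<lambda>n. f' n x h)" for x h
    by (rule summable_comparison_test'[OF summable_mult2[OF b(2), of "norm h"], where N = 0]) (use b(1) in auto)
  have "\<exists>g. \<forall>x\<in>UNIV. (\<lambda>n. f n x) sums g x \<and> (g has_derivative (\<lambda>h. \<Sum>n. f' n x h)) (at x within UNIV)"
  proof (rule has_derivative_series)
    show "(f n has_derivative f' n x) (at x within UNIV)" for n x using d by simp
    show "\<forall>\<^sub>F n in sequentially. \<forall>x\<in>UNIV. \<forall>h. norm ((\<Sum>i<n. f' i x h) - (\<Sum>n. f' n x h)) \<le> e * norm h"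
      if e: "e > 0" for e
    proof -
      have bn: "b n \<ge> 0" if "\<exists>h :: 'a. h \<noteq> 0" for n
      proof -
        obtain h :: 'a where "h \<noteq> 0" using \<open>\<exists>h :: 'a. h \<noteq> 0\<close> by blast
        have "0 \<le> b n * norm h" using b(1)[of n 0 h] by linarith
        then show ?thesis using \<open>h \<noteq> 0\<close> by (simp add: zero_le_mult_iff)
      qed
      have "(\<lambda>n. \<Sum>i. b (i + n)) \<longlonglongrightarrow> 0" using b(2) by (rule suminf_exist_split2)
      then have "\<forall>\<^sub>F n in sequentially. (\<Sum>i. b (i + n)) < e" using e by (intro order_tendstoD(2))
      then show ?thesis
      proof eventually_elim
        case (elim n)
        show ?case
        proof (intro ballI allI)
          fix x h
          have sb: "summable (\<lambda>i. b (i + n))" using b(2) by (simp add: summable_iff_shift)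
          have "(\<Sum>i<n. f' i x h) - (\<Sum>n. f' n x h) = - (\<Sum>i. f' (i + n) x h)"
            using suminf_split_initial_segment[OF sh, of x h n] by simp
          also have "norm \<dots> \<le> (\<Sum>i. b (i + n) * norm h)"
            unfolding norm_minus_cancel
            by (rule norm_suminf_le[OF _ summable_mult2[OF sb]]) (use b(1) in simp)
          also have "\<dots> = (\<Sum>i. b (i + n)) * norm h" by (rule suminf_mult2[OF sb, symmetric])
          also have "\<dots> \<le> e * norm h" using elim by (intro mult_right_mono) auto
          finally show "norm ((\<Sum>i<n. f' i x h) - (\<Sum>n. f' n x h)) \<le> e * norm h" .
        qed
      qed
    qed
    show "(\<lambda>n. f n 0) sums (\<Sum>n. f n 0)" using s by (rule summable_sums)
  qed auto
  then obtain g where g: "\<And>x. (\<lambda>n. f n x) sums g x" "\<And>x. (g has_derivative (\<lambda>h. \<Sum>n. f' n x h)) (at x)"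
    by auto
  have "g = (\<lambda>x. \<Sum>n. f n x)" using g(1) by (auto simp: sums_iff)
  then show ?thesis using g(2) by simp
qed

text \<open>
  Series of two harmonics in the phases \<open>\<theta>\<^sub>m = a\<^sub>m x + b\<^sub>m y\<close>, with coefficients that decay faster than
  any power of the frequency. This class is closed under directional derivatives.
\<close>

definition wave :: "real \<times> real \<times> real \<times> real \<Rightarrow> real \<Rightarrow> real" where
  "wave = (\<lambda>(u, v, w, z) t. u * sin t + v * cos t + w * sin (2 * t) + z * cos (2 * t))"

definition wave_size :: "real \<times> real \<times> real \<times> real \<Rightarrow> real" where
  "wave_size = (\<lambda>(u, v, w, z). \<bar>u\<bar> + \<bar>v\<bar> + \<bar>w\<bar> + \<bar>z\<bar>)"

definition wave_deriv :: "real \<times> real \<times> real \<times> real \<Rightarrow> real \<times> real \<times> real \<times> real" where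
  "wave_deriv = (\<lambda>(u, v, w, z). (- v, u, - 2 * z, 2 * w))"

lemma wave_size_nonneg: "wave_size c \<ge> 0"
  by (cases c) (simp add: wave_size_def)

lemma wave_size_deriv: "wave_size (wave_deriv c) \<le> 2 * wave_size c"
  by (cases c) (simp add: wave_size_def wave_deriv_def)

lemma wave_size_scale: "wave_size (s *\<^sub>R c) = \<bar>s\<bar> * wave_size c"
  by (cases c) (simp add: wave_size_def abs_mult algebra_simps)

lemma wave_scale: "wave (s *\<^sub>R c) t = s * wave c t"
  by (cases c) (simp add: wave_def algebra_simps)

lemma abs_wave_le: "\<bar>wave c t\<bar> \<le> wave_size c"
proof -
  obtain u v w z where c: "c = (u, v, w, z)" by (cases c)
  have "\<bar>x * s\<bar> \<le> \<bar>x\<bar>" if "\<bar>s\<bar> \<le> 1" for x s :: real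
    using mult_left_mono[OF that, of "\<bar>x\<bar>"] by (simp add: abs_mult)
  from this[OF abs_sin_le_one, of u t] this[OF abs_cos_le_one, of v t]
    this[OF abs_sin_le_one, of w "2 * t"] this[OF abs_cos_le_one, of z "2 * t"]
  show ?thesis unfolding c wave_def wave_size_def split by linarith
qed

lemma wave_has_derivative: "(wave c has_real_derivative wave (wave_deriv c) t) (at t)"
  by (cases c) (auto simp: wave_def wave_deriv_def intro!: derivative_eq_intros)

definition rapidly_decreasing :: "(nat \<Rightarrow> real) \<Rightarrow> (nat \<Rightarrow> real) \<Rightarrow> (nat \<Rightarrow> real \<times> real \<times> real \<times> real) \<Rightarrow> bool" where
  "rapidly_decreasing a b c \<longleftrightarrow> (\<forall>k. summable (\<lambda>m. wave_size (c m) * (1 + \<bar>a m\<bar> + \<bar>b m\<bar>) ^ k))"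

definition wave_series :: "(nat \<Rightarrow> real) \<Rightarrow> (nat \<Rightarrow> real) \<Rightarrow> (nat \<Rightarrow> real \<times> real \<times> real \<times> real) \<Rightarrow> real \<times> real \<Rightarrow> real" where
  "wave_series a b c p = (\<Sum>m. wave (c m) (a m * fst p + b m * snd p))"

lemma wave_series_has_derivative:
  assumes c: "rapidly_decreasing a b c"
  shows "(wave_series a b c has_derivative
     (\<lambda>h. \<Sum>m. (a m * fst h + b m * snd h) * wave (wave_deriv (c m)) (a m * fst p + b m * snd p))) (at p)"
proof -
  have s: "summable (\<lambda>m. wave_size (c m) * (1 + \<bar>a m\<bar> + \<bar>b m\<bar>) ^ k)" for k
    using c by (simp add: rapidly_decreasing_def)
  show ?thesis unfolding wave_series_def[abs_def]
  proof (rule has_derivative_suminf[where b = "\<lambda>m. 2 * (wave_size (c m) * (1 + \<bar>a m\<bar> + \<bar>b m\<bar>) ^ 1)"])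
    show "((\<lambda>p. wave (c m) (a m * fst p + b m * snd p)) has_derivative
        (\<lambda>h. (a m * fst h + b m * snd h) * wave (wave_deriv (c m)) (a m * fst p + b m * snd p))) (at p)" for m p
    proof -
      have "((\<lambda>p. a m * fst p + b m * snd p) has_derivative (\<lambda>h. a m * fst h + b m * snd h)) (at p)"
        by (auto intro!: derivative_eq_intros)
      from has_derivative_compose[OF this wave_has_derivative[unfolded has_field_derivative_def]]
      show ?thesis by (simp add: mult.commute)
    qed
    show "\<bar>(a m * fst h + b m * snd h) * wave (wave_deriv (c m)) (a m * fst p + b m * snd p)\<bar>
        \<le> 2 * (wave_size (c m) * (1 + \<bar>a m\<bar> + \<bar>b m\<bar>) ^ 1) * norm h" for m p h
    proof -
      have "\<bar>a m * fst h\<bar> \<le> \<bar>a m\<bar> * norm h" "\<bar>b m * snd h\<bar> \<le> \<bar>b m\<bar> * norm h"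
        using norm_fst_le[of "fst h" "snd h"] norm_snd_le[of "snd h" "fst h"]
        by (simp_all add: abs_mult mult_left_mono)
      then have "\<bar>a m * fst h + b m * snd h\<bar> \<le> \<bar>a m\<bar> * norm h + \<bar>b m\<bar> * norm h" by linarith
      also have "\<dots> \<le> (1 + \<bar>a m\<bar> + \<bar>b m\<bar>) * norm h" by (simp add: distrib_right)
      finally have "\<bar>a m * fst h + b m * snd h\<bar> * \<bar>wave (wave_deriv (c m)) (a m * fst p + b m * snd p)\<bar>
          \<le> ((1 + \<bar>a m\<bar> + \<bar>b m\<bar>) * norm h) * (2 * wave_size (c m))"
        by (intro mult_mono order_trans[OF abs_wave_le wave_size_deriv]) auto
      then show ?thesis by (simp add: abs_mult mult_ac)
    qed
    show "summable (\<lambda>m. 2 * (wave_size (c m) * (1 + \<bar>a m\<bar> + \<bar>b m\<bar>) ^ 1))" by (rule summable_mult[OF s])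
    show "summable (\<lambda>m. wave (c m) (a m * fst p + b m * snd p))" for p
      by (rule summable_comparison_test'[OF s[of 0], where N = 0]) (simp add: abs_wave_le)
  qed
qed

text \<open>A directional derivative keeps the phases and multiplies each coefficient by a frequency
  factor; rapid decrease absorbs it, so the induction runs over all coefficient sequences
  \<open>c\<close>.\<close>

lemma times_differentiable_wave_series:
  "rapidly_decreasing a b c \<Longrightarrow> times_differentiable k (wave_series a b c)"
proof (induction k arbitrary: c)
  case 0
  then show ?case
    unfolding times_differentiable.simps continuous_on_eq_continuous_at[OF open_UNIV]
    by (intro ballI has_derivative_continuous[OF wave_series_has_derivative])
next
  case (Suc k)
  note d = wave_series_has_derivative[OF Suc.prems]
  have "times_differentiable k (\<lambda>p. frechet_derivative (wave_series a b c) (at p) h)" for h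
  proof -
    define c' where "c' m = (a m * fst h + b m * snd h) *\<^sub>R wave_deriv (c m)" for m
    have "rapidly_decreasing a b c'"
      unfolding rapidly_decreasing_def
    proof
      fix k
      have s: "summable (\<lambda>m. 2 * norm h * (wave_size (c m) * (1 + \<bar>a m\<bar> + \<bar>b m\<bar>) ^ Suc k))"
        using Suc.prems unfolding rapidly_decreasing_def by (intro summable_mult) blast
      show "summable (\<lambda>m. wave_size (c' m) * (1 + \<bar>a m\<bar> + \<bar>b m\<bar>) ^ k)"
      proof (rule summable_comparison_test'[OF s, where N = 0])
        fix m
        have "\<bar>a m * fst h\<bar> \<le> \<bar>a m\<bar> * norm h" "\<bar>b m * snd h\<bar> \<le> \<bar>b m\<bar> * norm h"
          using norm_fst_le[of "fst h" "snd h"] norm_snd_le[of "snd h" "fst h"]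
          by (simp_all add: abs_mult mult_left_mono)
        then have "\<bar>a m * fst h + b m * snd h\<bar> \<le> \<bar>a m\<bar> * norm h + \<bar>b m\<bar> * norm h" by linarith
        also have "\<dots> \<le> (1 + \<bar>a m\<bar> + \<bar>b m\<bar>) * norm h" by (simp add: distrib_right)
        finally have "wave_size (c' m) \<le> ((1 + \<bar>a m\<bar> + \<bar>b m\<bar>) * norm h) * (2 * wave_size (c m))"
          unfolding c'_def wave_size_scale by (intro mult_mono wave_size_deriv) (auto simp: wave_size_nonneg)
        then have "wave_size (c' m) * (1 + \<bar>a m\<bar> + \<bar>b m\<bar>) ^ k \<le> ((1 + \<bar>a m\<bar> + \<bar>b m\<bar>) * norm h) * (2 * wave_size (c m)) * (1 + \<bar>a m\<bar> + \<bar>b m\<bar>) ^ k"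
          by (intro mult_right_mono) auto
        then show "norm (wave_size (c' m) * (1 + \<bar>a m\<bar> + \<bar>b m\<bar>) ^ k) \<le> 2 * norm h * (wave_size (c m) * (1 + \<bar>a m\<bar> + \<bar>b m\<bar>) ^ Suc k)"
          by (simp add: wave_size_nonneg abs_mult mult_ac)
      qed
    qed
    moreover have "frechet_derivative (wave_series a b c) (at p) h = wave_series a b c' p" for p
      unfolding frechet_derivative_at[OF d, symmetric] by (simp add: wave_series_def c'_def wave_scale)
    ultimately show ?thesis using Suc.IH by simp
  qed
  moreover have "wave_series a b c differentiable (at p)" for p
    using d unfolding differentiable_def by blast
  ultimately show ?case by simp
qed

lemma times_differentiable_add_const: "times_differentiable k f \<Longrightarrow> times_differentiable k (\<lambda>x. C + f x)"
proof (cases k)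
  case (Suc n)
  assume f: "times_differentiable k f"
  have "((\<lambda>x. C + f x) has_derivative frechet_derivative f (at x)) (at x)" for x
    using f Suc by (auto intro!: derivative_eq_intros simp: frechet_derivative_works[symmetric])
  then have "frechet_derivative (\<lambda>x. C + f x) (at x) = frechet_derivative f (at x)" "(\<lambda>x. C + f x) differentiable (at x)" for x
    using frechet_derivative_at[symmetric] unfolding differentiable_def by blast+
  then show ?thesis using f Suc by simp
qed (auto intro: continuous_on_add)

lemma smooth_phi: "smooth (\<lambda>p. phi (torus_proj p))"
proof -
  define a where "a m = 2 * pi * den m" for m
  define b where "b m = - (2 * pi * num m)" for m
  define c :: "nat \<Rightarrow> real \<times> real \<times> real \<times> real"
    where "c m = (- 2 * pi * (amp m * drift m)) *\<^sub>R (1, 0, 2, 0)" for m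
  have phi: "phi (torus_proj p) = 1 + wave_series a b c p" for p
  proof -
    obtain x y where p: "p = (x, y)" by (cases p)
    have "amp m * drift m * dcirc (chi m (torus_proj p)) = wave (c m) (a m * x + b m * y)" for m
    proof -
      have "dcirc (chi m (torus_proj p)) = hder (den m * x - num m * y)" unfolding p chi_torus_proj dcirc_cis ..
      moreover have "a m * x + b m * y = 2 * pi * (den m * x - num m * y)" by (simp add: a_def b_def algebra_simps)
      moreover have "hder w = - 2 * pi * wave (1, 0, 2, 0) (2 * pi * w)" for w
        by (simp add: hder_def wave_def mult.assoc[symmetric])
      ultimately show ?thesis unfolding c_def wave_scale by simp
    qed
    then show ?thesis by (simp add: phi_def wave_series_def p)
  qed
  have "rapidly_decreasing a b c"
    unfolding rapidly_decreasing_def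
  proof
    fix k
    \<comment> \<open>One factor \<open>(1/2) ^ den m\<close> of the coefficient defeats the power
      of the frequency; the spare factor \<open>(1/2) ^ m\<close> makes the series summable.\<close>
    have "(\<lambda>q. (21 * real q) ^ k * (1/2) ^ q) \<longlonglongrightarrow> 0" by real_asymp
    then have "Bseq (\<lambda>q. (21 * real q) ^ k * (1/2) ^ q)" by (intro convergent_imp_Bseq) (auto simp: convergent_def)
    then obtain B where B: "B > 0" "\<And>q. \<bar>(21 * real q) ^ k * (1/2) ^ q\<bar> \<le> B" by (auto elim!: BseqE)
    have "summable (\<lambda>m. 6 * pi * B * (1/2) ^ m)" by (intro summable_mult summable_geometric) auto
    then show "summable (\<lambda>m. wave_size (c m) * (1 + \<bar>a m\<bar> + \<bar>b m\<bar>) ^ k)"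
    proof (rule summable_comparison_test'[where N = 0])
      fix m
      have "wave_size (c m) = 6 * pi * (amp m * drift m)"
        unfolding c_def wave_size_scale by (simp add: wave_size_def abs_mult abs_of_pos)
      also have "\<dots> \<le> 6 * pi * (1/2) ^ (200 * den m)" by (intro mult_left_mono amp_drift_le) auto
      also have "\<dots> \<le> 6 * pi * (1/2) ^ (den m + m)"
        using den_gt[of m] by (intro mult_left_mono power_decreasing) auto
      finally have 1: "wave_size (c m) \<le> 6 * pi * (1/2) ^ (den m + m)" .
      have "1 + \<bar>a m\<bar> + \<bar>b m\<bar> = 1 + 2 * pi * (real (den m) + real (num m))"
        by (simp add: a_def b_def distrib_left)
      \<comment> \<open>With \<open>10/3\<close> as an upper bound for \<open>pi\<close> and
        \<open>num m \<le> 2 * den m\<close>, the total is \<open>1 + 20 = 21\<close> multiples of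
        \<open>den m\<close>.\<close>
      also have "\<dots> \<le> real (den m) + 2 * (10/3) * (real (den m) + 2 * real (den m))"
        using num_le[of m] den_gt[of m] pi_less_4 pi_approx(2)
        by (intro add_mono mult_mono) (auto simp: Suc_le_eq)
      also have "\<dots> = 21 * real (den m)" by simp
      finally have 2: "(1 + \<bar>a m\<bar> + \<bar>b m\<bar>) ^ k \<le> (21 * real (den m)) ^ k" by (intro power_mono) auto
      have "wave_size (c m) * (1 + \<bar>a m\<bar> + \<bar>b m\<bar>) ^ k \<le> 6 * pi * (1/2) ^ (den m + m) * (21 * real (den m)) ^ k"
        by (intro mult_mono 1 2) auto
      also have "\<dots> = 6 * pi * ((21 * real (den m)) ^ k * (1/2) ^ den m) * (1/2) ^ m"
        by (simp add: power_add)
      also have "\<dots> \<le> 6 * pi * B * (1/2) ^ m"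
        using B(2)[of "den m"] by (intro mult_right_mono mult_left_mono) auto
      finally show "norm (wave_size (c m) * (1 + \<bar>a m\<bar> + \<bar>b m\<bar>) ^ k) \<le> 6 * pi * B * (1/2) ^ m"
        by (simp add: wave_size_nonneg abs_mult)
    qed
  qed
  then show ?thesis
    unfolding smooth_def phi using times_differentiable_wave_series times_differentiable_add_const by blast
qed

theorem corollary6p4:
  shows "\<exists>(T :: real \<Rightarrow> complex \<times> complex \<Rightarrow> complex \<times> complex) (\<mu> :: (complex \<times> complex) measure).
           real_analytic_torus_flow T \<and>
           smooth_torus_measure \<mu> \<and> prob_space \<mu> \<and>
           measure_preserving_flow \<mu> T \<and>
           weakly_mixing \<mu> T \<and>
           \<not> reversible \<mu> T"
proof -
  have "smooth_torus_measure mu"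
    unfolding smooth_torus_measure_def mu_def
    using phi_bounds smooth_phi by (intro exI[of _ phi]) force
  then show ?thesis
    using real_analytic_torus_flow_flow prob_space_mu measure_preserving_flow_flow weakly_mixing_flow not_reversible_flow
    by blast
qed

end
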